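(* Let $p\in[1,\infty)$ and let $\mu^\bullet,\lambda^\bullet,\xi^\bullet$ be three equivariant random measures on $M$ of unit intensity, all defined on the same probability space and with finite mutual optimal mean transportation costs. Then: (i) $\mathbb W_p(\lambda^\bullet,\mu^\bullet)=0$ if and only if $\lambda^\omega=\mu^\omega$ for $\mathbb P$-a.e. $\omega$. (ii) $\mathbb W_p(\lambda^\bullet,\mu^\bullet)=\mathbb W_p(\mu^\bullet,\lambda^\bullet)$. (iii) $\mathbb W_p(\lambda^\bullet,\mu^\bullet)\le\mathbb W_p(\lambda^\bullet,\xi^\bullet)+\mathbb W_p(\xi^\bullet,\mu^\bullet)$.
   Context: Setting. $(M,d,m)$ is a complete connected smooth non-compact Riemannian manifold with Riemannian distance $d$ and Riemannian volume $m$. $G$ is a group of isometries of $M$ acting properly discontinuously (for every $x\in M$ and compact $K\subset M$, $gx\in K$ for only finitely many $g\in G$), cocompactly ($M/G$ is compact) and freely ($gx=x$ for one $x$ implies $g=\mathrm{id}$). A fundamental region is a measurable set $F\subset M$ with $\bigcup_{g\in G}gF=M$ and $F\cap gF=\emptyset$ for $g\ne \mathrm{id}$. $B_0$ is a fixed fundamental region: the interior of a Dirichlet region $D=\{x: d(x,p_0)\le d(x,gp_0)\ \forall g\in G\}$ ($p_0\in M$ fixed) together with a measurable selection of exactly one point from each orbit meeting $\partial D$. The volume is scaled so that $m(B_0)=1$. Random measures. $(\Omega,\mathfrak A,\mathbb P)$ is a probability space, $\Omega$ a compact metric space with completed Borel $\sigma$-field $\mathfrak A$, with a measurable flow $(\theta_g)_{g\in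 G}$ on $\Omega$ ($(\omega,g)\mapsto\theta_g\omega$ measurable, $\theta_{\mathrm{id}}=\mathrm{id}$, $\theta_g\circ\theta_h=\theta_{gh}$); $\mathbb P$ is stationary: $\mathbb P\circ\theta_g=\mathbb P$ for all $g$. $\mathcal M(X)$ is the set of Radon measures on $X$ with the vague topology. A random measure on $M$ is a measurable map $\lambda^\bullet:\Omega\to\mathcal M(M)$; it is equivariant if $\lambda^{\theta_g\omega}(gA)=\lambda^\omega(A)$ for all $g,\omega$ and Borel $A$. A random measure $q^\bullet:\Omega\to\mathcal M(M\times M)$ is equivariant if $q^{\theta_g\omega}(gA\times gB)=q^\omega(A\times B)$ for all $g,\omega$ and Borel $A,B$. The intensity of $\lambda^\bullet$ is $\mathbb E[\lambda^\bullet(B_0)]$; unit intensity means it equals $1$. Cost. A semicoupling of measures $\lambda,\mu$ on $M$ is a measure $q$ on $M\times M$ with $(\pi_1)_*q\le\lambda$, $(\pi_2)_*q=\mu$; $\Pi_{es}(\lambda^\bullet,\mu^\bullet)$ is the set of equivariant random measures $q^\bullet$ on $M\times M$ such that $q^\omega$ is a semicoupling of $\lambda^\omega,\mu^\omega$ for a.e. $\omega$ (for equal intensities these are automatically couplings). For random measures of unit intensity, $$\mathbb W_p^p(\lambda^\bullet,\mu^\bullet)=\inf_{q^\bullet\in\Pi_{es}(\lambda^\bullet,\mu^\bullet)}\mathbb E\Big[\int_{M\times B_0}d^p(x,y)\,q^\bullet(dx,dy)\Big].$$ *)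

theory Defs
  imports "HOL-Analysis.Analysis" "HOL-Probability.Probability"
begin

section \<open>Riemannian manifolds\<close>

text \<open>The manifold is a whole type of class \<^class>\<open>metric_space\<close>; its manifold topology is the topology
  of \<^const>\<open>dist\<close>, and \<^const>\<open>dist\<close> is required below to be the Riemannian distance.\<close>

primrec Ck_on :: "nat \<Rightarrow> ('e::euclidean_space \<Rightarrow> 'f::real_normed_vector) \<Rightarrow> 'e set \<Rightarrow> bool" where
  "Ck_on 0 f S \<longleftrightarrow> continuous_on S f"
| "Ck_on (Suc k) f S \<longleftrightarrow> (\<forall>x\<in>S. f differentiable at x) \<and>
     (\<forall>v. Ck_on k (\<lambda>x. frechet_derivative f (at x) v) S)"

text \<open>Used for open sets only.\<close>
definition smooth_on :: "('e::euclidean_space \<Rightarrow> 'f::real_normed_vector) \<Rightarrow> 'e set \<Rightarrow> bool" where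
  "smooth_on f S \<longleftrightarrow> (\<forall>k. Ck_on k f S)"

text \<open>A chart is a pair of its domain and its coordinate map.\<close>
type_synonym ('a, 'n) chart = "'a set \<times> ('a \<Rightarrow> real^'n)"

definition chart_inv :: "('a, 'n) chart \<Rightarrow> real^'n \<Rightarrow> 'a" where
  "chart_inv c = inv_into (fst c) (snd c)"

definition smooth_atlas :: "('a::topological_space, 'n::finite) chart set \<Rightarrow> bool" where
  "smooth_atlas \<A> \<longleftrightarrow>
     (\<Union>c\<in>\<A>. fst c) = UNIV \<and>
     (\<forall>c\<in>\<A>. open (fst c) \<and> open (snd c ` fst c) \<and>
        homeomorphism (fst c) (snd c ` fst c) (snd c) (chart_inv c)) \<and>
     (\<forall>c\<in>\<A>. \<forall>c'\<in>\<A>. smooth_on (snd c' \<circ> chart_inv c) (snd c ` (fst c \<inter> fst c')))"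

text \<open>A Riemannian metric is given by its coefficient matrices \<open>\<gamma> c x\<close> at the point \<open>x\<close> in the
  chart \<open>c\<close>, which transform as a covariant 2-tensor under change of charts.\<close>
definition riemannian_metric ::
    "('a::topological_space, 'n::finite) chart set \<Rightarrow> (('a, 'n) chart \<Rightarrow> 'a \<Rightarrow> real^'n^'n) \<Rightarrow> bool" where
  "riemannian_metric \<A> \<gamma> \<longleftrightarrow>
     (\<forall>c\<in>\<A>. smooth_on (\<lambda>y. \<gamma> c (chart_inv c y)) (snd c ` fst c)) \<and>
     (\<forall>c\<in>\<A>. \<forall>x\<in>fst c. transpose (\<gamma> c x) = \<gamma> c x \<and> (\<forall>v. v \<noteq> 0 \<longrightarrow> 0 < v \<bullet> (\<gamma> c x *v v))) \<and>
     (\<forall>c\<in>\<A>. \<forall>c'\<in>\<A>. \<forall>x\<in>fst c \<inter> fst c'.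
        let J = jacobian (snd c' \<circ> chart_inv c) (at (snd c x))
        in \<gamma> c x = transpose J ** \<gamma> c' x ** J)"

text \<open>\<open>\<sigma>\<close> maps \<open>{a..b}\<close> into one chart domain, is \<open>C\<^sup>1\<close> there (one-sided derivatives at the end
  points), and has length \<open>L\<close>.\<close>
definition C1_piece ::
    "('a, 'n::finite) chart set \<Rightarrow> (('a, 'n) chart \<Rightarrow> 'a \<Rightarrow> real^'n^'n) \<Rightarrow>
     (real \<Rightarrow> 'a) \<Rightarrow> real \<Rightarrow> real \<Rightarrow> real \<Rightarrow> bool" where
  "C1_piece \<A> \<gamma> \<sigma> a b L \<longleftrightarrow>
     (\<exists>c\<in>\<A>. \<exists>D. \<sigma> ` {a..b} \<subseteq> fst c \<and>
        (\<forall>t\<in>{a..b}. ((snd c \<circ> \<sigma>) has_vector_derivative D t) (at t within {a..b})) \<and>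
        continuous_on {a..b} D \<and>
        L = integral {a..b} (\<lambda>t. sqrt (D t \<bullet> (\<gamma> c (\<sigma> t) *v D t))))"

definition piecewise_C1_length ::
    "('a, 'n::finite) chart set \<Rightarrow> (('a, 'n) chart \<Rightarrow> 'a \<Rightarrow> real^'n^'n) \<Rightarrow>
     (real \<Rightarrow> 'a) \<Rightarrow> real \<Rightarrow> bool" where
  "piecewise_C1_length \<A> \<gamma> \<sigma> L \<longleftrightarrow>
     (\<exists>(N::nat) t l. t 0 = 0 \<and> t N = 1 \<and>
        (\<forall>i<N. t i < t (Suc i) \<and> C1_piece \<A> \<gamma> \<sigma> (t i) (t (Suc i)) (l i)) \<and>
        L = (\<Sum>i<N. l i))"

definition riemannian_dist ::
    "('a, 'n::finite) chart set \<Rightarrow> (('a, 'n) chart \<Rightarrow> 'a \<Rightarrow> real^'n^'n) \<Rightarrow> 'a \<Rightarrow> 'a \<Rightarrow> real" where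
  "riemannian_dist \<A> \<gamma> x y =
     Inf {L. \<exists>\<sigma>. \<sigma> 0 = x \<and> \<sigma> 1 = y \<and> piecewise_C1_length \<A> \<gamma> \<sigma> L}"

definition connected_riemannian_manifold ::
    "('a::metric_space, 'n::finite) chart set \<Rightarrow> (('a, 'n) chart \<Rightarrow> 'a \<Rightarrow> real^'n^'n) \<Rightarrow> bool" where
  "connected_riemannian_manifold \<A> \<gamma> \<longleftrightarrow>
     connected (UNIV :: 'a set) \<and> smooth_atlas \<A> \<and> riemannian_metric \<A> \<gamma> \<and>
     (\<forall>x y. dist x y = riemannian_dist \<A> \<gamma> x y)"

definition riemannian_volume ::
    "('a::metric_space, 'n::finite) chart set \<Rightarrow> (('a, 'n) chart \<Rightarrow> 'a \<Rightarrow> real^'n^'n) \<Rightarrow>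
     'a measure \<Rightarrow> bool" where
  "riemannian_volume \<A> \<gamma> vol \<longleftrightarrow>
     sets vol = sets borel \<and>
     (\<forall>c\<in>\<A>. \<forall>B\<in>sets borel. B \<subseteq> fst c \<longrightarrow>
        emeasure vol B = (\<integral>\<^sup>+y\<in>snd c ` B. ennreal (sqrt (det (\<gamma> c (chart_inv c y)))) \<partial>lborel))"

section \<open>Group actions and fundamental regions\<close>

definition isometry_group :: "('a::metric_space \<Rightarrow> 'a) set \<Rightarrow> bool" where
  "isometry_group G \<longleftrightarrow>
     (\<forall>g\<in>G. surj g \<and> (\<forall>x y. dist (g x) (g y) = dist x y)) \<and>
     id \<in> G \<and> (\<forall>g\<in>G. \<forall>h\<in>G. g \<circ> h \<in> G) \<and> (\<forall>g\<in>G. inv g \<in> G)"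

definition properly_discontinuous :: "('a::topological_space \<Rightarrow> 'a) set \<Rightarrow> bool" where
  "properly_discontinuous G \<longleftrightarrow> (\<forall>x K. compact K \<longrightarrow> finite {g\<in>G. g x \<in> K})"

definition orbit :: "('a \<Rightarrow> 'a) set \<Rightarrow> 'a \<Rightarrow> 'a set" where
  "orbit G x = (\<lambda>g. g x) ` G"

text \<open>\<open>quotient_map\<close> determines \<open>Q\<close>: it is the set of all orbits with the quotient topology.\<close>
definition cocompact :: "('a::topological_space \<Rightarrow> 'a) set \<Rightarrow> bool" where
  "cocompact G \<longleftrightarrow> (\<exists>Q. quotient_map euclidean Q (orbit G) \<and> compact_space Q)"

definition free_action :: "('a \<Rightarrow> 'a) set \<Rightarrow> bool" where
  "free_action G \<longleftrightarrow> (\<forall>g\<in>G. \<forall>x. g x = x \<longrightarrow> g = id)"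

definition fundamental_region :: "('a::topological_space \<Rightarrow> 'a) set \<Rightarrow> 'a set \<Rightarrow> bool" where
  "fundamental_region G F \<longleftrightarrow>
     F \<in> sets borel \<and> (\<Union>g\<in>G. g ` F) = UNIV \<and> (\<forall>g\<in>G. g \<noteq> id \<longrightarrow> F \<inter> g ` F = {})"

definition dirichlet_region :: "('a::metric_space \<Rightarrow> 'a) set \<Rightarrow> 'a \<Rightarrow> 'a set" where
  "dirichlet_region G p0 = {x. \<forall>g\<in>G. dist x p0 \<le> dist x (g p0)}"

definition dirichlet_fundamental_region :: "('a::metric_space \<Rightarrow> 'a) set \<Rightarrow> 'a set \<Rightarrow> bool" where
  "dirichlet_fundamental_region G B0 \<longleftrightarrow>
     fundamental_region G B0 \<and>
     (\<exists>p0 S. let D = dirichlet_region G p0; \<O> = orbit G ` frontier D in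
        B0 = interior D \<union> S \<and> S \<in> sets borel \<and> S \<subseteq> \<Union>\<O> \<and> (\<forall>T\<in>\<O>. \<exists>!y. y \<in> S \<inter> T))"

section \<open>Random measures\<close>

text \<open>All spaces below are locally compact and second countable, where Borel measures that are finite
  on compact sets are automatically regular.\<close>
definition radon_measures :: "'x::topological_space measure set" where
  "radon_measures = {\<nu>. sets \<nu> = sets borel \<and> (\<forall>K. compact K \<longrightarrow> emeasure \<nu> K < \<infinity>)}"

definition Cc :: "('x::topological_space \<Rightarrow> real) set" where
  "Cc = {f. continuous_on UNIV f \<and> compact (closure {x. f x \<noteq> 0})}"

text \<open>The coarsest topology making \<open>\<nu> \<mapsto> \<integral>f d\<nu>\<close> continuous for every \<open>f \<in> C\<^sub>c\<close>.\<close>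
definition vague_topology :: "'x::topological_space measure topology" where
  "vague_topology = topology_generated_by
     {{\<nu>\<in>radon_measures. (\<integral>x. f x \<partial>\<nu>) \<in> V} | f V. f \<in> Cc \<and> open V}"

definition vague_borel :: "'x::topological_space measure measure" where
  "vague_borel = sigma radon_measures {U. openin vague_topology U}"

definition random_measure :: "'w measure \<Rightarrow> ('w \<Rightarrow> 'x::topological_space measure) \<Rightarrow> bool" where
  "random_measure P \<Lambda> \<longleftrightarrow> \<Lambda> \<in> P \<rightarrow>\<^sub>M vague_borel"

definition completed_borel_prob :: "'w::topological_space measure \<Rightarrow> bool" where
  "completed_borel_prob P \<longleftrightarrow> (\<exists>P0. sets P0 = sets borel \<and> prob_space P0 \<and> P = completion P0)"

text \<open>The group \<open>G\<close> carries the discrete \<open>\<sigma>\<close>-field.\<close>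
definition measurable_flow ::
    "'w measure \<Rightarrow> ('a \<Rightarrow> 'a) set \<Rightarrow> (('a \<Rightarrow> 'a) \<Rightarrow> 'w \<Rightarrow> 'w) \<Rightarrow> bool" where
  "measurable_flow P G \<theta> \<longleftrightarrow>
     (\<lambda>(\<omega>, g). \<theta> g \<omega>) \<in> P \<Otimes>\<^sub>M count_space G \<rightarrow>\<^sub>M P \<and>
     \<theta> id = id \<and> (\<forall>g\<in>G. \<forall>h\<in>G. \<theta> g \<circ> \<theta> h = \<theta> (g \<circ> h))"

definition stationary ::
    "'w measure \<Rightarrow> ('a \<Rightarrow> 'a) set \<Rightarrow> (('a \<Rightarrow> 'a) \<Rightarrow> 'w \<Rightarrow> 'w) \<Rightarrow> bool" where
  "stationary P G \<theta> \<longleftrightarrow> (\<forall>g\<in>G. \<forall>A\<in>sets P. emeasure P (\<theta> g ` A) = emeasure P A)"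

definition equivariant ::
    "('a::topological_space \<Rightarrow> 'a) set \<Rightarrow> (('a \<Rightarrow> 'a) \<Rightarrow> 'w \<Rightarrow> 'w) \<Rightarrow> ('w \<Rightarrow> 'a measure) \<Rightarrow> bool" where
  "equivariant G \<theta> \<Lambda> \<longleftrightarrow>
     (\<forall>g\<in>G. \<forall>\<omega>. \<forall>A\<in>sets borel. emeasure (\<Lambda> (\<theta> g \<omega>)) (g ` A) = emeasure (\<Lambda> \<omega>) A)"

definition equivariant2 ::
    "('a::topological_space \<Rightarrow> 'a) set \<Rightarrow> (('a \<Rightarrow> 'a) \<Rightarrow> 'w \<Rightarrow> 'w) \<Rightarrow> ('w \<Rightarrow> ('a \<times> 'a) measure) \<Rightarrow> bool" where
  "equivariant2 G \<theta> q \<longleftrightarrow>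
     (\<forall>g\<in>G. \<forall>\<omega>. \<forall>A\<in>sets borel. \<forall>B\<in>sets borel.
        emeasure (q (\<theta> g \<omega>)) ((g ` A) \<times> (g ` B)) = emeasure (q \<omega>) (A \<times> B))"

definition intensity :: "'w measure \<Rightarrow> 'a set \<Rightarrow> ('w \<Rightarrow> 'a measure) \<Rightarrow> ennreal" where
  "intensity P B0 \<Lambda> = (\<integral>\<^sup>+\<omega>. emeasure (\<Lambda> \<omega>) B0 \<partial>P)"

section \<open>Transportation cost\<close>

definition semicoupling ::
    "('a::topological_space) measure \<Rightarrow> 'a measure \<Rightarrow> ('a \<times> 'a) measure \<Rightarrow> bool" where
  "semicoupling l m q \<longleftrightarrow> sets q = sets borel \<and>
     (\<forall>A\<in>sets borel. emeasure (distr q borel fst) A \<le> emeasure l A) \<and> distr q borel snd = m"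

definition equivariant_semicouplings ::
    "'w measure \<Rightarrow> ('a::topological_space \<Rightarrow> 'a) set \<Rightarrow> (('a \<Rightarrow> 'a) \<Rightarrow> 'w \<Rightarrow> 'w) \<Rightarrow>
     ('w \<Rightarrow> 'a measure) \<Rightarrow> ('w \<Rightarrow> 'a measure) \<Rightarrow> ('w \<Rightarrow> ('a \<times> 'a) measure) set" where
  "equivariant_semicouplings P G \<theta> \<Lambda> M =
     {q. random_measure P q \<and> equivariant2 G \<theta> q \<and> (AE \<omega> in P. semicoupling (\<Lambda> \<omega>) (M \<omega>) (q \<omega>))}"

definition wasserstein_pow ::
    "real \<Rightarrow> 'w measure \<Rightarrow> ('a::metric_space \<Rightarrow> 'a) set \<Rightarrow> (('a \<Rightarrow> 'a) \<Rightarrow> 'w \<Rightarrow> 'w) \<Rightarrow> 'a set \<Rightarrow>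
     ('w \<Rightarrow> 'a measure) \<Rightarrow> ('w \<Rightarrow> 'a measure) \<Rightarrow> ennreal" where
  "wasserstein_pow p P G \<theta> B0 \<Lambda> M =
     (INF q\<in>equivariant_semicouplings P G \<theta> \<Lambda> M.
        \<integral>\<^sup>+\<omega>. (\<integral>\<^sup>+z\<in>UNIV \<times> B0. ennreal (dist (fst z) (snd z) powr p) \<partial>q \<omega>) \<partial>P)"

text \<open>The \<open>p\<close>-th root of \<^const>\<open>wasserstein_pow\<close> in \<open>[0, \<infinity>]\<close>.\<close>
definition wasserstein ::
    "real \<Rightarrow> 'w measure \<Rightarrow> ('a::metric_space \<Rightarrow> 'a) set \<Rightarrow> (('a \<Rightarrow> 'a) \<Rightarrow> 'w \<Rightarrow> 'w) \<Rightarrow> 'a set \<Rightarrow>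
     ('w \<Rightarrow> 'a measure) \<Rightarrow> ('w \<Rightarrow> 'a measure) \<Rightarrow> ennreal" where
  "wasserstein p P G \<theta> B0 \<Lambda> M =
     (let C = wasserstein_pow p P G \<theta> B0 \<Lambda> M
      in if C = \<infinity> then \<infinity> else ennreal (enn2real C powr (1 / p)))"

end

theory Submission
  imports Defs
begin

text \<open>
  By stationarity of \<open>P\<close> and equivariance, the expected mass that the cells \<open>g B0\<close> send into \<open>B0\<close> equals
  the expected mass that \<open>B0\<close> sends into the cells (\<open>mass_transport\<close>, \<open>mass_transport_measure\<close>). This has
  two consequences. A semicoupling of random measures of intensity one is almost surely a coupling,
  since the mass that it leaves behind in \<open>B0\<close> has expectation zero (\<open>AE_coupling\<close>). And the cost of a
  coupling can be counted at its source as well as at its target (\<open>transport_cost_fst\<close>). So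
  exchanging the two factors turns semicouplings of one pair into semicouplings of the reversed pair
  without changing the cost, which is the symmetry of the distance.

  For the triangle inequality one would like to glue two couplings along a disintegration over the
  middle measure \<open>\<xi>\<close> that is measurable in \<open>\<omega>\<close> and equivariant. As the distance is an infimum, a coarser
  gluing is enough. The region \<open>B0\<close> is cut into countably many pieces of diameter at most \<open>\<delta>\<close>, and their
  translates partition the space. The measure that gives \<open>A \<times> C\<close> the sum over the cells \<open>E\<close> of
  \<open>q1 (A \<times> E) * q2 (E \<times> C) / \<xi> E\<close> is an exact coupling of the outer measures, and on rectangles its
  measurability and its equivariance are evident (\<open>glued_random\<close>, \<open>glued_equivariant\<close>). A path
  along \<open>q1\<close> and then \<open>q2\<close> now makes an additional jump of length at most \<open>\<delta>\<close> inside a cell. A weighted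
  convexity inequality, which plays the role of Minkowski's inequality, and one more mass transport,
  for the first leg of the path, show that the \<open>p\<close>-th root of the cost is at most the sum of those of the
  two couplings and \<open>\<delta>\<close> (\<open>transport_cost_glued_le\<close>). Finally \<open>\<delta>\<close> tends to \<open>0\<close>.

  If the distance vanishes, there are couplings of arbitrarily small cost. By Markov's inequality
  the expected mass that leaves finitely many cells and travels further than \<open>\<epsilon>\<close> is arbitrarily small.
  Hence \<open>\<Lambda> K\<close> is almost surely bounded by the mass of \<open>\<mu>\<close> in the \<open>\<epsilon>\<close>-neighbourhood of \<open>K\<close>, for every compact
  \<open>K\<close> and every \<open>\<epsilon>\<close>. Letting \<open>\<epsilon>\<close> tend to \<open>0\<close>, exchanging the roles of \<open>\<Lambda>\<close> and \<open>\<mu>\<close> and running through a countable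
  family of compact sets that determines a Radon measure gives \<open>\<Lambda> = \<mu>\<close> almost surely. Conversely the
  diagonal coupling of a random measure with itself has cost zero.

  The constructed couplings have to be measurable for the Borel field of the vague topology. On a
  locally compact, second countable metric space this topology has a countable base
  (\<open>vague_countable_base\<close>), so it suffices that the mass of every Borel set is
  measurable in \<open>\<omega>\<close> (\<open>random_measureI\<close>).
\<close>

section \<open>Exhaustions and compactly supported functions\<close>

text \<open>The form in which the charts of the manifold enter. The type argument makes the notion available
  for the manifold as well as for its square.\<close>
definition locally_compact_type :: "'x::topological_space itself \<Rightarrow> bool" where
  "locally_compact_type _ \<longleftrightarrow> (\<forall>x::'x. \<exists>U K. open U \<and> compact K \<and> x \<in> U \<and> U \<subseteq> K)"

lemma locally_compact_typeE:
  fixes x :: "'x::topological_space"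
  assumes "locally_compact_type TYPE('x)"
  obtains U K where "open U" "compact K" "x \<in> U" "U \<subseteq> K"
proof -
  have "\<exists>U K. open U \<and> compact K \<and> x \<in> U \<and> U \<subseteq> K"
    using assms unfolding locally_compact_type_def by (rule spec)
  then show ?thesis by (elim exE conjE) (rule that)
qed

lemma locally_compact_type_prod:
  assumes "locally_compact_type TYPE('x::topological_space)" "locally_compact_type TYPE('y::topological_space)"
  shows "locally_compact_type TYPE('x \<times> 'y)"
  unfolding locally_compact_type_def
proof
  fix z :: "'x \<times> 'y"
  obtain U K where "open U" "compact K" "fst z \<in> U" "U \<subseteq> K"
    using locally_compact_typeE[OF assms(1)] .
  moreover obtain U' K' where "open U'" "compact K'" "snd z \<in> U'" "U' \<subseteq> K'"
    using locally_compact_typeE[OF assms(2)] .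
  ultimately show "\<exists>U K. open U \<and> compact K \<and> z \<in> U \<and> U \<subseteq> K"
    by (intro exI[of _ "U \<times> U'"] exI[of _ "K \<times> K'"]) (auto simp: open_Times compact_Times mem_Times_iff)
qed

lemma open_exhaustion:
  assumes locally_compact: "locally_compact_type TYPE('x::{metric_space, second_countable_topology})"
  obtains V :: "nat \<Rightarrow> 'x::{metric_space, second_countable_topology} set"
  where "incseq V" "\<And>n. open (V n)" "\<And>n. compact (closure (V n))" "(\<Union>n. V n) = UNIV"
proof -
  define F where "F = {U::'x set. open U \<and> compact (closure U)}"
  have cover: "\<Union>F = UNIV"
  proof -
    have "x \<in> \<Union>F" for x :: 'x
    proof -
      obtain U K where "open U" "compact K" "x \<in> U" "U \<subseteq> K"
        using locally_compact_typeE[OF locally_compact] .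
      moreover from this have "compact (closure U)"
        by (metis closure_minimal compact_imp_closed closed_closure compact_Int_closed inf.absorb_iff2)
      ultimately show ?thesis unfolding F_def by blast
    qed
    then show ?thesis by blast
  qed
  obtain F' where F': "F' \<subseteq> F" "countable F'" "\<Union>F' = UNIV"
    using Lindelof[of F] cover unfolding F_def by auto
  then have ne: "F' \<noteq> {}" by auto
  define V where "V n = (\<Union>i\<le>n. from_nat_into F' i)" for n
  have in_F: "from_nat_into F' i \<in> F" for i
    using F' ne from_nat_into by blast
  show ?thesis
  proof
    show "incseq V" unfolding V_def by (intro monoI UN_mono) auto
    show "open (V n)" for n unfolding V_def using in_F by (auto simp: F_def)
    show "compact (closure (V n))" for n
      by (induction n) (use in_F in \<open>auto simp: V_def F_def atMost_Suc intro: compact_Un\<close>)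
    show "(\<Union>n. V n) = UNIV"
    proof -
      have "x \<in> (\<Union>n. V n)" for x
      proof -
        obtain S where "S \<in> F'" "x \<in> S" using F'(3) by blast
        then obtain i where "from_nat_into F' i = S"
          using from_nat_into_surj[OF F'(2)] by blast
        then show ?thesis unfolding V_def using \<open>x \<in> S\<close> by blast
      qed
      then show ?thesis by blast
    qed
  qed
qed

lemma compact_subset_exhaustion:
  assumes "incseq V" "\<And>n. open (V n)" "(\<Union>n. V n) = UNIV" "compact K"
  obtains n where "K \<subseteq> V (n::nat)"
proof -
  obtain D where D: "D \<subseteq> range V" "finite D" "K \<subseteq> \<Union>D"
    using compactE[OF assms(4), of "range V"] assms(2,3) by (metis (no_types, lifting) imageE subset_UNIV)
  then obtain N where N: "finite N" "D = V ` N" by (meson finite_subset_image)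
  have "\<Union>D \<subseteq> V (Max (insert 0 N))"
  proof
    fix x assume "x \<in> \<Union>D"
    then obtain i where i: "i \<in> N" "x \<in> V i" unfolding N(2) by blast
    then have "V i \<subseteq> V (Max (insert 0 N))" using N(1) by (intro incseqD[OF assms(1)] Max_ge) auto
    then show "x \<in> V (Max (insert 0 N))" using i by blast
  qed
  then show ?thesis using that D by blast
qed

text \<open>The distance to the complement, which is positive exactly on \<open>V\<close> if \<open>V\<close> is open. The case
  \<open>V = UNIV\<close> is separate because \<^const>\<open>infdist\<close> to the empty set is \<open>0\<close>.\<close>
definition depth_in :: "'x::metric_space set \<Rightarrow> 'x \<Rightarrow> real" where
  "depth_in V x = (if V = UNIV then 1 else infdist x (- V))"

lemma depth_in_nonneg: "0 \<le> depth_in V x"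
  by (simp add: depth_in_def infdist_nonneg)

lemma depth_in_pos_iff: "open V \<Longrightarrow> 0 < depth_in V x \<longleftrightarrow> x \<in> V"
  using in_closed_iff_infdist_zero[of "- V" x] infdist_nonneg[of x "- V"]
  by (auto simp: depth_in_def less_le)

lemma continuous_depth_in: "continuous_on S (depth_in V)"
  unfolding depth_in_def by (cases "V = UNIV") (auto intro!: continuous_intros)

lemma Cc_dominated:
  assumes "continuous_on UNIV g" "\<And>x. g x \<noteq> 0 \<Longrightarrow> x \<in> V" "compact (closure V)"
  shows "g \<in> Cc"
proof -
  have "closure {x. g x \<noteq> 0} \<subseteq> closure V" using assms(2) by (intro closure_mono) auto
  then have "compact (closure {x. g x \<noteq> 0})"
    by (metis assms(3) closed_closure compact_Int_closed inf.absorb_iff2)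
  then show ?thesis using assms(1) by (simp add: Cc_def)
qed

lemma Cc_continuous: "f \<in> Cc \<Longrightarrow> continuous_on UNIV f"
  by (simp add: Cc_def)

lemma Cc_uminus: "f \<in> Cc \<Longrightarrow> (\<lambda>x. - f x) \<in> Cc"
  by (auto simp: Cc_def intro!: continuous_intros)

lemma Cc_add:
  fixes f g :: "'x::metric_space \<Rightarrow> real"
  assumes "f \<in> Cc" "g \<in> Cc" shows "(\<lambda>x. f x + g x) \<in> Cc"
proof (rule Cc_dominated)
  show "compact (closure ({x. f x \<noteq> 0} \<union> {x. g x \<noteq> 0}))"
    using assms by (simp add: Cc_def closure_Un compact_Un)
qed (use assms in \<open>auto simp: Cc_def intro!: continuous_intros\<close>)

lemma Cc_borel: "f \<in> Cc \<Longrightarrow> f \<in> borel_measurable borel"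
  by (auto simp: Cc_def intro: borel_measurable_continuous_onI)

lemma Cc_bounded:
  assumes "f \<in> Cc"
  obtains B where "0 < B" "\<And>x. \<bar>f x\<bar> \<le> B"
proof -
  let ?K = "closure {x. f x \<noteq> 0}"
  have "compact (f ` ?K)"
    using assms by (intro compact_continuous_image) (auto simp: Cc_def intro: continuous_on_subset)
  then obtain B where B: "0 < B" "\<And>x. x \<in> ?K \<Longrightarrow> \<bar>f x\<bar> \<le> B"
    by (auto dest!: compact_imp_bounded simp: bounded_pos)
  have "\<bar>f x\<bar> \<le> B" for x
    using B closure_subset[of "{x. f x \<noteq> 0}"] by (cases "f x = 0") auto
  then show ?thesis using that B by blast
qed

lemma radon_measuresD:
  assumes "\<nu> \<in> radon_measures"
  shows "sets \<nu> = sets borel" "space \<nu> = UNIV" "\<And>K. compact K \<Longrightarrow> emeasure \<nu> K < \<infinity>"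
  using assms by (auto simp: radon_measures_def dest: sets_eq_imp_space_eq)

lemma Cc_integrable:
  fixes f :: "'x::metric_space \<Rightarrow> real"
  assumes f: "f \<in> Cc" and nu: "\<nu> \<in> radon_measures"
  shows "integrable \<nu> f"
proof -
  note [measurable_cong] = radon_measuresD(1)[OF nu]
  let ?K = "closure {x. f x \<noteq> 0}"
  have K: "compact ?K" using f by (simp add: Cc_def)
  obtain B where B: "0 < B" "\<And>x. \<bar>f x\<bar> \<le> B" using Cc_bounded[OF f] by blast
  have "integrable \<nu> (indicator ?K :: _ \<Rightarrow> real)"
    using radon_measuresD(3)[OF nu K] radon_measuresD(1)[OF nu] by (intro integrable_real_indicator) auto
  then have "integrable \<nu> (\<lambda>x. B * indicator ?K x)" by simp
  then show ?thesis
  proof (rule Bochner_Integration.integrable_bound)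
    show "f \<in> borel_measurable \<nu>" using Cc_borel[OF f] radon_measuresD(1)[OF nu] by (simp cong: measurable_cong_sets)
    have "f x \<noteq> 0 \<Longrightarrow> x \<in> ?K" for x using closure_subset[of "{x. f x \<noteq> 0}"] by auto
    then show "AE x in \<nu>. norm (f x) \<le> norm (B * indicator ?K x)"
      using B by (intro AE_I2) (auto split: split_indicator)
  qed
qed

text \<open>The height \<open>r\<close>, the centre \<open>d\<close> and the inverse radius \<open>n\<close> will range over countable sets, and
  pointwise maxima of finitely many bumps then still form a countable family.\<close>
definition bump :: "real \<times> 'x::metric_space \<times> nat \<Rightarrow> 'x \<Rightarrow> real" where
  "bump t x = (case t of (r, d, n) \<Rightarrow> r * max 0 (1 - real n * dist x d))"

definition max_bumps :: "(real \<times> 'x::metric_space \<times> nat) list \<Rightarrow> 'x \<Rightarrow> real" where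
  "max_bumps ts x = fold (\<lambda>t. max (bump t x)) ts 0"

lemma max_bumps_snoc: "max_bumps (ts @ [t]) x = max (bump t x) (max_bumps ts x)"
  by (simp add: max_bumps_def)

lemma max_bumps_Nil: "max_bumps [] x = 0"
  by (simp add: max_bumps_def)

lemma continuous_max_bumps: "continuous_on S (max_bumps ts)"
proof (induction ts rule: rev_induct)
  case Nil
  then show ?case by (simp add: max_bumps_def)
next
  case (snoc t ts)
  have "continuous_on S (bump t)" unfolding bump_def by (cases t) (auto intro!: continuous_intros)
  then show ?case using snoc by (simp add: max_bumps_snoc[abs_def] continuous_on_max)
qed

lemma max_bumps_nonneg: "0 \<le> max_bumps ts x"
  by (induction ts rule: rev_induct) (auto simp: max_bumps_Nil max_bumps_snoc)

text \<open>Near \<open>x\<close> the function \<open>f\<close> exceeds a rational \<open>r > a\<close>. A bump of height \<open>r\<close> that is so narrow that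
  it lives there stays below \<open>f\<close>, and it exceeds \<open>a\<close> at \<open>x\<close> if its centre is close enough to \<open>x\<close>.\<close>
lemma bump_approx_below:
  fixes f :: "'x::metric_space \<Rightarrow> real"
  assumes f: "continuous_on UNIV f" "\<And>x. 0 \<le> f x"
    and D: "\<forall>U::'x set. open U \<longrightarrow> U \<noteq> {} \<longrightarrow> (\<exists>d\<in>D. d \<in> U)" and a: "0 \<le> a" "a < f x"
  shows "\<exists>t\<in>\<rat> \<times> D \<times> UNIV. (\<forall>y. bump t y \<le> f y) \<and> a < bump t x"
proof -
  obtain b where b: "a < b" "b < f x" using a dense by blast
  obtain r where r: "r \<in> \<rat>" "a < r" "r < b" using Rats_dense_in_real[OF b(1)] by blast
  have "open {y. b < f y}" using f(1) by (intro open_Collect_less) auto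
  then obtain \<eta> where \<eta>: "0 < \<eta>" "\<And>y. dist y x < \<eta> \<Longrightarrow> b < f y"
    using b by (auto simp: open_dist)
  obtain n where n: "2 / \<eta> < real n" using reals_Archimedean2 by blast
  have n0: "0 < real n" using n \<eta>(1) by (smt (verit) divide_pos_pos)
  have n\<eta>: "2 < real n * \<eta>" using n \<eta>(1) by (simp add: pos_divide_less_eq)
  \<comment> \<open>The first bound keeps the support of the bump within distance \<open>\<eta>\<close> of \<open>x\<close>, as \<open>1 / n < \<eta> / 2\<close>; the second one keeps its value at \<open>x\<close> above \<open>a\<close>.\<close>
  define e where "e = min (\<eta>/2) ((1 - a / r) / n)"
  have r0: "0 < r" using r a by linarith
  have "0 < e" unfolding e_def using r r0 n0 \<eta> by (simp add: field_simps)
  obtain d where d: "d \<in> D" "d \<in> ball x e"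
    using D[rule_format, of "ball x e"] \<open>0 < e\<close> by auto
  let ?t = "(r, d, n)"
  have "bump ?t y \<le> f y" for y
  proof (cases "real n * dist y d < 1")
    case True
    have "real n * dist y x \<le> real n * dist y d + real n * dist d x"
      using n0 by (metis dist_triangle distrib_left mult_left_mono less_imp_le)
    also have "\<dots> \<le> 1 + real n * (\<eta> / 2)"
      using d True n0 unfolding e_def by (intro add_mono mult_left_mono) (auto simp: dist_commute)
    also have "\<dots> < real n * \<eta>" using n\<eta> by (simp add: field_simps)
    finally have "dist y x < \<eta>" using n0 by simp
    then have "b < f y" by (rule \<eta>)
    moreover have "bump ?t y \<le> r * 1" unfolding bump_def using r0 n0 by (auto intro!: mult_left_mono)
    ultimately show ?thesis using r by linarith
  next
    case False
    then show ?thesis using f(2) by (simp add: bump_def)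
  qed
  moreover have "a < bump ?t x"
  proof -
    have "dist x d < (1 - a / r) / n" using d unfolding e_def by simp
    then have "real n * dist x d < 1 - a / r" using n0 by (simp add: field_simps)
    then have "a / r < max 0 (1 - real n * dist x d)" by linarith
    then show ?thesis unfolding bump_def using r0 by (simp add: field_simps)
  qed
  ultimately show ?thesis using r d by (intro bexI[of _ ?t]) auto
qed

text \<open>By the preceding lemma \<open>f\<close> is the pointwise supremum of the countably many bumps below it. The
  maxima of the first \<open>n\<close> of them increase to \<open>f\<close>, so their integrals converge for every \<open>\<nu>\<close>.\<close>
lemma max_bumps_approx_below:
  fixes f :: "'x::metric_space \<Rightarrow> real"
  assumes f: "f \<in> Cc" "\<And>x. 0 \<le> f x" and nu: "\<nu> \<in> radon_measures" and e: "0 < e"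
    and D: "countable D" "\<forall>U::'x set. open U \<longrightarrow> U \<noteq> {} \<longrightarrow> (\<exists>d\<in>D. d \<in> U)"
  shows "\<exists>ts\<in>lists (\<rat> \<times> D \<times> UNIV). max_bumps ts \<in> Cc \<and> (\<forall>y. max_bumps ts y \<le> f y) \<and>
           (\<integral>x. f x \<partial>\<nu>) - e < (\<integral>x. max_bumps ts x \<partial>\<nu>)"
proof -
  define T where "T = {t\<in>\<rat> \<times> D \<times> UNIV. \<forall>y. bump t y \<le> f y}"
  have "countable T" unfolding T_def
    by (rule countable_subset[of _ "\<rat> \<times> D \<times> UNIV"]) (auto intro!: countable_SIGMA D countable_rat)
  obtain d where "d \<in> D" using D(2)[rule_format, of UNIV] by auto
  then have "(0, d, 0) \<in> T" using f(2) by (auto simp: T_def bump_def)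
  then have T_ne: "T \<noteq> {}" by auto
  define ts where "ts n = map (from_nat_into T) [0..<n]" for n
  have ts_T: "set (ts n) \<subseteq> T" for n
    unfolding ts_def using from_nat_into[OF T_ne] by auto
  have ts_Suc: "max_bumps (ts (Suc n)) x = max (bump (from_nat_into T n) x) (max_bumps (ts n) x)" for n x
    by (simp add: ts_def max_bumps_snoc)
  have le: "max_bumps (ts n) y \<le> f y" for n y
  proof (induction n)
    case 0 then show ?case using f(2) by (simp add: ts_def max_bumps_Nil)
  next
    case (Suc n)
    have "bump (from_nat_into T n) y \<le> f y" using from_nat_into[OF T_ne, of n] by (simp add: T_def)
    then show ?case using Suc by (simp add: ts_Suc)
  qed
  have Cc: "max_bumps (ts n) \<in> Cc" for n
  proof (rule Cc_dominated[OF continuous_max_bumps])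
    show "compact (closure {x. f x \<noteq> 0})" using f by (simp add: Cc_def)
    show "x \<in> {x. f x \<noteq> 0}" if "max_bumps (ts n) x \<noteq> 0" for x
      using le[of n x] max_bumps_nonneg[of "ts n" x] that by auto
  qed
  have mono: "incseq (\<lambda>n. max_bumps (ts n) x)" for x
    by (rule incseq_SucI) (simp add: ts_Suc)
  have lim: "(\<lambda>n. max_bumps (ts n) x) \<longlonglongrightarrow> f x" for x
  proof (rule increasing_tendsto)
    show "\<forall>\<^sub>F n in sequentially. max_bumps (ts n) x \<le> f x" by (simp add: le)
    fix a assume a: "a < f x"
    show "\<forall>\<^sub>F n in sequentially. a < max_bumps (ts n) x"
    proof (cases "0 \<le> a")
      case True
      then obtain t where t: "t \<in> T" "a < bump t x"
        using bump_approx_below[OF Cc_continuous[OF f(1)] f(2) D(2) True a] unfolding T_def by auto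
      then obtain k where k: "from_nat_into T k = t"
        using from_nat_into_surj[OF \<open>countable T\<close>] by blast
      have "a < max_bumps (ts (Suc k)) x" using t k by (simp add: ts_Suc)
      then have "a < max_bumps (ts n) x" if "Suc k \<le> n" for n
        using incseqD[OF mono that, of x] by linarith
      then show ?thesis using eventually_at_top_linorder by blast
    next
      case False
      have "a < max_bumps (ts n) x" for n using False max_bumps_nonneg[of "ts n" x] by linarith
      then show ?thesis by simp
    qed
  qed
  have "(\<lambda>n. \<integral>x. max_bumps (ts n) x \<partial>\<nu>) \<longlonglongrightarrow> (\<integral>x. f x \<partial>\<nu>)"
  proof (rule integral_dominated_convergence[where w = f])
    show "integrable \<nu> f" by (rule Cc_integrable[OF f(1) nu])
    show "AE x in \<nu>. norm (max_bumps (ts i) x) \<le> f x" for i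
      using le max_bumps_nonneg[of "ts i"] by (intro AE_I2) simp
    show "max_bumps (ts i) \<in> borel_measurable \<nu>" for i
      using Cc_integrable[OF Cc nu] by (rule borel_measurable_integrable)
    show "f \<in> borel_measurable \<nu>"
      using Cc_integrable[OF f(1) nu] by (rule borel_measurable_integrable)
  qed (use lim in auto)
  then have "\<forall>\<^sub>F n in sequentially. (\<integral>x. f x \<partial>\<nu>) - e < (\<integral>x. max_bumps (ts n) x \<partial>\<nu>)"
    using e by (intro order_tendstoD) auto
  then obtain n where "(\<integral>x. f x \<partial>\<nu>) - e < (\<integral>x. max_bumps (ts n) x \<partial>\<nu>)"
    using eventually_happens by fastforce
  moreover have "ts n \<in> lists (\<rat> \<times> D \<times> UNIV)" using ts_T[of n] unfolding T_def by auto
  ultimately show ?thesis using Cc le by blast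
qed

text \<open>The preceding lemma covers nonnegative \<open>f\<close>. In general a multiple \<open>N h\<close> of one of countably many
  compactly supported functions \<open>h\<close> makes \<open>f + N h\<close> nonnegative, and it is subtracted again after
  the approximation. Approximation from below is all that is needed, since it applies to \<open>- f\<close> too.\<close>
lemma countable_Cc_approx_below:
  assumes locally_compact: "locally_compact_type TYPE('x::{metric_space, second_countable_topology})"
  obtains F :: "('x::{metric_space, second_countable_topology} \<Rightarrow> real) set"
  where "countable F" "F \<subseteq> Cc"
    "\<And>f \<nu> e. f \<in> Cc \<Longrightarrow> \<nu> \<in> radon_measures \<Longrightarrow> 0 < e \<Longrightarrow>
       \<exists>g\<in>F. (\<forall>x. g x \<le> f x) \<and> (\<integral>x. f x \<partial>\<nu>) - e < (\<integral>x. g x \<partial>\<nu>)"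
proof -
  obtain V :: "nat \<Rightarrow> 'x set" where V: "incseq V" "\<And>n. open (V n)" "\<And>n. compact (closure (V n))" "(\<Union>n. V n) = UNIV"
    by (rule open_exhaustion[OF locally_compact]) (rule that)
  obtain D :: "'x set" where D: "countable D" "\<forall>U::'x set. open U \<longrightarrow> U \<noteq> {} \<longrightarrow> (\<exists>d\<in>D. d \<in> U)"
    using countable_dense_exists[where 'a = 'x] by (elim exE conjE) (rule that)
  define g where "g ts m N = (\<lambda>x. max_bumps ts x - real N * depth_in (V m) x)" for ts :: "(real \<times> 'x \<times> nat) list" and m N :: nat
  define F where "F = (\<lambda>(ts, m, N). g ts m N) ` (lists (\<rat> \<times> D \<times> UNIV) \<times> UNIV \<times> UNIV) \<inter> Cc"
  have depth_in_Cc: "(\<lambda>x. real N * depth_in (V m) x) \<in> Cc" for m N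
  proof (rule Cc_dominated[OF _ _ V(3)[of m]])
    show "continuous_on UNIV (\<lambda>x. real N * depth_in (V m) x)"
      by (intro continuous_intros continuous_depth_in)
    fix x assume "real N * depth_in (V m) x \<noteq> 0"
    then have "0 < depth_in (V m) x" using depth_in_nonneg[of "V m" x] by (cases "depth_in (V m) x = 0") simp_all
    then show "x \<in> V m" by (simp only: depth_in_pos_iff[OF V(2)])
  qed
  show ?thesis
  proof
    show "countable F" unfolding F_def
      by (intro countable_Int1 countable_image countable_SIGMA countable_lists countable_rat D) auto
    show "F \<subseteq> Cc" by (simp add: F_def)
    fix f :: "'x \<Rightarrow> real" and \<nu> :: "'x measure" and e :: real
    assume f: "f \<in> Cc" and nu: "\<nu> \<in> radon_measures" and e: "0 < e"
    let ?K = "closure {x. f x \<noteq> 0}"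
    have K: "compact ?K" using f by (simp add: Cc_def)
    obtain m where m: "?K \<subseteq> V m" using compact_subset_exhaustion[OF V(1,2,4) K] by blast
    obtain B where B: "0 < B" "\<And>x. \<bar>f x\<bar> \<le> B" using Cc_bounded[OF f] by blast
    \<comment> \<open>On the compact support of \<open>f\<close> the depth is bounded away from \<open>0\<close>.\<close>
    have "\<exists>N::nat. \<forall>x\<in>?K. B \<le> real N * depth_in (V m) x"
    proof (cases "?K = {}")
      case False
      obtain x0 where x0: "x0 \<in> ?K" "\<And>x. x \<in> ?K \<Longrightarrow> depth_in (V m) x0 \<le> depth_in (V m) x"
        using continuous_attains_inf[OF K False continuous_depth_in] by blast
      have pos: "0 < depth_in (V m) x0" using depth_in_pos_iff[OF V(2)] x0(1) m by blast
      obtain N :: nat where N: "B / depth_in (V m) x0 < real N" using reals_Archimedean2 by blast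
      have "B \<le> real N * depth_in (V m) x" if "x \<in> ?K" for x
      proof -
        have "B \<le> real N * depth_in (V m) x0" using N pos by (simp add: pos_divide_less_eq)
        also have "\<dots> \<le> real N * depth_in (V m) x" using x0(2)[OF that] by (simp add: mult_left_mono)
        finally show ?thesis .
      qed
      then show ?thesis by blast
    qed simp
    then obtain N :: nat where N: "\<And>x. x \<in> ?K \<Longrightarrow> B \<le> real N * depth_in (V m) x" by blast
    let ?h = "\<lambda>x. real N * depth_in (V m) x"
    have nonneg: "0 \<le> f x + ?h x" for x
    proof (cases "f x = 0")
      case True then show ?thesis using depth_in_nonneg[of "V m" x] by simp
    next
      case False
      then have "x \<in> ?K" using closure_subset[of "{x. f x \<noteq> 0}"] by auto
      then show ?thesis using N[of x] B(2)[of x] by linarith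
    qed
    have fh: "(\<lambda>x. f x + ?h x) \<in> Cc" by (rule Cc_add[OF f depth_in_Cc])
    obtain ts where ts: "ts \<in> lists (\<rat> \<times> D \<times> UNIV)" "max_bumps ts \<in> Cc"
      "\<And>y. max_bumps ts y \<le> f y + ?h y"
      "(\<integral>x. f x + ?h x \<partial>\<nu>) - e < (\<integral>x. max_bumps ts x \<partial>\<nu>)"
      using max_bumps_approx_below[OF fh nonneg nu e D] by blast
    have "g ts m N \<in> Cc" using Cc_add[OF ts(2) Cc_uminus[OF depth_in_Cc[of N m]]] by (simp add: g_def)
    then have "g ts m N \<in> F" unfolding F_def using ts(1) by (intro IntI image_eqI[of _ _ "(ts, m, N)"]) auto
    moreover have "\<forall>x. g ts m N x \<le> f x" using ts(3) by (simp add: g_def algebra_simps)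
    moreover have "(\<integral>x. f x \<partial>\<nu>) - e < (\<integral>x. g ts m N x \<partial>\<nu>)"
      using ts(4) unfolding g_def
        Bochner_Integration.integral_add[OF Cc_integrable[OF f nu] Cc_integrable[OF depth_in_Cc nu]]
        Bochner_Integration.integral_diff[OF Cc_integrable[OF ts(2) nu] Cc_integrable[OF depth_in_Cc nu]]
      by linarith
    ultimately show "\<exists>g\<in>F. (\<forall>x. g x \<le> f x) \<and> (\<integral>x. f x \<partial>\<nu>) - e < (\<integral>x. g x \<partial>\<nu>)" by blast
  qed
qed

section \<open>The Borel structure of the vague topology\<close>

text \<open>The sets \<open>A\<close> for which \<open>\<kappa> \<omega> (A \<inter> V n)\<close> is measurable in \<open>\<omega>\<close> form a Dynkin system, because \<open>V n\<close> has
  finite mass and complements can be subtracted. Pieces inside the \<open>V n\<close> are then summed up.\<close>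
lemma measurable_emeasure_of_generator:
  fixes \<kappa> :: "'w \<Rightarrow> 'x::topological_space measure"
  assumes E: "Int_stable E" "sigma_sets UNIV E = sets borel"
    and V: "range V \<subseteq> E" "(\<Union>n::nat. V n) = UNIV"
    and fin: "\<And>\<omega> n. \<omega> \<in> space P \<Longrightarrow> emeasure (\<kappa> \<omega>) (V n) \<noteq> \<infinity>"
    and sets: "\<And>\<omega>. \<omega> \<in> space P \<Longrightarrow> sets (\<kappa> \<omega>) = sets borel"
    and meas: "\<And>A. A \<in> E \<Longrightarrow> (\<lambda>\<omega>. emeasure (\<kappa> \<omega>) A) \<in> borel_measurable P"
    and B: "B \<in> sets borel"
  shows "(\<lambda>\<omega>. emeasure (\<kappa> \<omega>) B) \<in> borel_measurable P"
proof -
  have E_sub: "E \<subseteq> Pow UNIV" by auto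
  have E_borel: "E \<subseteq> sets borel" using E(2) sigma_sets.Basic by blast
  then have V_borel: "V n \<in> sets borel" for n using V(1) by blast
  have inter: "(\<lambda>\<omega>. emeasure (\<kappa> \<omega>) (A \<inter> V n)) \<in> borel_measurable P" if A: "A \<in> sets borel" for A n
  proof -
    have "A \<in> sigma_sets UNIV E" using A E(2) by simp
    from E(1) E_sub this show ?thesis
    proof (induction rule: sigma_sets_induct_disjoint)
      case (basic A)
      then have "A \<inter> V n \<in> E" using E(1) V(1) by (meson Int_stableD rangeI subsetD)
      then show ?case by (rule meas)
    next
      case empty
      then show ?case by simp
    next
      case (compl A)
      then have A: "A \<in> sets borel" using E(2) by simp
      have "emeasure (\<kappa> \<omega>) ((UNIV - A) \<inter> V n) = emeasure (\<kappa> \<omega>) (V n) - emeasure (\<kappa> \<omega>) (A \<inter> V n)"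
        if "\<omega> \<in> space P" for \<omega>
      proof -
        have "emeasure (\<kappa> \<omega>) (A \<inter> V n) \<le> emeasure (\<kappa> \<omega>) (V n)"
          using V_borel sets[OF that] by (intro emeasure_mono) auto
        then have "emeasure (\<kappa> \<omega>) (A \<inter> V n) \<noteq> \<infinity>" using fin[OF that, of n] by (auto simp: top_unique)
        moreover have "(UNIV - A) \<inter> V n = V n - A \<inter> V n" by auto
        ultimately show ?thesis
          using A V_borel sets[OF that] by (simp add: emeasure_Diff)
      qed
      moreover have "V n \<in> E" using V(1) by auto
      ultimately show ?case using compl.IH meas[of "V n"]
        by (subst measurable_cong[where g = "\<lambda>\<omega>. emeasure (\<kappa> \<omega>) (V n) - emeasure (\<kappa> \<omega>) (A \<inter> V n)"]) auto
    next
      case (union A)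
      then have A: "A i \<in> sets borel" for i using E(2) by auto
      have "emeasure (\<kappa> \<omega>) ((\<Union>i. A i) \<inter> V n) = (\<Sum>i. emeasure (\<kappa> \<omega>) (A i \<inter> V n))"
        if "\<omega> \<in> space P" for \<omega>
      proof -
        have "disjoint_family (\<lambda>i. A i \<inter> V n)"
          using union.hyps(1) unfolding disjoint_family_on_def by blast
        then have "(\<Sum>i. emeasure (\<kappa> \<omega>) (A i \<inter> V n)) = emeasure (\<kappa> \<omega>) (\<Union>i. A i \<inter> V n)"
          using A V_borel sets[OF that] by (intro suminf_emeasure) auto
        also have "(\<Union>i. A i \<inter> V n) = (\<Union>i. A i) \<inter> V n" by blast
        finally show ?thesis by simp
      qed
      then show ?case using union.IH
        by (subst measurable_cong[where g = "\<lambda>\<omega>. (\<Sum>i. emeasure (\<kappa> \<omega>) (A i \<inter> V n))"]) auto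
    qed
  qed
  have "emeasure (\<kappa> \<omega>) B = (\<Sum>n. emeasure (\<kappa> \<omega>) ((B \<inter> disjointed V n) \<inter> V n))" if "\<omega> \<in> space P" for \<omega>
  proof -
    have D: "disjointed V n \<in> sets borel" for n using V_borel
      by (simp add: disjointed_def sets.Diff sets.countable_UN')
    have "B \<inter> disjointed V n \<inter> V n = B \<inter> disjointed V n" for n using disjointed_subset[of V n] by auto
    moreover have "B = (\<Union>n. B \<inter> disjointed V n)" using UN_disjointed_eq[of V] V(2) by auto
    moreover have "disjoint_family (\<lambda>n. B \<inter> disjointed V n)"
      using disjoint_family_disjointed[of V] by (auto simp: disjoint_family_on_def)
    ultimately show ?thesis
      using B D sets[OF that] suminf_emeasure[of "\<lambda>n. B \<inter> disjointed V n" "\<kappa> \<omega>"] by (auto simp: image_subset_iff)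
  qed
  moreover have "disjointed V n \<in> sets borel" for n using V_borel
      by (simp add: disjointed_def sets.Diff sets.countable_UN')
  ultimately show ?thesis using inter B
    by (subst measurable_cong[where g = "\<lambda>\<omega>. (\<Sum>n. emeasure (\<kappa> \<omega>) ((B \<inter> disjointed V n) \<inter> V n))"]) auto
qed

lemma measurable_nn_integral_kernel:
  fixes \<kappa> :: "'w \<Rightarrow> 'x::topological_space measure"
  assumes meas: "\<And>A. A \<in> sets borel \<Longrightarrow> (\<lambda>\<omega>. emeasure (\<kappa> \<omega>) A) \<in> borel_measurable P"
    and sets: "\<And>\<omega>. \<omega> \<in> space P \<Longrightarrow> sets (\<kappa> \<omega>) = sets borel"
    and f: "f \<in> borel_measurable borel"
  shows "(\<lambda>\<omega>. \<integral>\<^sup>+x. f x \<partial>\<kappa> \<omega>) \<in> borel_measurable P"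
  using f
proof (induction rule: borel_measurable_induct)
  case (cong f g)
  then show ?case by simp
next
  case (set A)
  then show ?case using meas sets by (subst measurable_cong[where g = "\<lambda>\<omega>. emeasure (\<kappa> \<omega>) A"]) auto
next
  case (mult u c)
  have "(\<integral>\<^sup>+x. c * u x \<partial>\<kappa> \<omega>) = c * (\<integral>\<^sup>+x. u x \<partial>\<kappa> \<omega>)" if "\<omega> \<in> space P" for \<omega>
    using mult sets[OF that] by (intro nn_integral_cmult) (simp cong: measurable_cong_sets)
  then show ?case using mult by (subst measurable_cong[where g = "\<lambda>\<omega>. c * (\<integral>\<^sup>+x. u x \<partial>\<kappa> \<omega>)"]) auto
next
  case (add u v)
  have "(\<integral>\<^sup>+x. v x + u x \<partial>\<kappa> \<omega>) = (\<integral>\<^sup>+x. v x \<partial>\<kappa> \<omega>) + (\<integral>\<^sup>+x. u x \<partial>\<kappa> \<omega>)" if "\<omega> \<in> space P" for \<omega>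
    using add sets[OF that] by (intro nn_integral_add) (simp_all cong: measurable_cong_sets)
  then show ?case using add by (subst measurable_cong[where g = "\<lambda>\<omega>. (\<integral>\<^sup>+x. v x \<partial>\<kappa> \<omega>) + (\<integral>\<^sup>+x. u x \<partial>\<kappa> \<omega>)"]) auto
next
  case (seq U)
  have "(SUP i. U i) = (\<lambda>x. SUP i. U i x)" by (auto simp: fun_eq_iff image_image)
  then have "integral\<^sup>N (\<kappa> \<omega>) (SUP i. U i) = (SUP i. integral\<^sup>N (\<kappa> \<omega>) (U i))" if "\<omega> \<in> space P" for \<omega>
    using seq sets[OF that] by (simp, intro nn_integral_monotone_convergence_SUP) (auto cong: measurable_cong_sets)
  then show ?case using seq by (subst measurable_cong[where g = "\<lambda>\<omega>. SUP i. integral\<^sup>N (\<kappa> \<omega>) (U i)"]) auto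
qed

lemma space_vague_borel: "space (vague_borel :: 'x::topological_space measure measure) = radon_measures"
  and sets_vague_borel: "sets (vague_borel :: 'x::topological_space measure measure) = sigma_sets radon_measures {U. openin vague_topology U}"
proof -
  have "U \<subseteq> radon_measures" if "openin vague_topology U" for U :: "'x measure set"
    using openin_subset[OF that] by (auto simp: vague_topology_def)
  then have "{U. openin vague_topology U} \<subseteq> Pow (radon_measures :: 'x measure set)" by auto
  then show "space (vague_borel :: 'x measure measure) = radon_measures"
    and "sets (vague_borel :: 'x measure measure) = sigma_sets radon_measures {U. openin vague_topology U}"
    unfolding vague_borel_def by (auto simp: space_measure_of sets_measure_of)
qed

lemma measurable_Cc_integral:
  assumes "f \<in> Cc"
  shows "(\<lambda>\<nu>. \<integral>x. f x \<partial>\<nu>) \<in> borel_measurable vague_borel"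
proof (rule borel_measurableI)
  fix V :: "real set" assume V: "open V"
  have "openin vague_topology {\<nu>\<in>radon_measures. (\<integral>x. f x \<partial>\<nu>) \<in> V}"
    unfolding vague_topology_def using assms V by (intro topology_generated_by_Basis) blast
  moreover have "(\<lambda>\<nu>. \<integral>x. f x \<partial>\<nu>) -` V \<inter> space vague_borel = {\<nu>\<in>radon_measures. (\<integral>x. f x \<partial>\<nu>) \<in> V}"
    by (auto simp: space_vague_borel)
  ultimately show "(\<lambda>\<nu>. \<integral>x. f x \<partial>\<nu>) -` V \<inter> space vague_borel \<in> sets vague_borel"
    by (auto simp: sets_vague_borel)
qed

lemma random_measure_radon:
  assumes "random_measure P \<Lambda>" "\<omega> \<in> space P"
  shows "\<Lambda> \<omega> \<in> radon_measures"
  using assms measurable_space[of \<Lambda> P vague_borel] by (auto simp: random_measure_def space_vague_borel)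

text \<open>The indicator of a relatively compact open set \<open>U\<close> is the increasing limit of the functions
  \<open>min 1 (n * depth_in U x)\<close>, whose integrals are vaguely continuous. These sets generate the
  Borel sets.\<close>
lemma random_measure_emeasure_measurable:
  fixes \<Lambda> :: "'w \<Rightarrow> 'x::{metric_space, second_countable_topology} measure"
  assumes locally_compact: "locally_compact_type TYPE('x)"
    and \<Lambda>: "random_measure P \<Lambda>" and B: "B \<in> sets borel"
  shows "(\<lambda>\<omega>. emeasure (\<Lambda> \<omega>) B) \<in> borel_measurable P"
proof -
  define E where "E = {U::'x set. open U \<and> compact (closure U)}"
  obtain V :: "nat \<Rightarrow> 'x set" where V: "incseq V" "\<And>n. open (V n)" "\<And>n. compact (closure (V n))" "(\<Union>n. V n) = UNIV"
    by (rule open_exhaustion[OF locally_compact]) (rule that)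
  have sub: "compact (closure U)" if "U \<subseteq> W" "compact (closure W)" for U W :: "'x set"
    using that by (metis closed_closure closure_mono compact_Int_closed inf.absorb_iff2)
  have "Int_stable E" unfolding E_def Int_stable_def using sub by (auto intro: inf_le1)
  moreover have "sigma_sets UNIV E = sets borel"
  proof
    show "sigma_sets UNIV E \<subseteq> sets borel"
      by (intro sets.sigma_sets_subset'[of _ borel, simplified]) (auto simp: E_def)
    have "U \<in> sigma_sets UNIV E" if "open U" for U
    proof -
      have "U = (\<Union>n. U \<inter> V n)" using V(4) by auto
      moreover have "U \<inter> V n \<in> E" for n unfolding E_def using that V(2,3) sub[of "U \<inter> V n" "V n"] by auto
      ultimately show ?thesis by (metis sigma_sets.Basic sigma_sets.Union)
    qed
    then show "sets borel \<subseteq> sigma_sets UNIV E"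
      unfolding borel_def by (auto intro!: sigma_sets_mono)
  qed
  moreover have "range V \<subseteq> E" using V by (auto simp: E_def)
  moreover note V(4)
  moreover have "emeasure (\<Lambda> \<omega>) (V n) \<noteq> \<infinity>" if "\<omega> \<in> space P" for \<omega> n
  proof -
    note r = radon_measuresD[OF random_measure_radon[OF \<Lambda> that]]
    have "emeasure (\<Lambda> \<omega>) (V n) \<le> emeasure (\<Lambda> \<omega>) (closure (V n))"
      using r(1) by (intro emeasure_mono closure_subset) auto
    then show ?thesis using r(3)[OF V(3)[of n]] by (auto simp: top_unique)
  qed
  moreover have "sets (\<Lambda> \<omega>) = sets borel" if "\<omega> \<in> space P" for \<omega>
    using radon_measuresD(1)[OF random_measure_radon[OF \<Lambda> that]] .
  moreover have "(\<lambda>\<omega>. emeasure (\<Lambda> \<omega>) U) \<in> borel_measurable P" if U: "U \<in> E" for U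
  proof -
    define f where "f n x = min 1 (real n * depth_in U x)" for n x
    have oU: "open U" "compact (closure U)" using U by (auto simp: E_def)
    have f0: "f n x = 0" if "x \<notin> U" for n x
      using that depth_in_pos_iff[OF oU(1), of x] depth_in_nonneg[of U x] by (simp add: f_def)
    have f_nonneg: "0 \<le> f n x" for n x using depth_in_nonneg[of U x] by (simp add: f_def)
    have f_Cc: "f n \<in> Cc" for n
    proof (rule Cc_dominated[OF _ _ oU(2)])
      show "continuous_on UNIV (f n)" unfolding f_def by (intro continuous_intros continuous_depth_in)
    qed (use f0 in auto)
    have f_mono: "incseq (\<lambda>n. ennreal (f n x))" for x
      using depth_in_nonneg[of U x]
      by (intro incseq_SucI ennreal_leI) (auto simp: f_def min_def algebra_simps)
    have f_sup: "(SUP n. ennreal (f n x)) = indicator U x" for x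
    proof (cases "x \<in> U")
      case True
      then have "0 < depth_in U x" using depth_in_pos_iff[OF oU(1)] by simp
      then obtain n :: nat where "1 < real n * depth_in U x" using reals_Archimedean3 by blast
      then have "f n x = 1" by (simp add: f_def)
      then have "1 \<le> (SUP n. ennreal (f n x))" by (intro SUP_upper2[of n]) auto
      moreover have "(SUP n. ennreal (f n x)) \<le> 1" by (intro SUP_least) (simp add: f_def)
      ultimately show ?thesis using True by simp
    qed (simp add: f0)
    have "emeasure (\<Lambda> \<omega>) U = (SUP n. ennreal (\<integral>x. f n x \<partial>\<Lambda> \<omega>))" if w: "\<omega> \<in> space P" for \<omega>
    proof -
      note r = random_measure_radon[OF \<Lambda> w]
      note [measurable_cong] = radon_measuresD(1)[OF r]
      have [measurable]: "f n \<in> borel_measurable borel" for n by (rule Cc_borel[OF f_Cc])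
      have "emeasure (\<Lambda> \<omega>) U = (\<integral>\<^sup>+x. indicator U x \<partial>\<Lambda> \<omega>)"
        using oU radon_measuresD(1)[OF r] by simp
      also have "\<dots> = (\<integral>\<^sup>+x. (SUP n. ennreal (f n x)) \<partial>\<Lambda> \<omega>)" by (simp only: f_sup)
      also have "\<dots> = (SUP n. \<integral>\<^sup>+x. ennreal (f n x) \<partial>\<Lambda> \<omega>)"
        using f_mono by (intro nn_integral_monotone_convergence_SUP) (auto simp: incseq_def le_fun_def)
      also have "\<dots> = (SUP n. ennreal (\<integral>x. f n x \<partial>\<Lambda> \<omega>))"
        using Cc_integrable[OF f_Cc r] f_nonneg by (simp add: nn_integral_eq_integral)
      finally show ?thesis .
    qed
    moreover have "(\<lambda>\<omega>. SUP n. ennreal (\<integral>x. f n x \<partial>\<Lambda> \<omega>)) \<in> borel_measurable P"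
      using measurable_compose[OF \<Lambda>[unfolded random_measure_def] measurable_Cc_integral[OF f_Cc]]
      by (intro borel_measurable_SUP) auto
    ultimately show ?thesis by (subst measurable_cong) auto
  qed
  ultimately show ?thesis using B by (rule measurable_emeasure_of_generator)
qed

text \<open>The \<open>\<sigma>\<close>-field of a random measure is generated by all vaguely open sets, hence by arbitrary unions of
  subbasic sets. Measurability can be checked on the subbasic sets only because countably many of
  them suffice: if \<open>g \<le> f\<close> then \<open>a < \<integral>g d\<nu>\<close> is a smaller neighbourhood than \<open>a < \<integral>f d\<nu>\<close>, and \<open>g\<close> may be
  taken from the countable family that approximates from below. Upper bounds for \<open>\<integral>f d\<nu>\<close> are lower
  bounds for \<open>\<integral>(- f) d\<nu>\<close>.\<close>
lemma vague_countable_base: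
  assumes locally_compact: "locally_compact_type TYPE('x::{metric_space, second_countable_topology})"
  obtains S :: "'x::{metric_space, second_countable_topology} measure set set"
  where "countable S" "\<And>B. B \<in> S \<Longrightarrow> \<exists>f\<in>Cc. \<exists>a. B = {\<nu>\<in>radon_measures. a < (\<integral>x. f x \<partial>\<nu>)}"
    "\<And>U \<nu>. openin vague_topology U \<Longrightarrow> \<nu> \<in> U \<Longrightarrow>
       \<exists>T. finite T \<and> T \<subseteq> S \<and> \<nu> \<in> radon_measures \<inter> \<Inter>T \<and> radon_measures \<inter> \<Inter>T \<subseteq> U"
proof -
  obtain F :: "('x \<Rightarrow> real) set" where F: "countable F" "F \<subseteq> Cc"
    "\<And>f \<nu> e. f \<in> Cc \<Longrightarrow> \<nu> \<in> radon_measures \<Longrightarrow> 0 < e \<Longrightarrow>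
       \<exists>g\<in>F. (\<forall>x. g x \<le> f x) \<and> (\<integral>x. f x \<partial>\<nu>) - e < (\<integral>x. g x \<partial>\<nu>)"
    by (rule countable_Cc_approx_below[OF locally_compact]) (rule that)
  define H where "H f a = {\<nu>\<in>radon_measures. a < (\<integral>x. f x \<partial>\<nu>)}" for f :: "'x \<Rightarrow> real" and a :: real
  define S where "S = (\<lambda>(f, a). H f a) ` (F \<times> \<rat>)"
  have half: "\<exists>B\<in>S. \<nu> \<in> B \<and> B \<subseteq> H f a" if f: "f \<in> Cc" and nu: "\<nu> \<in> H f a" for f a \<nu>
  proof -
    have r: "\<nu> \<in> radon_measures" and a: "a < (\<integral>x. f x \<partial>\<nu>)" using nu by (auto simp: H_def)
    obtain g where g: "g \<in> F" "\<forall>x. g x \<le> f x" "(\<integral>x. f x \<partial>\<nu>) - ((\<integral>x. f x \<partial>\<nu>) - a) < (\<integral>x. g x \<partial>\<nu>)"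
      using F(3)[OF f r, of "(\<integral>x. f x \<partial>\<nu>) - a"] a by auto
    then obtain b where b: "b \<in> \<rat>" "a < b" "b < (\<integral>x. g x \<partial>\<nu>)"
      using Rats_dense_in_real[of a "\<integral>x. g x \<partial>\<nu>"] by auto
    have "H g b \<subseteq> H f a"
    proof
      fix \<nu>' assume h: "\<nu>' \<in> H g b"
      then have r': "\<nu>' \<in> radon_measures" by (simp add: H_def)
      have "(\<integral>x. g x \<partial>\<nu>') \<le> (\<integral>x. f x \<partial>\<nu>')"
        using g F(2) f r' by (intro integral_mono Cc_integrable) auto
      then show "\<nu>' \<in> H f a" using h b by (auto simp: H_def)
    qed
    then show ?thesis using g(1) b r by (intro bexI[of _ "H g b"]) (auto simp: S_def H_def)
  qed
  show ?thesis
  proof (rule that[of S])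
    show "countable S" unfolding S_def by (intro countable_image countable_SIGMA F countable_rat)
    show "\<exists>f\<in>Cc. \<exists>a. B = {\<nu>\<in>radon_measures. a < (\<integral>x. f x \<partial>\<nu>)}" if "B \<in> S" for B
      using that F(2) by (auto simp: S_def H_def)
    fix U :: "'x measure set" and \<nu> assume U: "openin vague_topology U" and nu: "\<nu> \<in> U"
    let ?sub = "{{\<nu>\<in>radon_measures. (\<integral>x. f x \<partial>\<nu>) \<in> V} | f V. f \<in> (Cc :: ('x \<Rightarrow> real) set) \<and> open V}"
    have "generate_topology_on ?sub U"
      using U unfolding vague_topology_def by (rule openin_topology_generated_by)
    then show "\<exists>T. finite T \<and> T \<subseteq> S \<and> \<nu> \<in> radon_measures \<inter> \<Inter>T \<and> radon_measures \<inter> \<Inter>T \<subseteq> U"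
      using nu
    proof (induction arbitrary: \<nu> rule: generate_topology_on.induct)
      case Empty
      then show ?case by simp
    next
      case (Int a b)
      obtain T where "finite T" "T \<subseteq> S" "\<nu> \<in> radon_measures \<inter> \<Inter>T" "radon_measures \<inter> \<Inter>T \<subseteq> a"
        using Int.IH(1)[of \<nu>] Int.prems by auto
      moreover obtain T' where "finite T'" "T' \<subseteq> S" "\<nu> \<in> radon_measures \<inter> \<Inter>T'" "radon_measures \<inter> \<Inter>T' \<subseteq> b"
        using Int.IH(2)[of \<nu>] Int.prems by auto
      ultimately show ?case by (intro exI[of _ "T \<union> T'"]) auto
    next
      case (UN K)
      then obtain k where k: "k \<in> K" "\<nu> \<in> k" by auto
      obtain T where "finite T" "T \<subseteq> S" "\<nu> \<in> radon_measures \<inter> \<Inter>T" "radon_measures \<inter> \<Inter>T \<subseteq> k"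
        using UN.IH[OF k] by auto
      then show ?case using k by (intro exI[of _ T]) auto
    next
      case (Basis s)
      then obtain f V where f: "f \<in> Cc" and V: "open V" and s: "s = {\<nu>\<in>radon_measures. (\<integral>x. f x \<partial>\<nu>) \<in> V}"
        by auto
      have r: "\<nu> \<in> radon_measures" "(\<integral>x. f x \<partial>\<nu>) \<in> V" using Basis s by auto
      obtain e where e: "0 < e" "\<And>t. dist t (\<integral>x. f x \<partial>\<nu>) < e \<Longrightarrow> t \<in> V"
        using V r by (auto simp: open_dist)
      let ?I = "\<integral>x. f x \<partial>\<nu>"
      obtain B where B: "B \<in> S" "\<nu> \<in> B" "B \<subseteq> H f (?I - e)"
        using half[OF f, of \<nu> "?I - e"] r e by (auto simp: H_def)
      obtain B' where B': "B' \<in> S" "\<nu> \<in> B'" "B' \<subseteq> H (\<lambda>x. - f x) (- ?I - e)"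
        using half[OF Cc_uminus[OF f], of \<nu> "- ?I - e"] r e by (auto simp: H_def)
      have "B \<inter> B' \<subseteq> s"
      proof
        fix \<nu>' assume "\<nu>' \<in> B \<inter> B'"
        then have "\<nu>' \<in> H f (?I - e)" "\<nu>' \<in> H (\<lambda>x. - f x) (- ?I - e)" using B B' by auto
        then show "\<nu>' \<in> s" unfolding s H_def using e(2)[of "\<integral>x. f x \<partial>\<nu>'"] by (auto simp: dist_real_def)
      qed
      then show ?case using B B' r by (intro exI[of _ "{B, B'}"]) auto
    qed
  qed
qed

text \<open>Every vaguely open set is a countable union of basic sets. These are defined by finitely many
  integrals, which are measurable in \<open>\<omega>\<close> as soon as the masses of Borel sets are.\<close>
lemma random_measureI:
  fixes q :: "'w \<Rightarrow> 'x::{metric_space, second_countable_topology} measure"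
  assumes locally_compact: "locally_compact_type TYPE('x)"
    and radon: "\<And>\<omega>. \<omega> \<in> space P \<Longrightarrow> q \<omega> \<in> radon_measures"
    and meas: "\<And>A. A \<in> sets borel \<Longrightarrow> (\<lambda>\<omega>. emeasure (q \<omega>) A) \<in> borel_measurable P"
  shows "random_measure P q"
proof -
  obtain S :: "'x measure set set" where S: "countable S"
    "\<And>B. B \<in> S \<Longrightarrow> \<exists>f\<in>Cc. \<exists>a. B = {\<nu>\<in>radon_measures. a < (\<integral>x. f x \<partial>\<nu>)}"
    "\<And>U \<nu>. openin vague_topology U \<Longrightarrow> \<nu> \<in> U \<Longrightarrow>
       \<exists>T. finite T \<and> T \<subseteq> S \<and> \<nu> \<in> radon_measures \<inter> \<Inter>T \<and> radon_measures \<inter> \<Inter>T \<subseteq> U"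
    by (rule vague_countable_base[OF locally_compact]) (rule that)
  have sets_q: "sets (q \<omega>) = sets borel" if "\<omega> \<in> space P" for \<omega>
    using radon_measuresD(1)[OF radon[OF that]] .
  have int: "(\<lambda>\<omega>. \<integral>x. f x \<partial>q \<omega>) \<in> borel_measurable P" if f: "f \<in> Cc" for f
  proof -
    have "(\<integral>x. f x \<partial>q \<omega>) = enn2real (\<integral>\<^sup>+x. ennreal (f x) \<partial>q \<omega>) - enn2real (\<integral>\<^sup>+x. ennreal (- f x) \<partial>q \<omega>)"
      if "\<omega> \<in> space P" for \<omega>
      by (rule real_lebesgue_integral_def[OF Cc_integrable[OF f radon[OF that]]])
    moreover have "(\<lambda>\<omega>. \<integral>\<^sup>+x. ennreal (g x) \<partial>q \<omega>) \<in> borel_measurable P" if "g \<in> Cc" for g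
      using Cc_borel[OF that] by (intro measurable_nn_integral_kernel meas sets_q) auto
    ultimately show ?thesis using f Cc_uminus[OF f] by (subst measurable_cong) auto
  qed
  have base: "{\<omega>\<in>space P. q \<omega> \<in> B} \<in> sets P" if "B \<in> S" for B
  proof -
    obtain f a where f: "f \<in> Cc" "B = {\<nu>\<in>radon_measures. a < (\<integral>x. f x \<partial>\<nu>)}" using S(2)[OF \<open>B \<in> S\<close>] by blast
    have "{\<omega>\<in>space P. q \<omega> \<in> B} = {\<omega>\<in>space P. a < (\<integral>x. f x \<partial>q \<omega>)}" using f radon by auto
    then show ?thesis using int[OF f(1)] by simp
  qed
  have inter: "{\<omega>\<in>space P. q \<omega> \<in> radon_measures \<inter> \<Inter>T} \<in> sets P" if "finite T" "T \<subseteq> S" for T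
    using that
  proof (induction T rule: finite_induct)
    case empty
    have "{\<omega>\<in>space P. q \<omega> \<in> radon_measures \<inter> \<Inter>{}} = space P" using radon by auto
    then show ?case by (metis sets.top)
  next
    case (insert B T)
    have "{\<omega>\<in>space P. q \<omega> \<in> radon_measures \<inter> \<Inter>(insert B T)} = {\<omega>\<in>space P. q \<omega> \<in> B} \<inter> {\<omega>\<in>space P. q \<omega> \<in> radon_measures \<inter> \<Inter>T}"
      by auto
    then show ?case using insert base[of B] by auto
  qed
  have "q \<in> P \<rightarrow>\<^sub>M sigma radon_measures {U. openin vague_topology U}"
  proof (rule measurable_measure_of)
    show "{U. openin vague_topology U} \<subseteq> Pow (radon_measures :: 'x measure set)"
      using openin_subset[of vague_topology] by (auto simp: vague_topology_def)
    show "q \<in> space P \<rightarrow> radon_measures" using radon by auto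
    fix U assume "U \<in> {U. openin (vague_topology :: 'x measure topology) U}"
    then have U: "openin vague_topology U" by simp
    define \<T> where "\<T> = {T. finite T \<and> T \<subseteq> S \<and> radon_measures \<inter> \<Inter>T \<subseteq> U}"
    have "countable \<T>"
      by (rule countable_subset[OF _ countable_Collect_finite_subset[OF S(1)]]) (auto simp: \<T>_def)
    moreover have "q -` U \<inter> space P = (\<Union>T\<in>\<T>. {\<omega>\<in>space P. q \<omega> \<in> radon_measures \<inter> \<Inter>T})"
    proof
      show "q -` U \<inter> space P \<subseteq> (\<Union>T\<in>\<T>. {\<omega>\<in>space P. q \<omega> \<in> radon_measures \<inter> \<Inter>T})"
      proof
        fix \<omega> assume w: "\<omega> \<in> q -` U \<inter> space P"
        then obtain T where "finite T" "T \<subseteq> S" "q \<omega> \<in> radon_measures \<inter> \<Inter>T" "radon_measures \<inter> \<Inter>T \<subseteq> U"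
          using S(3)[OF U, of "q \<omega>"] by auto
        then show "\<omega> \<in> (\<Union>T\<in>\<T>. {\<omega>\<in>space P. q \<omega> \<in> radon_measures \<inter> \<Inter>T})"
          using w by (intro UN_I[of T]) (auto simp: \<T>_def)
      qed
    qed (auto simp: \<T>_def)
    ultimately show "q -` U \<inter> space P \<in> sets P"
      using inter by (auto simp: \<T>_def intro!: sets.countable_UN')
  qed
  then show ?thesis by (simp add: random_measure_def vague_borel_def)
qed

section \<open>Rectangles and countable partitions\<close>

text \<open>The preimage of a closed coordinate ball is a compact neighbourhood.\<close>
lemma smooth_atlas_locally_compact:
  fixes \<A> :: "('a::topological_space, 'n::finite) chart set"
  assumes "smooth_atlas \<A>"
  shows "locally_compact_type TYPE('a)"
  unfolding locally_compact_type_def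
proof
  fix x :: 'a
  obtain c where c: "c \<in> \<A>" "x \<in> fst c" using assms unfolding smooth_atlas_def by blast
  have o: "open (fst c)" "open (snd c ` fst c)" and h: "homeomorphism (fst c) (snd c ` fst c) (snd c) (chart_inv c)"
    using assms c(1) unfolding smooth_atlas_def by auto
  obtain r where r: "0 < r" "cball (snd c x) r \<subseteq> snd c ` fst c"
    using o(2) c(2) by (meson imageI open_contains_cball)
  let ?U = "fst c \<inter> snd c -` ball (snd c x) r"
  let ?K = "chart_inv c ` cball (snd c x) r"
  have "open ?U"
    using h o(1) by (intro continuous_open_preimage) (auto simp: homeomorphism_def)
  moreover have "compact ?K"
    using h r by (intro compact_continuous_image) (auto simp: homeomorphism_def intro: continuous_on_subset)
  moreover have "x \<in> ?U" using c r by simp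
  moreover have "?U \<subseteq> ?K"
  proof
    fix y assume y: "y \<in> ?U"
    then have "chart_inv c (snd c y) = y" using h by (auto simp: homeomorphism_def)
    then show "y \<in> ?K" using y by (intro image_eqI[of _ _ "snd c y"]) auto
  qed
  ultimately show "\<exists>U K. open U \<and> compact K \<and> x \<in> U \<and> U \<subseteq> K" by blast
qed

definition rectangles :: "('x::topological_space \<times> 'y::topological_space) set set" where
  "rectangles = {A \<times> B | A B. A \<in> sets borel \<and> B \<in> sets borel}"

lemma sigma_sets_rectangles:
  "sigma_sets UNIV rectangles = sets (borel :: ('x::second_countable_topology \<times> 'y::second_countable_topology) measure)"
proof -
  have "sets (borel :: ('x \<times> 'y) measure) = sets (borel \<Otimes>\<^sub>M borel)" by (simp only: borel_prod)
  also have "\<dots> = sigma_sets UNIV rectangles" by (simp add: sets_pair_measure rectangles_def)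
  finally show ?thesis by simp
qed

lemma Int_stable_rectangles: "Int_stable rectangles"
  unfolding Int_stable_def
proof (intro ballI)
  fix a b :: "('a \<times> 'b) set" assume "a \<in> rectangles" "b \<in> rectangles"
  then obtain A B C D where "a = A \<times> B" "b = C \<times> D" "A \<in> sets borel" "B \<in> sets borel" "C \<in> sets borel" "D \<in> sets borel"
    by (auto simp: rectangles_def)
  then show "a \<inter> b \<in> rectangles" unfolding rectangles_def
    by (auto simp: Times_Int_Times intro!: exI[of _ "A \<inter> C"] exI[of _ "B \<inter> D"])
qed

lemma borel_Times [measurable]:
  fixes A :: "'x::second_countable_topology set" and B :: "'y::second_countable_topology set"
  assumes "A \<in> sets borel" "B \<in> sets borel" shows "A \<times> B \<in> sets borel"
  using assms by (simp flip: borel_prod)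

lemma measure_eqI_rectangles:
  fixes q q' :: "('x::second_countable_topology \<times> 'y::second_countable_topology) measure"
  assumes "sets q = sets borel" "sets q' = sets borel"
    and eq: "\<And>A B. A \<in> sets borel \<Longrightarrow> B \<in> sets borel \<Longrightarrow> emeasure q (A \<times> B) = emeasure q' (A \<times> B)"
    and V: "\<And>n. V n \<in> rectangles" "(\<Union>n::nat. V n) = UNIV" "\<And>n. emeasure q (V n) \<noteq> \<infinity>"
  shows "q = q'"
proof (rule measure_eqI_generator_eq_countable[where E = rectangles and A = "range V" and \<Omega> = UNIV])
  show "emeasure q X = emeasure q' X" if "X \<in> rectangles" for X using that eq by (auto simp: rectangles_def)
qed (use assms Int_stable_rectangles in \<open>auto simp: sigma_sets_rectangles\<close>)

lemma borel_measurable_nn_integral_count_space: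
  fixes f :: "'i \<Rightarrow> 'x \<Rightarrow> ennreal"
  assumes I: "countable I" and f: "\<And>i. i \<in> I \<Longrightarrow> f i \<in> borel_measurable M"
  shows "(\<lambda>x. \<integral>\<^sup>+i. f i x \<partial>count_space I) \<in> borel_measurable M"
proof -
  interpret sigma_finite_measure "count_space I"
    by (rule sigma_finite_measure_count_space_countable[OF I])
  have "(\<lambda>(i, x). f i x) \<in> borel_measurable (count_space I \<Otimes>\<^sub>M M)"
    by (rule measurable_pair_measure_countable1[OF I]) (use f in auto)
  then have "(\<lambda>(x, i). f i x) \<in> borel_measurable (M \<Otimes>\<^sub>M count_space I)"
    using measurable_pair_swap by fastforce
  then show ?thesis by (rule borel_measurable_nn_integral)
qed

lemma nn_integral_partition:
  fixes f :: "'x \<Rightarrow> ennreal"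
  assumes I: "countable I" and cell: "\<And>i. i \<in> I \<Longrightarrow> cell i \<in> sets N"
    and disj: "disjoint_family_on cell I" and cover: "(\<Union>i\<in>I. cell i) = space N"
    and f [measurable]: "f \<in> borel_measurable M" and k [measurable]: "k \<in> M \<rightarrow>\<^sub>M N"
  shows "(\<integral>\<^sup>+x. f x \<partial>M) = (\<integral>\<^sup>+i. (\<integral>\<^sup>+x. f x * indicator (cell i) (k x) \<partial>M) \<partial>count_space I)"
proof -
  have "(\<integral>\<^sup>+i. indicator (cell i) (k x) \<partial>count_space I) = (1::ennreal)" if "x \<in> space M" for x
  proof -
    obtain i where i: "i \<in> I" "k x \<in> cell i" using cover measurable_space[OF k \<open>x \<in> space M\<close>] by blast
    have "indicator (cell j) (k x) = (indicator {i} j :: ennreal)" if "j \<in> I" for j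
      using i that disj by (auto simp: disjoint_family_on_def split: split_indicator)
    then have "(\<integral>\<^sup>+j. indicator (cell j) (k x) \<partial>count_space I) = (\<integral>\<^sup>+j. (indicator {i} j :: ennreal) \<partial>count_space I)"
      by (intro nn_integral_cong) simp
    also have "\<dots> = 1" using i by (simp add: one_ennreal_def[symmetric])
    finally show ?thesis .
  qed
  then have "(\<integral>\<^sup>+x. f x \<partial>M) = (\<integral>\<^sup>+x. (\<integral>\<^sup>+i. f x * indicator (cell i) (k x) \<partial>count_space I) \<partial>M)"
    by (intro nn_integral_cong) (simp add: nn_integral_cmult)
  also have "\<dots> = (\<integral>\<^sup>+i. (\<integral>\<^sup>+x. f x * indicator (cell i) (k x) \<partial>M) \<partial>count_space I)"
    using cell by (intro nn_integral_count_space_nn_integral[OF I]) (auto intro!: borel_measurable_times borel_measurable_indicator' simp: measurable_sets)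
  finally show ?thesis .
qed

section \<open>Equivariant flows and mass transport\<close>

text \<open>The group acts on the space and on the probability space. Completeness of \<open>P\<close> makes every property
  that holds almost everywhere a measurable one.\<close>
locale equivariant_flow =
  fixes G :: "('a::polish_space \<Rightarrow> 'a) set" and B0 :: "'a set"
    and P :: "'w measure" and \<theta> :: "('a \<Rightarrow> 'a) \<Rightarrow> 'w \<Rightarrow> 'w"
  assumes locally_compact: "locally_compact_type TYPE('a)"
    and isometries: "isometry_group G" and discontinuous: "properly_discontinuous G"
    and fundamental: "fundamental_region G B0"
    and prob: "prob_space P" and complete: "complete_measure P" and space_P: "space P = UNIV"
    and flow: "measurable_flow P G \<theta>" and stationary: "stationary P G \<theta>"
begin

sublocale prob_space P by (rule prob)
sublocale complete_measure P by (rule complete)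

lemma group_id [simp]: "id \<in> G"
  and group_comp [simp]: "g \<in> G \<Longrightarrow> h \<in> G \<Longrightarrow> g \<circ> h \<in> G"
  and group_inv [simp]: "g \<in> G \<Longrightarrow> inv g \<in> G"
  and group_dist [simp]: "g \<in> G \<Longrightarrow> dist (g x) (g y) = dist x y"
  using isometries by (auto simp: isometry_group_def)

lemma group_bij: "g \<in> G \<Longrightarrow> bij g"
proof -
  assume g: "g \<in> G"
  have "inj g"
  proof (rule injI)
    fix x y assume "g x = g y"
    then have "dist x y = 0" using group_dist[OF g, of x y] by simp
    then show "x = y" by simp
  qed
  then show "bij g" using g isometries by (simp add: bij_def isometry_group_def)
qed

lemma group_inv_simps:
  assumes "g \<in> G"
  shows "inv g (g x) = x" "g (inv g x) = x" "g \<circ> inv g = id" "inv g \<circ> g = id" "inv (inv g) = g"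
  using group_bij[OF assms] by (auto simp: bij_def surj_iff inv_o_cancel inv_inv_eq surj_f_inv_f)

lemma group_image_eq: "g \<in> G \<Longrightarrow> g ` A = inv g -` A"
  using group_bij by (simp add: bij_vimage_eq_inv_image group_bij bij_imp_bij_inv inv_inv_eq)

lemma group_measurable [measurable (raw)]: "g \<in> G \<Longrightarrow> g \<in> borel \<rightarrow>\<^sub>M borel"
  by (intro borel_measurable_continuous_onI)
    (auto simp: continuous_on_iff intro!: exI)

lemma group_image_borel: "g \<in> G \<Longrightarrow> A \<in> sets borel \<Longrightarrow> g ` A \<in> sets borel"
  unfolding group_image_eq using measurable_sets[OF group_measurable[of "inv g"], of A] by simp

text \<open>Proper discontinuity, applied to one orbit and to countably many compact sets that exhaust the space.\<close>
lemma countable_group: "countable G"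
proof -
  obtain V :: "nat \<Rightarrow> 'a set" where V: "incseq V" "\<And>n. open (V n)" "\<And>n. compact (closure (V n))" "(\<Union>n. V n) = UNIV"
    by (rule open_exhaustion[OF locally_compact]) (rule that)
  have "G \<subseteq> (\<Union>n. {g\<in>G. g x \<in> closure (V n)})" for x
  proof
    fix g assume "g \<in> G"
    moreover obtain n where "g x \<in> V n" using V(4) by blast
    ultimately show "g \<in> (\<Union>n. {g\<in>G. g x \<in> closure (V n)})" using closure_subset[of "V n"] by blast
  qed
  moreover have "countable (\<Union>n. {g\<in>G. g x \<in> closure (V n)})" for x
  proof (rule countable_UN)
    show "countable {g\<in>G. g x \<in> closure (V n)}" for n
      using discontinuous V(3)[of n] by (intro countable_finite) (simp add: properly_discontinuous_def)
  qed simp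
  ultimately show ?thesis by (rule countable_subset[of _ "(\<Union>n. {g\<in>G. g undefined \<in> closure (V n)})"])
qed

lemma B0_borel [measurable]: "B0 \<in> sets borel"
  and cells_cover: "(\<Union>g\<in>G. g ` B0) = UNIV"
  using fundamental by (auto simp: fundamental_region_def)

lemma cells_disjoint: "disjoint_family_on (\<lambda>g. g ` B0) G"
  unfolding disjoint_family_on_def
proof (intro ballI impI)
  fix g h assume gh: "g \<in> G" "h \<in> G" "g \<noteq> h"
  have "inv g \<circ> h \<noteq> id"
  proof
    assume "inv g \<circ> h = id"
    then have "g \<circ> (inv g \<circ> h) = g" by simp
    then show False using gh group_inv_simps(3)[OF gh(1)] by (simp flip: comp_assoc)
  qed
  then have e: "B0 \<inter> (inv g \<circ> h) ` B0 = {}" using fundamental group_comp[OF group_inv[OF gh(1)] gh(2)] unfolding fundamental_region_def by blast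
  show "g ` B0 \<inter> h ` B0 = {}"
  proof (rule ccontr)
    assume "g ` B0 \<inter> h ` B0 \<noteq> {}"
    then obtain x y where xy: "x \<in> B0" "y \<in> B0" "g x = h y" by auto
    then have "x = (inv g \<circ> h) y" using group_inv_simps(1)[OF gh(1), of x] by simp
    then show False using e xy by blast
  qed
qed

lemma nn_integral_cells:
  fixes f :: "'x \<Rightarrow> ennreal"
  assumes "f \<in> borel_measurable M" "k \<in> M \<rightarrow>\<^sub>M borel"
  shows "(\<integral>\<^sup>+x. f x \<partial>M) = (\<integral>\<^sup>+g. (\<integral>\<^sup>+x. f x * indicator (g ` B0) (k x) \<partial>M) \<partial>count_space G)"
  using assms cells_cover
  by (intro nn_integral_partition[where N = borel] countable_group group_image_borel B0_borel cells_disjoint) auto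

lemma flow_measurable [measurable (raw)]: "g \<in> G \<Longrightarrow> \<theta> g \<in> P \<rightarrow>\<^sub>M P"
proof -
  assume g: "g \<in> G"
  have "(\<lambda>(\<omega>, g). \<theta> g \<omega>) \<in> P \<Otimes>\<^sub>M count_space G \<rightarrow>\<^sub>M P" using flow by (simp add: measurable_flow_def)
  from measurable_compose[OF measurable_Pair2'[of g "count_space G" P] this] g
  show "\<theta> g \<in> P \<rightarrow>\<^sub>M P" by simp
qed

lemma flow_id [simp]: "\<theta> id \<omega> = \<omega>"
  and flow_flow: "g \<in> G \<Longrightarrow> h \<in> G \<Longrightarrow> \<theta> g (\<theta> h \<omega>) = \<theta> (g \<circ> h) \<omega>"
  using flow by (auto simp: measurable_flow_def fun_eq_iff)

lemma flow_inv: "g \<in> G \<Longrightarrow> \<theta> g (\<theta> (inv g) \<omega>) = \<omega>" "g \<in> G \<Longrightarrow> \<theta> (inv g) (\<theta> g \<omega>) = \<omega>"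
  by (simp_all add: flow_flow group_inv_simps)

lemma distr_flow:
  assumes g: "g \<in> G" shows "distr P P (\<theta> g) = P"
proof (rule measure_eqI)
  fix A assume "A \<in> sets (distr P P (\<theta> g))"
  then have A: "A \<in> sets P" by simp
  have "\<theta> g -` A = \<theta> (inv g) ` A"
  proof
    show "\<theta> g -` A \<subseteq> \<theta> (inv g) ` A"
    proof
      fix \<omega> assume "\<omega> \<in> \<theta> g -` A"
      then show "\<omega> \<in> \<theta> (inv g) ` A" using g by (intro image_eqI[of _ _ "\<theta> g \<omega>"]) (auto simp: flow_inv)
    qed
    show "\<theta> (inv g) ` A \<subseteq> \<theta> g -` A" using g by (auto simp: flow_inv)
  qed
  then show "emeasure (distr P P (\<theta> g)) A = emeasure P A"
    using stationary g A by (simp add: emeasure_distr flow_measurable space_P stationary_def)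
qed simp

lemma nn_integral_flow:
  assumes "g \<in> G" and [measurable]: "f \<in> borel_measurable P"
  shows "(\<integral>\<^sup>+\<omega>. f (\<theta> g \<omega>) \<partial>P) = (\<integral>\<^sup>+\<omega>. f \<omega> \<partial>P)"
  by (subst distr_flow[OF assms(1), symmetric], subst nn_integral_distr)
    (use assms(1) in \<open>auto simp: distr_flow intro: flow_measurable\<close>)

lemma AE_flow:
  assumes "g \<in> G" "AE \<omega> in P. Q \<omega>"
  shows "AE \<omega> in P. Q (\<theta> g \<omega>)"
proof (rule AE_distrD[OF flow_measurable[OF assms(1)]])
  show "AE \<omega> in distr P P (\<theta> g). Q \<omega>" unfolding distr_flow[OF assms(1)] by (rule assms(2))
qed

text \<open>The mass transport principle. Read \<open>a \<omega> g h\<close> as the mass that the cell \<open>g B0\<close> sends to \<open>h B0\<close>. Moving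
  \<open>\<omega>\<close> by \<open>\<theta> g\<close> preserves \<open>P\<close> and turns the mass sent from \<open>g B0\<close> to \<open>B0\<close> into the mass sent from \<open>B0\<close> to
  \<open>inv g B0\<close>. So what \<open>B0\<close> receives and what it sends have the same expectation.\<close>
lemma mass_transport:
  fixes a :: "'w \<Rightarrow> ('a \<Rightarrow> 'a) \<Rightarrow> ('a \<Rightarrow> 'a) \<Rightarrow> ennreal"
  assumes meas: "\<And>g. g \<in> G \<Longrightarrow> (\<lambda>\<omega>. a \<omega> g id) \<in> borel_measurable P"
    and inv: "\<And>\<omega> k g h. k \<in> G \<Longrightarrow> g \<in> G \<Longrightarrow> h \<in> G \<Longrightarrow> a (\<theta> k \<omega>) (k \<circ> g) (k \<circ> h) = a \<omega> g h"
  shows "(\<integral>\<^sup>+\<omega>. (\<integral>\<^sup>+g. a \<omega> g id \<partial>count_space G) \<partial>P) = (\<integral>\<^sup>+\<omega>. (\<integral>\<^sup>+g. a \<omega> id g \<partial>count_space G) \<partial>P)"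
proof -
  have flip: "a \<omega> id g = a (\<theta> (inv g) \<omega>) (inv g) id" if "g \<in> G" for g \<omega>
    using inv[of "inv g" id g \<omega>] that by (simp add: group_inv_simps)
  have meas': "(\<lambda>\<omega>. a \<omega> id g) \<in> borel_measurable P" if "g \<in> G" for g
    unfolding flip[OF that] using that by (intro measurable_compose[OF flow_measurable meas]) auto
  have bij: "bij_betw inv G G"
    by (rule bij_betw_byWitness[where f' = inv]) (auto simp: group_inv_simps)
  have "(\<integral>\<^sup>+\<omega>. (\<integral>\<^sup>+g. a \<omega> g id \<partial>count_space G) \<partial>P) = (\<integral>\<^sup>+g. (\<integral>\<^sup>+\<omega>. a \<omega> g id \<partial>P) \<partial>count_space G)"
    by (rule nn_integral_count_space_nn_integral[OF countable_group meas])
  also have "\<dots> = (\<integral>\<^sup>+g. (\<integral>\<^sup>+\<omega>. a (\<theta> g \<omega>) g id \<partial>P) \<partial>count_space G)"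
    by (intro nn_integral_cong nn_integral_flow[symmetric] meas) auto
  also have "\<dots> = (\<integral>\<^sup>+g. (\<integral>\<^sup>+\<omega>. a \<omega> id (inv g) \<partial>P) \<partial>count_space G)"
    by (intro nn_integral_cong) (simp add: flip group_inv_simps)
  also have "\<dots> = (\<integral>\<^sup>+g. (\<integral>\<^sup>+\<omega>. a \<omega> id g \<partial>P) \<partial>count_space G)"
    by (rule nn_integral_bij_count_space[OF bij])
  also have "\<dots> = (\<integral>\<^sup>+\<omega>. (\<integral>\<^sup>+g. a \<omega> id g \<partial>count_space G) \<partial>P)"
    by (rule nn_integral_count_space_nn_integral[OF countable_group meas', symmetric])
  finally show ?thesis .
qed

lemma locally_compact_prod: "locally_compact_type TYPE('a \<times> 'a)"
  by (rule locally_compact_type_prod[OF locally_compact locally_compact])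

lemma random_measure_sets:
  assumes "random_measure P \<kappa>"
  shows "sets (\<kappa> \<omega>) = sets borel" "space (\<kappa> \<omega>) = UNIV"
  using radon_measuresD(1,2)[OF random_measure_radon[OF assms]] by (auto simp: space_P)

text \<open>The exhaustion of the product space consists of rectangles, on which equivariance is assumed.\<close>
lemma finite_squares:
  obtains V :: "nat \<Rightarrow> 'a set" where "\<And>n. V n \<in> sets borel" "(\<Union>n. V n \<times> V n) = UNIV"
    "\<And>\<nu> n. \<nu> \<in> radon_measures \<Longrightarrow> emeasure \<nu> (V n \<times> V n) \<noteq> \<infinity>"
proof -
  obtain V :: "nat \<Rightarrow> 'a set" where V: "incseq V" "\<And>n. open (V n)" "\<And>n. compact (closure (V n))" "(\<Union>n. V n) = UNIV"
    by (rule open_exhaustion[OF locally_compact]) (rule that)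
  show ?thesis
  proof (rule that[of V])
    show "(\<Union>n. V n \<times> V n) = UNIV"
    proof -
      have "(x, y) \<in> (\<Union>n. V n \<times> V n)" for x y
      proof -
        obtain m n where "x \<in> V m" "y \<in> V n" using V(4) by blast
        then have "x \<in> V (max m n)" "y \<in> V (max m n)" using incseqD[OF V(1)] by (meson max.cobounded1 max.cobounded2 subsetD)+
        then show ?thesis by blast
      qed
      then show ?thesis by auto
    qed
    show "emeasure \<nu> (V n \<times> V n) \<noteq> \<infinity>" if "\<nu> \<in> radon_measures" for \<nu> n
    proof -
      have "emeasure \<nu> (V n \<times> V n) \<le> emeasure \<nu> (closure (V n) \<times> closure (V n))"
        using radon_measuresD(1)[OF that] closure_subset
        by (intro emeasure_mono) (auto intro!: borel_closed closed_Times)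
      then show ?thesis using radon_measuresD(3)[OF that compact_Times[OF V(3)[of n] V(3)[of n]]] by (auto simp: top_unique)
    qed
  qed (use V in auto)
qed

lemma map_prod_measurable [measurable (raw)]: "g \<in> G \<Longrightarrow> map_prod g g \<in> borel \<rightarrow>\<^sub>M borel"
  by (intro borel_measurable_continuous_onI)
    (auto simp: continuous_on_iff dist_Pair_Pair dist_prod_def map_prod_def split_beta intro!: exI)

text \<open>Equivariance is assumed on rectangles; it extends to all Borel sets because rectangles form a
  generator that is stable under intersections and contains an exhaustion by sets of finite mass.\<close>
lemma equivariant2_distr:
  assumes \<kappa>: "random_measure P \<kappa>" "equivariant2 G \<theta> \<kappa>" and g: "g \<in> G"
  shows "\<kappa> (\<theta> g \<omega>) = distr (\<kappa> \<omega>) borel (map_prod g g)"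
proof -
  obtain V :: "nat \<Rightarrow> 'a set" where V: "\<And>n. V n \<in> sets borel" "(\<Union>n. V n \<times> V n) = UNIV"
    "\<And>\<nu> n. \<nu> \<in> radon_measures \<Longrightarrow> emeasure \<nu> (V n \<times> V n) \<noteq> \<infinity>"
    by (rule finite_squares, rule that, assumption+)
  note s = random_measure_sets[OF \<kappa>(1)]
  show ?thesis
  proof (rule measure_eqI_rectangles[where V = "\<lambda>n. V n \<times> V n"])
    show "sets (\<kappa> (\<theta> g \<omega>)) = sets borel" by (rule s)
    show "V n \<times> V n \<in> rectangles" for n using V(1) by (auto simp: rectangles_def)
    show "emeasure (\<kappa> (\<theta> g \<omega>)) (V n \<times> V n) \<noteq> \<infinity>" for n
      using V(3) random_measure_radon[OF \<kappa>(1)] by (simp add: space_P)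
    fix A B :: "'a set" assume A: "A \<in> sets borel" and B: "B \<in> sets borel"
    have AB: "A = g ` (g -` A)" "B = g ` (g -` B)" using group_bij[OF g] by (auto simp: bij_def)
    have m: "g -` A \<in> sets borel" "g -` B \<in> sets borel"
      using measurable_sets[OF group_measurable[OF g] A] measurable_sets[OF group_measurable[OF g] B] by auto
    have "emeasure (\<kappa> (\<theta> g \<omega>)) (A \<times> B) = emeasure (\<kappa> \<omega>) ((g -` A) \<times> (g -` B))"
      using \<kappa>(2) g m AB unfolding equivariant2_def by metis
    also have "(g -` A) \<times> (g -` B) = map_prod g g -` (A \<times> B)" by auto
    also have "emeasure (\<kappa> \<omega>) \<dots> = emeasure (distr (\<kappa> \<omega>) borel (map_prod g g)) (A \<times> B)"
      using A B s g by (subst emeasure_distr) (auto simp: map_prod_measurable borel_Times cong: measurable_cong_sets)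
    finally show "emeasure (\<kappa> (\<theta> g \<omega>)) (A \<times> B) = emeasure (distr (\<kappa> \<omega>) borel (map_prod g g)) (A \<times> B)" .
  qed (use V in auto)
qed

lemma nn_integral_equivariant2:
  fixes f :: "'a \<times> 'a \<Rightarrow> ennreal"
  assumes \<kappa>: "random_measure P \<kappa>" "equivariant2 G \<theta> \<kappa>" and k: "k \<in> G"
    and f: "f \<in> borel_measurable borel" and A: "A \<in> sets borel" and B: "B \<in> sets borel"
  shows "(\<integral>\<^sup>+z\<in>k ` A \<times> k ` B. f z \<partial>\<kappa> (\<theta> k \<omega>)) = (\<integral>\<^sup>+z\<in>A \<times> B. f (map_prod k k z) \<partial>\<kappa> \<omega>)"
proof -
  have m: "(\<lambda>z. f z * indicator (k ` A \<times> k ` B) z) \<in> borel_measurable borel"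
    using f k A B by (intro borel_measurable_times_ennreal borel_measurable_indicator borel_Times group_image_borel)
  have mp: "map_prod k k \<in> \<kappa> \<omega> \<rightarrow>\<^sub>M borel"
    using map_prod_measurable[OF k] random_measure_sets(1)[OF \<kappa>(1)] by (simp cong: measurable_cong_sets)
  have "(\<integral>\<^sup>+z\<in>k ` A \<times> k ` B. f z \<partial>\<kappa> (\<theta> k \<omega>))
      = (\<integral>\<^sup>+z. f (map_prod k k z) * indicator (k ` A \<times> k ` B) (map_prod k k z) \<partial>\<kappa> \<omega>)"
    unfolding equivariant2_distr[OF \<kappa> k] by (rule nn_integral_distr[OF mp]) (use m in simp)
  also have "\<dots> = (\<integral>\<^sup>+z\<in>A \<times> B. f (map_prod k k z) \<partial>\<kappa> \<omega>)"
  proof (rule nn_integral_cong)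
    fix z :: "'a \<times> 'a"
    have "k x \<in> k ` C \<longleftrightarrow> x \<in> C" for x C using group_bij[OF k] by (auto simp: bij_def inj_def)
    then show "f (map_prod k k z) * indicator (k ` A \<times> k ` B) (map_prod k k z) = f (map_prod k k z) * indicator (A \<times> B) z"
      by (cases z) (simp add: indicator_def)
  qed
  finally show ?thesis .
qed

lemma emeasure_random_measurable:
  "random_measure P \<Lambda> \<Longrightarrow> A \<in> sets borel \<Longrightarrow> (\<lambda>\<omega>. emeasure (\<Lambda> \<omega> :: 'a measure) A) \<in> borel_measurable P"
  by (rule random_measure_emeasure_measurable[OF locally_compact])

lemma emeasure_random_measurable2:
  "random_measure P q \<Longrightarrow> C \<in> sets borel \<Longrightarrow> (\<lambda>\<omega>. emeasure (q \<omega> :: ('a \<times> 'a) measure) C) \<in> borel_measurable P"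
  by (rule random_measure_emeasure_measurable[OF locally_compact_prod])

lemma nn_integral_random_measurable2:
  "random_measure P q \<Longrightarrow> f \<in> borel_measurable borel \<Longrightarrow> (\<lambda>\<omega>. \<integral>\<^sup>+z. f z \<partial>(q \<omega> :: ('a \<times> 'a) measure)) \<in> borel_measurable P"
  by (intro measurable_nn_integral_kernel emeasure_random_measurable2 random_measure_sets)

text \<open>Mass transport for a random measure on pairs with an invariant weight \<open>\<phi>\<close>. The weight may depend on
  \<open>\<omega>\<close>, which is needed for the cost of a glued coupling.\<close>
lemma mass_transport_measure:
  fixes \<phi> :: "'w \<Rightarrow> 'a \<times> 'a \<Rightarrow> ennreal"
  assumes \<kappa>: "random_measure P \<kappa>" "equivariant2 G \<theta> \<kappa>"
    and \<phi> [measurable]: "\<And>\<omega>. \<phi> \<omega> \<in> borel_measurable borel"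
    and inv: "\<And>g \<omega> x y. g \<in> G \<Longrightarrow> \<phi> (\<theta> g \<omega>) (g x, g y) = \<phi> \<omega> (x, y)"
    and meas: "\<And>A B. A \<in> sets borel \<Longrightarrow> B \<in> sets borel \<Longrightarrow>
      (\<lambda>\<omega>. \<integral>\<^sup>+z\<in>A \<times> B. \<phi> \<omega> z \<partial>\<kappa> \<omega>) \<in> borel_measurable P"
  shows "(\<integral>\<^sup>+\<omega>. (\<integral>\<^sup>+z\<in>UNIV \<times> B0. \<phi> \<omega> z \<partial>\<kappa> \<omega>) \<partial>P) = (\<integral>\<^sup>+\<omega>. (\<integral>\<^sup>+z\<in>B0 \<times> UNIV. \<phi> \<omega> z \<partial>\<kappa> \<omega>) \<partial>P)"
proof -
  note s = random_measure_sets[OF \<kappa>(1)]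
  define a where "a \<omega> g h = (\<integral>\<^sup>+z\<in>(g ` B0) \<times> (h ` B0). \<phi> \<omega> z \<partial>\<kappa> \<omega>)" for \<omega> g h
  have ms [measurable]: "\<phi> \<omega> \<in> borel_measurable (\<kappa> \<omega>')" "fst \<in> \<kappa> \<omega>' \<rightarrow>\<^sub>M borel" "snd \<in> \<kappa> \<omega>' \<rightarrow>\<^sub>M borel" for \<omega> \<omega>'
    using s \<phi>[of \<omega>] by (auto cong: measurable_cong_sets simp flip: borel_prod)
  have B0s: "UNIV \<times> B0 \<in> sets (\<kappa> \<omega>)" "B0 \<times> UNIV \<in> sets (\<kappa> \<omega>)" for \<omega>
    using s by (auto intro!: borel_Times)
  have "(\<integral>\<^sup>+\<omega>. (\<integral>\<^sup>+g. a \<omega> g id \<partial>count_space G) \<partial>P) = (\<integral>\<^sup>+\<omega>. (\<integral>\<^sup>+g. a \<omega> id g \<partial>count_space G) \<partial>P)"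
  proof (rule mass_transport)
    show "(\<lambda>\<omega>. a \<omega> g id) \<in> borel_measurable P" if "g \<in> G" for g
      unfolding a_def using that by (intro meas group_image_borel) auto
    fix \<omega> k g h assume G: "k \<in> G" "g \<in> G" "h \<in> G"
    have "a (\<theta> k \<omega>) (k \<circ> g) (k \<circ> h) = (\<integral>\<^sup>+z\<in>g ` B0 \<times> h ` B0. \<phi> (\<theta> k \<omega>) (map_prod k k z) \<partial>\<kappa> \<omega>)"
      unfolding a_def image_comp[symmetric]
      by (intro nn_integral_equivariant2 \<kappa> G \<phi> group_image_borel B0_borel)
    also have "\<dots> = a \<omega> g h"
      unfolding a_def using inv[OF G(1)] by (intro nn_integral_cong) (auto simp: map_prod_def split_beta)
    finally show "a (\<theta> k \<omega>) (k \<circ> g) (k \<circ> h) = a \<omega> g h" .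
  qed
  moreover have "(\<integral>\<^sup>+g. a \<omega> g id \<partial>count_space G) = (\<integral>\<^sup>+z\<in>UNIV \<times> B0. \<phi> \<omega> z \<partial>\<kappa> \<omega>)" for \<omega>
    using B0s
    by (subst nn_integral_cells[where k = fst]) (auto simp: a_def intro!: nn_integral_cong split: split_indicator)
  moreover have "(\<integral>\<^sup>+g. a \<omega> id g \<partial>count_space G) = (\<integral>\<^sup>+z\<in>B0 \<times> UNIV. \<phi> \<omega> z \<partial>\<kappa> \<omega>)" for \<omega>
    using B0s
    by (subst nn_integral_cells[where k = snd]) (auto simp: a_def intro!: nn_integral_cong split: split_indicator)
  ultimately show ?thesis by simp
qed

end

section \<open>Couplings, costs and symmetry\<close>

definition coupling :: "('a::topological_space) measure \<Rightarrow> 'a measure \<Rightarrow> ('a \<times> 'a) measure \<Rightarrow> bool" where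
  "coupling l m q \<longleftrightarrow> sets q = sets borel \<and> distr q borel fst = l \<and> distr q borel snd = m"

lemma emeasure_fst_marginal:
  fixes q :: "('a::second_countable_topology \<times> 'a) measure"
  assumes "sets q = sets borel" "A \<in> sets borel"
  shows "emeasure (distr q borel fst) A = emeasure q (A \<times> UNIV)"
proof -
  have "fst \<in> q \<rightarrow>\<^sub>M borel" using assms(1) by (simp flip: borel_prod cong: measurable_cong_sets)
  moreover have "fst -` A \<inter> space q = A \<times> UNIV" using sets_eq_imp_space_eq[OF assms(1)] by auto
  ultimately show ?thesis using assms(2) by (simp add: emeasure_distr)
qed

lemma emeasure_snd_marginal:
  fixes q :: "('a::second_countable_topology \<times> 'a) measure"
  assumes "sets q = sets borel" "A \<in> sets borel"
  shows "emeasure (distr q borel snd) A = emeasure q (UNIV \<times> A)"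
proof -
  have "snd \<in> q \<rightarrow>\<^sub>M borel" using assms(1) by (simp flip: borel_prod cong: measurable_cong_sets)
  moreover have "snd -` A \<inter> space q = UNIV \<times> A" using sets_eq_imp_space_eq[OF assms(1)] by auto
  ultimately show ?thesis using assms(2) by (simp add: emeasure_distr)
qed

lemma couplingD:
  fixes q :: "('a::second_countable_topology \<times> 'a) measure"
  assumes "coupling l m q"
  shows "sets q = sets borel" "A \<in> sets borel \<Longrightarrow> emeasure q (A \<times> UNIV) = emeasure l A"
    "A \<in> sets borel \<Longrightarrow> emeasure q (UNIV \<times> A) = emeasure m A"
  using assms emeasure_fst_marginal[of q A] emeasure_snd_marginal[of q A] by (auto simp: coupling_def)

lemma couplingI:
  fixes q :: "('a::second_countable_topology \<times> 'a) measure"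
  assumes "sets q = sets borel" "sets l = sets borel" "sets m = sets borel"
    "\<And>A. A \<in> sets borel \<Longrightarrow> emeasure q (A \<times> UNIV) = emeasure l A"
    "\<And>A. A \<in> sets borel \<Longrightarrow> emeasure q (UNIV \<times> A) = emeasure m A"
  shows "coupling l m q"
  unfolding coupling_def
proof (intro conjI)
  show "distr q borel fst = l"
    by (rule measure_eqI) (use assms in \<open>auto simp: emeasure_fst_marginal\<close>)
  show "distr q borel snd = m"
    by (rule measure_eqI) (use assms in \<open>auto simp: emeasure_snd_marginal\<close>)
qed (rule assms)

lemma coupling_imp_semicoupling: "coupling l m q \<Longrightarrow> semicoupling l m q"
  by (auto simp: coupling_def semicoupling_def)

context equivariant_flow
begin

lemma emeasure_cells:
  fixes \<nu> :: "'a measure"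
  assumes "sets \<nu> = sets borel" "A \<in> sets borel"
  shows "emeasure \<nu> A = (\<integral>\<^sup>+g. emeasure \<nu> (A \<inter> g ` B0) \<partial>count_space G)"
proof -
  have "A = (\<Union>g\<in>G. A \<inter> g ` B0)" using cells_cover by blast
  then have "emeasure \<nu> A = emeasure \<nu> (\<Union>g\<in>G. A \<inter> g ` B0)" by simp
  also have "\<dots> = (\<integral>\<^sup>+g. emeasure \<nu> (A \<inter> g ` B0) \<partial>count_space G)"
  proof (rule emeasure_UN_countable)
    show "A \<inter> g ` B0 \<in> sets \<nu>" if "g \<in> G" for g
      using assms group_image_borel[OF that B0_borel] by auto
    show "disjoint_family_on (\<lambda>g. A \<inter> g ` B0) G"
      using cells_disjoint unfolding disjoint_family_on_def by blast
  qed (rule countable_group)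
  finally show ?thesis .
qed

lemma emeasure_equivariant_cell:
  assumes "equivariant G \<theta> \<Lambda>" "g \<in> G" "A \<in> sets borel"
  shows "emeasure (\<Lambda> \<omega>) (g ` A) = emeasure (\<Lambda> (\<theta> (inv g) \<omega>)) A"
  using assms flow_inv(1)[OF assms(2), of \<omega>] unfolding equivariant_def by metis

lemma emeasure_equivariant2_cell:
  assumes "equivariant2 G \<theta> q" "g \<in> G" "A \<in> sets borel" "B \<in> sets borel"
  shows "emeasure (q \<omega>) (g ` A \<times> g ` B) = emeasure (q (\<theta> (inv g) \<omega>)) (A \<times> B)"
  using assms flow_inv(1)[OF assms(2), of \<omega>] unfolding equivariant2_def by metis

lemma AE_finite_cells:
  assumes \<Lambda>: "random_measure P \<Lambda>" "equivariant G \<theta> \<Lambda>" "intensity P B0 \<Lambda> = 1"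
  shows "AE \<omega> in P. \<forall>g\<in>G. emeasure (\<Lambda> \<omega>) (g ` B0) \<noteq> \<infinity>"
proof -
  have "AE \<omega> in P. emeasure (\<Lambda> \<omega>) B0 \<noteq> \<infinity>"
    using \<Lambda> by (intro nn_integral_PInf_AE emeasure_random_measurable) (auto simp: intensity_def)
  then have "AE \<omega> in P. emeasure (\<Lambda> (\<theta> (inv g) \<omega>)) B0 \<noteq> \<infinity>" if "g \<in> G" for g
    using that by (intro AE_flow) auto
  then have "\<forall>g\<in>G. AE \<omega> in P. emeasure (\<Lambda> \<omega>) (g ` B0) \<noteq> \<infinity>"
    by (simp add: emeasure_equivariant_cell[OF \<Lambda>(2)])
  then show ?thesis by (simp add: AE_ball_countable countable_group)
qed

lemma emeasure_mass_transport:
  assumes q: "random_measure P q" "equivariant2 G \<theta> q"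
  shows "(\<integral>\<^sup>+\<omega>. emeasure (q \<omega>) (UNIV \<times> B0) \<partial>P) = (\<integral>\<^sup>+\<omega>. emeasure (q \<omega>) (B0 \<times> UNIV) \<partial>P)"
proof -
  note s = random_measure_sets[OF q(1)]
  have "(\<lambda>\<omega>. \<integral>\<^sup>+z\<in>A \<times> B. 1 \<partial>q \<omega>) \<in> borel_measurable P" if "A \<in> sets borel" "B \<in> sets borel" for A B
    using that q s emeasure_random_measurable2[OF q(1) borel_Times[OF that]] by (simp add: borel_Times)
  then show ?thesis
    using mass_transport_measure[OF q, of "\<lambda>_ _. 1"] s by (simp add: borel_Times)
qed

text \<open>By mass transport the first marginal of \<open>q\<close> has the same intensity as the second one, that is, as \<open>M\<close>.
  It is dominated by \<open>\<Lambda>\<close>, and both intensities are \<open>1\<close>. So it agrees with \<open>\<Lambda>\<close> almost everywhere on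
  \<open>B0\<close>, and by stationarity on every cell. Domination and equal finite mass on a cell force equality
  of the measures inside the cell.\<close>
lemma AE_coupling:
  assumes \<Lambda>: "random_measure P \<Lambda>" "equivariant G \<theta> \<Lambda>" "intensity P B0 \<Lambda> = 1"
    and M: "random_measure P M" "intensity P B0 M = 1"
    and q: "q \<in> equivariant_semicouplings P G \<theta> \<Lambda> M"
  shows "AE \<omega> in P. coupling (\<Lambda> \<omega>) (M \<omega>) (q \<omega>)"
proof -
  have q': "random_measure P q" "equivariant2 G \<theta> q" "AE \<omega> in P. semicoupling (\<Lambda> \<omega>) (M \<omega>) (q \<omega>)"
    using q by (auto simp: equivariant_semicouplings_def)
  note s = random_measure_sets[OF q'(1)]
  note [measurable] = emeasure_random_measurable[OF \<Lambda>(1) B0_borel]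
    emeasure_random_measurable2[OF q'(1) borel_Times[OF B0_borel sets.top[of borel, unfolded space_borel]]]
  have semi: "emeasure (q \<omega>) (A \<times> UNIV) \<le> emeasure (\<Lambda> \<omega>) A" "emeasure (q \<omega>) (UNIV \<times> A) = emeasure (M \<omega>) A"
    if "semicoupling (\<Lambda> \<omega>) (M \<omega>) (q \<omega>)" "A \<in> sets borel" for \<omega> A
    using that emeasure_fst_marginal[OF s(1)[of \<omega>], of A] emeasure_snd_marginal[OF s(1)[of \<omega>], of A]
    by (auto simp: semicoupling_def)
  have le: "AE \<omega> in P. emeasure (q \<omega>) (B0 \<times> UNIV) \<le> emeasure (\<Lambda> \<omega>) B0"
    using q'(3) by eventually_elim (rule semi, auto)
  have "(\<integral>\<^sup>+\<omega>. emeasure (q \<omega>) (UNIV \<times> B0) \<partial>P) = (\<integral>\<^sup>+\<omega>. emeasure (M \<omega>) B0 \<partial>P)"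
    using q'(3) by (intro nn_integral_cong_AE, eventually_elim) (rule semi, auto)
  then have one: "(\<integral>\<^sup>+\<omega>. emeasure (q \<omega>) (B0 \<times> UNIV) \<partial>P) = 1"
    using emeasure_mass_transport[OF q'(1,2)] M(2) by (simp add: intensity_def)
  \<comment> \<open>The mass of \<open>\<Lambda>\<close> in \<open>B0\<close> that is not transported has expectation \<open>1 - 1 = 0\<close>.\<close>
  have "(\<integral>\<^sup>+\<omega>. emeasure (\<Lambda> \<omega>) B0 - emeasure (q \<omega>) (B0 \<times> UNIV) \<partial>P)
      = (\<integral>\<^sup>+\<omega>. emeasure (\<Lambda> \<omega>) B0 \<partial>P) - (\<integral>\<^sup>+\<omega>. emeasure (q \<omega>) (B0 \<times> UNIV) \<partial>P)"
    using one le by (intro nn_integral_diff) auto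
  also have "\<dots> = 0" using one \<Lambda>(3) by (simp add: intensity_def)
  finally have "AE \<omega> in P. emeasure (\<Lambda> \<omega>) B0 - emeasure (q \<omega>) (B0 \<times> UNIV) = 0"
    by (subst (asm) nn_integral_0_iff_AE) auto
  then have "AE \<omega> in P. emeasure (\<Lambda> \<omega>) B0 \<le> emeasure (q \<omega>) (B0 \<times> UNIV)"
    by eventually_elim (rule ennreal_minus_eq_0)
  then have "AE \<omega> in P. emeasure (\<Lambda> (\<theta> (inv g) \<omega>)) B0 \<le> emeasure (q (\<theta> (inv g) \<omega>)) (B0 \<times> UNIV)" if "g \<in> G" for g
    using that by (intro AE_flow) auto
  moreover have "emeasure (q \<omega>) (g ` B0 \<times> UNIV) = emeasure (q (\<theta> (inv g) \<omega>)) (B0 \<times> UNIV)" if "g \<in> G" for g \<omega>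
    using emeasure_equivariant2_cell[OF q'(2) that B0_borel sets.top[of borel, unfolded space_borel], of \<omega>] group_bij[OF that]
    by (simp add: bij_def)
  ultimately have "\<forall>g\<in>G. AE \<omega> in P. emeasure (\<Lambda> \<omega>) (g ` B0) \<le> emeasure (q \<omega>) (g ` B0 \<times> UNIV)"
    by (simp add: emeasure_equivariant_cell[OF \<Lambda>(2)])
  then have "AE \<omega> in P. \<forall>g\<in>G. emeasure (\<Lambda> \<omega>) (g ` B0) \<le> emeasure (q \<omega>) (g ` B0 \<times> UNIV)"
    by (simp add: AE_ball_countable countable_group)
  then show ?thesis using AE_finite_cells[OF \<Lambda>] q'(3)
  proof eventually_elim
    fix \<omega> assume ge: "\<forall>g\<in>G. emeasure (\<Lambda> \<omega>) (g ` B0) \<le> emeasure (q \<omega>) (g ` B0 \<times> UNIV)"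
      and fin: "\<forall>g\<in>G. emeasure (\<Lambda> \<omega>) (g ` B0) \<noteq> \<infinity>" and sc: "semicoupling (\<Lambda> \<omega>) (M \<omega>) (q \<omega>)"
    note sL = random_measure_sets(1)[OF \<Lambda>(1), of \<omega>]
    let ?N = "distr (q \<omega>) borel fst"
    have N: "emeasure ?N A = emeasure (q \<omega>) (A \<times> UNIV)" if "A \<in> sets borel" for A
      by (rule emeasure_fst_marginal[OF s(1) that])
    have N_le: "emeasure ?N A \<le> emeasure (\<Lambda> \<omega>) A" if "A \<in> sets borel" for A
      using semi(1)[OF sc that] N[OF that] by simp
    have cell: "emeasure ?N (A \<inter> g ` B0) = emeasure (\<Lambda> \<omega>) (A \<inter> g ` B0)" if A: "A \<in> sets borel" and g: "g \<in> G" for A g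
    proof (rule antisym)
      have C: "g ` B0 \<in> sets borel" by (rule group_image_borel[OF g B0_borel])
      have AC: "A \<inter> g ` B0 \<in> sets borel" "g ` B0 - A \<in> sets borel" using A C by auto
      show "emeasure ?N (A \<inter> g ` B0) \<le> emeasure (\<Lambda> \<omega>) (A \<inter> g ` B0)" by (rule N_le[OF AC(1)])
      have split: "emeasure \<nu> (g ` B0) = emeasure \<nu> (A \<inter> g ` B0) + emeasure \<nu> (g ` B0 - A)" if "sets \<nu> = sets borel" for \<nu> :: "'a measure"
        using AC that by (subst plus_emeasure) (auto intro!: arg_cong[where f = "emeasure \<nu>"])
      have "emeasure (\<Lambda> \<omega>) (A \<inter> g ` B0) + emeasure (\<Lambda> \<omega>) (g ` B0 - A) \<le> emeasure ?N (A \<inter> g ` B0) + emeasure ?N (g ` B0 - A)"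
        using bspec[OF ge g] unfolding N[OF C, symmetric] split[OF sL] split[of ?N, OF sets_distr] .
      also have "\<dots> \<le> emeasure ?N (A \<inter> g ` B0) + emeasure (\<Lambda> \<omega>) (g ` B0 - A)"
        by (intro add_left_mono N_le AC)
      finally have "emeasure (\<Lambda> \<omega>) (g ` B0 - A) + emeasure (\<Lambda> \<omega>) (A \<inter> g ` B0) \<le> emeasure (\<Lambda> \<omega>) (g ` B0 - A) + emeasure ?N (A \<inter> g ` B0)"
        by (simp add: add.commute)
      moreover have "emeasure (\<Lambda> \<omega>) (g ` B0 - A) \<noteq> \<top>"
        using fin g split[OF sL] by (auto simp: ennreal_add_eq_top)
      ultimately show "emeasure (\<Lambda> \<omega>) (A \<inter> g ` B0) \<le> emeasure ?N (A \<inter> g ` B0)"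
        by (auto dest: ennreal_add_left_cancel_le[THEN iffD1])
    qed
    have "?N = \<Lambda> \<omega>"
    proof (rule measure_eqI)
      fix A assume "A \<in> sets ?N"
      then have A: "A \<in> sets borel" by simp
      show "emeasure ?N A = emeasure (\<Lambda> \<omega>) A"
        using A sL by (simp add: emeasure_cells[of ?N] emeasure_cells[of "\<Lambda> \<omega>"] cell cong: nn_integral_cong_simp)
    qed (simp add: sL)
    then show "coupling (\<Lambda> \<omega>) (M \<omega>) (q \<omega>)" using sc by (simp add: coupling_def semicoupling_def)
  qed
qed

abbreviation dist_pow :: "real \<Rightarrow> 'a \<times> 'a \<Rightarrow> ennreal" where
  "dist_pow p z \<equiv> ennreal (dist (fst z) (snd z) powr p)"

definition transport_cost :: "real \<Rightarrow> ('w \<Rightarrow> ('a \<times> 'a) measure) \<Rightarrow> ennreal" where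
  "transport_cost p q = (\<integral>\<^sup>+\<omega>. (\<integral>\<^sup>+z\<in>UNIV \<times> B0. dist_pow p z \<partial>q \<omega>) \<partial>P)"

lemma wasserstein_pow_eq: "wasserstein_pow p P G \<theta> B0 \<Lambda> M = (INF q\<in>equivariant_semicouplings P G \<theta> \<Lambda> M. transport_cost p q)"
  by (simp add: wasserstein_pow_def transport_cost_def)

lemma dist_powr_measurable [measurable]:
  "dist_pow p \<in> borel_measurable borel"
proof -
  have "(\<lambda>z::'a \<times> 'a. dist (fst z) (snd z)) \<in> borel_measurable borel"
    by (intro borel_measurable_continuous_onI continuous_intros)
  then show ?thesis by (intro measurable_compose[OF _ measurable_ennreal] powr_real_measurable) auto
qed

text \<open>Mass transport with the weight \<open>dist x y powr p\<close>, which is invariant because \<open>G\<close> acts by isometries.\<close>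
lemma transport_cost_fst:
  assumes q: "random_measure P q" "equivariant2 G \<theta> q"
  shows "transport_cost p q = (\<integral>\<^sup>+\<omega>. (\<integral>\<^sup>+z\<in>B0 \<times> UNIV. dist_pow p z \<partial>q \<omega>) \<partial>P)"
  unfolding transport_cost_def
proof (rule mass_transport_measure[OF q])
  show "dist_pow p \<in> borel_measurable borel" by (rule dist_powr_measurable)
  fix A B :: "'a set" assume "A \<in> sets borel" "B \<in> sets borel"
  then show "(\<lambda>\<omega>. \<integral>\<^sup>+z\<in>A \<times> B. dist_pow p z \<partial>q \<omega>) \<in> borel_measurable P"
    by (intro nn_integral_random_measurable2[OF q(1)] borel_measurable_times_ennreal dist_powr_measurable borel_measurable_indicator borel_Times)
qed auto

lemma swap_measurable [measurable]: "prod.swap \<in> (borel :: ('a \<times> 'a) measure) \<rightarrow>\<^sub>M borel"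
  by (intro borel_measurable_continuous_onI continuous_on_swap)

lemma swap_equivariant_semicoupling:
  assumes \<Lambda>: "random_measure P \<Lambda>" "equivariant G \<theta> \<Lambda>" "intensity P B0 \<Lambda> = 1"
    and M: "random_measure P M" "intensity P B0 M = 1"
    and q: "q \<in> equivariant_semicouplings P G \<theta> \<Lambda> M"
  defines "q' \<equiv> \<lambda>\<omega>. distr (q \<omega>) borel prod.swap"
  shows "q' \<in> equivariant_semicouplings P G \<theta> M \<Lambda>" "transport_cost p q' = transport_cost p q"
proof -
  have q1: "random_measure P q" "equivariant2 G \<theta> q"
    using q by (auto simp: equivariant_semicouplings_def)
  note s = random_measure_sets[OF q1(1)]
  have sm [measurable]: "prod.swap \<in> q \<omega> \<rightarrow>\<^sub>M borel" for \<omega> using s(1)[of \<omega>] by (simp cong: measurable_cong_sets)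
  have em: "emeasure (q' \<omega>) C = emeasure (q \<omega>) (prod.swap -` C)" if "C \<in> sets borel" for \<omega> C
    using that s(2)[of \<omega>] unfolding q'_def by (subst emeasure_distr) auto
  have rect: "emeasure (q' \<omega>) (A \<times> B) = emeasure (q \<omega>) (B \<times> A)" if "A \<in> sets borel" "B \<in> sets borel" for \<omega> A B
    using em[OF borel_Times[OF that]] by (simp add: vimage_def Times_eq_image_sum) (auto intro!: arg_cong[where f = "emeasure (q \<omega>)"])
  have rm: "random_measure P q'"
  proof (rule random_measureI[OF locally_compact_prod])
    show "q' \<omega> \<in> radon_measures" for \<omega>
      unfolding radon_measures_def
    proof (intro CollectI conjI allI impI)
      fix K :: "('a \<times> 'a) set" assume K: "compact K"
      have "prod.swap -` K = prod.swap ` K" by force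
      then have "compact (prod.swap -` K)" using K by (simp add: compact_continuous_image continuous_on_swap)
      then show "emeasure (q' \<omega>) K < \<infinity>"
        using radon_measuresD(3)[OF random_measure_radon[OF q1(1)]] em[of K \<omega>] compact_imp_closed[OF K] by (simp add: space_P)
    qed (simp add: q'_def)
    show "(\<lambda>\<omega>. emeasure (q' \<omega>) C) \<in> borel_measurable P" if "C \<in> sets borel" for C
      unfolding em[OF that] using measurable_sets[OF swap_measurable that]
      by (intro emeasure_random_measurable2[OF q1(1)]) simp
  qed
  have eq2: "equivariant2 G \<theta> q'"
    using q1(2) unfolding equivariant2_def by (auto simp: rect group_image_borel)
  have "AE \<omega> in P. semicoupling (M \<omega>) (\<Lambda> \<omega>) (q' \<omega>)"
    using AE_coupling[OF \<Lambda> M q]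
  proof eventually_elim
    fix \<omega> assume c: "coupling (\<Lambda> \<omega>) (M \<omega>) (q \<omega>)"
    have "sets (q' \<omega>) = sets borel" by (simp add: q'_def)
    then have "coupling (M \<omega>) (\<Lambda> \<omega>) (q' \<omega>)"
      using couplingD[OF c] random_measure_sets[OF \<Lambda>(1)] random_measure_sets[OF M(1)]
      by (intro couplingI) (auto simp: rect)
    then show "semicoupling (M \<omega>) (\<Lambda> \<omega>) (q' \<omega>)" by (rule coupling_imp_semicoupling)
  qed
  then show "q' \<in> equivariant_semicouplings P G \<theta> M \<Lambda>"
    using rm eq2 by (simp add: equivariant_semicouplings_def)
  have "(\<integral>\<^sup>+z\<in>UNIV \<times> B0. dist_pow p z \<partial>q' \<omega>) = (\<integral>\<^sup>+z\<in>B0 \<times> UNIV. dist_pow p z \<partial>q \<omega>)" for \<omega>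
    unfolding q'_def
    by (subst nn_integral_distr) (auto simp: dist_commute borel_Times intro!: nn_integral_cong split: split_indicator)
  then show "transport_cost p q' = transport_cost p q"
    unfolding transport_cost_fst[OF q1] by (simp add: transport_cost_def)
qed

lemma wasserstein_commute:
  assumes \<Lambda>: "random_measure P \<Lambda>" "equivariant G \<theta> \<Lambda>" "intensity P B0 \<Lambda> = 1"
    and M: "random_measure P M" "equivariant G \<theta> M" "intensity P B0 M = 1"
  shows "wasserstein p P G \<theta> B0 \<Lambda> M = wasserstein p P G \<theta> B0 M \<Lambda>"
proof -
  have "wasserstein_pow p P G \<theta> B0 \<Lambda> M = wasserstein_pow p P G \<theta> B0 M \<Lambda>"
    unfolding wasserstein_pow_eq
  proof (intro antisym INF_greatest)
    fix q assume q: "q \<in> equivariant_semicouplings P G \<theta> M \<Lambda>"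
    show "(INF q\<in>equivariant_semicouplings P G \<theta> \<Lambda> M. transport_cost p q) \<le> transport_cost p q"
      using swap_equivariant_semicoupling[OF M \<Lambda>(1,3) q] by (intro INF_lower2) auto
  next
    fix q assume q: "q \<in> equivariant_semicouplings P G \<theta> \<Lambda> M"
    show "(INF q\<in>equivariant_semicouplings P G \<theta> M \<Lambda>. transport_cost p q) \<le> transport_cost p q"
      using swap_equivariant_semicoupling[OF \<Lambda> M(1,3) q] by (intro INF_lower2) auto
  qed
  then show ?thesis by (simp add: wasserstein_def)
qed

end

lemma convex_on_powr_nonneg:
  assumes p: "1 \<le> (p::real)"
  shows "convex_on {0..} (\<lambda>x. x powr p)"
proof (rule convex_onI)
  fix t x y :: real
  assume t: "0 < t" "t < 1" and xy: "x \<in> {0..}" "y \<in> {0..}"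
  have le: "s powr p \<le> s" if "0 < s" "s < 1" for s :: real
    using powr_mono'[of 1 p s] p that by simp
  consider "x = 0" | "y = 0" | "0 < x" "0 < y" using xy by fastforce
  then show "((1 - t) *\<^sub>R x + t *\<^sub>R y) powr p \<le> (1 - t) * x powr p + t * y powr p"
  proof cases
    case 1
    then show ?thesis using le[of t] t xy by (simp add: powr_mult mult_right_mono)
  next
    case 2
    then show ?thesis using le[of "1 - t"] t xy by (simp add: powr_mult mult_right_mono)
  next
    case 3
    then show ?thesis using convex_onD[OF powr_convex[OF p], of t x y] t by simp
  qed
qed (simp add: convex_real_interval)

section \<open>Gluing two couplings along a partition\<close>

text \<open>Convexity of \<open>x powr p\<close> at the convex combination
  \<open>(a + b + c) / S = A/S * (a/A) + B/S * (b/B) + C/S * (c/C)\<close>. If \<open>A\<close>, \<open>B\<close>, \<open>C\<close> are the \<open>L\<^sup>p\<close>-norms of functions \<open>a\<close>, \<open>b\<close>, \<open>c\<close>,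
  integrating this inequality gives Minkowski's. In the pointwise form the three terms
  can be estimated separately after integration.\<close>
lemma powr_sum3_weighted:
  fixes a b c A B C p :: real
  assumes p: "1 \<le> p" and nn: "0 \<le> a" "0 \<le> b" "0 \<le> c" and pos: "0 < A" "0 < B" "0 < C"
  defines "S \<equiv> A + B + C"
  shows "(a + b + c) powr p
    \<le> S powr (p - 1) * (A powr (1 - p) * a powr p + B powr (1 - p) * b powr p + C powr (1 - p) * c powr p)"
proof -
  have S: "0 < S" using pos by (simp add: S_def)
  define w where "w i = (if i = 0 then A / S else if i = 1 then B / S else C / S)" for i :: nat
  define y where "y i = (if i = 0 then a / A else if i = 1 then b / B else c / C)" for i :: nat
  have "(a + b + c) / S = (\<Sum>i\<in>{0,1,2}. w i *\<^sub>R y i)"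
    using pos by (simp add: w_def y_def add_divide_distrib)
  then have "((a + b + c) / S) powr p = (\<Sum>i\<in>{0,1,2}. w i *\<^sub>R y i) powr p" by (rule arg_cong)
  also have "\<dots> \<le> (\<Sum>i\<in>{0,1,2}. w i * y i powr p)"
    using convex_on_sum[OF _ _ convex_on_powr_nonneg[OF p], of "{0,1,2}" w y] S pos nn
    by (auto simp: w_def y_def S_def add_divide_distrib[symmetric] add.assoc)
  also have "\<dots> = A / S * (a / A) powr p + B / S * (b / B) powr p + C / S * (c / C) powr p"
    by (simp add: w_def y_def)
  also have "\<dots> = (1 / S) * (A powr (1 - p) * a powr p + B powr (1 - p) * b powr p + C powr (1 - p) * c powr p)"
  proof -
    have scaled: "X / S * (x / X) powr p = (1 / S) * (X powr (1 - p) * x powr p)" if "0 < X" "0 \<le> x" for X x :: real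
      using that by (simp add: powr_divide powr_diff field_simps)
    show ?thesis
      unfolding scaled[OF pos(1) nn(1)] scaled[OF pos(2) nn(2)] scaled[OF pos(3) nn(3)] by (simp only: distrib_left)
  qed
  finally have "((a + b + c) / S) powr p \<le> (1 / S) * (A powr (1 - p) * a powr p + B powr (1 - p) * b powr p + C powr (1 - p) * c powr p)" .
  then have "S powr p * ((a + b + c) / S) powr p \<le> S powr p * ((1 / S) * (A powr (1 - p) * a powr p + B powr (1 - p) * b powr p + C powr (1 - p) * c powr p))"
    by (rule mult_left_mono) simp
  moreover have "S powr p * ((a + b + c) / S) powr p = (a + b + c) powr p"
    using S nn by (simp add: powr_divide)
  moreover have "S powr p * (1 / S) = S powr (p - 1)" using S by (simp add: powr_diff)
  ultimately show ?thesis by (simp only: mult.assoc[symmetric])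
qed

lemma mult_divide_cancel_dominated:
  fixes x m :: ennreal
  assumes "x \<le> m" "m \<noteq> \<infinity>" shows "x * m / m = x" "m * x / m = x"
  using assms by (cases "m = 0"; simp add: ennreal_mult_divide_eq mult_divide_eq_ennreal mult.commute[of m x])+

lemma mult_divide_le:
  fixes x m :: ennreal
  assumes "m \<noteq> \<infinity>" shows "x * m / m \<le> x"
  using assms by (cases "m = 0") (simp_all add: mult_divide_eq_ennreal)

text \<open>Inside each cell of a partition of the middle space the two couplings are made conditionally
  independent, so that a rectangle \<open>A \<times> C\<close> gets the sum over the cells \<open>E\<close> of
  \<open>q1 (A \<times> E) * q2 (E \<times> C) / m E\<close>. Cells of mass zero cause no trouble: there the numerator vanishes
  and \<open>0 / 0 = 0\<close>.\<close>
definition glue :: "'i set \<Rightarrow> ('i \<Rightarrow> 'a set) \<Rightarrow> ('a::topological_space) measure \<Rightarrow> ('a \<times> 'a) measure \<Rightarrow> ('a \<times> 'a) measure \<Rightarrow> ('a \<times> 'a) measure" where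
  "glue I cell m q1 q2 = distr
     (density (q1 \<Otimes>\<^sub>M q2) (\<lambda>w. \<integral>\<^sup>+i. indicator (cell i) (snd (fst w)) * indicator (cell i) (fst (snd w)) / emeasure m (cell i) \<partial>count_space I))
     borel (\<lambda>w. (fst (fst w), snd (snd w)))"

text \<open>The deterministic part of the construction, for one fixed \<open>\<omega>\<close>.\<close>
locale gluing =
  fixes I :: "'i set" and cell :: "'i \<Rightarrow> 'a::second_countable_topology set"
    and l m r :: "'a measure" and q1 q2 :: "('a \<times> 'a) measure"
  assumes I: "countable I" and cell: "\<And>i. i \<in> I \<Longrightarrow> cell i \<in> sets borel"
    and disj: "disjoint_family_on cell I" and cover: "(\<Union>i\<in>I. cell i) = UNIV"
    and c1: "coupling l m q1" and c2: "coupling m r q2"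
    and sf: "sigma_finite_measure q2" and fin: "\<And>i. i \<in> I \<Longrightarrow> emeasure m (cell i) \<noteq> \<infinity>"
begin

lemma sets_q [measurable_cong]: "sets q1 = sets (borel \<Otimes>\<^sub>M borel)" "sets q2 = sets (borel \<Otimes>\<^sub>M borel)"
  unfolding borel_prod using couplingD(1)[OF c1] couplingD(1)[OF c2] by simp_all

lemma sets_q_borel: "sets q1 = sets borel" "sets q2 = sets borel"
  using couplingD(1)[OF c1] couplingD(1)[OF c2] by simp_all

lemma nn_integral_glue:
  assumes f: "f \<in> borel_measurable borel"
  shows "(\<integral>\<^sup>+z. f z \<partial>glue I cell m q1 q2) =
    (\<integral>\<^sup>+i. (\<integral>\<^sup>+u. (\<integral>\<^sup>+v. indicator (cell i) (snd u) * indicator (cell i) (fst v) * f (fst u, snd v) \<partial>q2) \<partial>q1) / emeasure m (cell i) \<partial>count_space I)"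
proof -
  interpret sigma_finite_measure q2 by (rule sf)
  note [measurable] = I
  have f' [measurable]: "f \<in> borel_measurable (borel \<Otimes>\<^sub>M borel)" using f by (simp add: borel_prod)
  have cell' [measurable]: "i \<in> I \<Longrightarrow> cell i \<in> sets borel" for i by (rule cell)
  let ?w = "\<lambda>i w. indicator (cell i) (snd (fst w)) * indicator (cell i) (fst (snd w)) / emeasure m (cell i) :: ennreal"
  have w [measurable]: "?w i \<in> borel_measurable (q1 \<Otimes>\<^sub>M q2)" if "i \<in> I" for i using that by measurable
  have W: "(\<lambda>w. \<integral>\<^sup>+i. ?w i w \<partial>count_space I) \<in> borel_measurable (q1 \<Otimes>\<^sub>M q2)"
    by (rule borel_measurable_nn_integral_count_space[OF I w])
  have pr: "(\<lambda>w. (fst (fst w), snd (snd w))) \<in> q1 \<Otimes>\<^sub>M q2 \<rightarrow>\<^sub>M borel"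
    unfolding borel_prod[symmetric] by measurable
  have "(\<integral>\<^sup>+z. f z \<partial>glue I cell m q1 q2) =
      (\<integral>\<^sup>+w. (\<integral>\<^sup>+i. ?w i w \<partial>count_space I) * f (fst (fst w), snd (snd w)) \<partial>(q1 \<Otimes>\<^sub>M q2))"
    unfolding glue_def using f W pr measurable_compose[OF pr f]
    by (simp add: nn_integral_distr nn_integral_density)
  also have "\<dots> = (\<integral>\<^sup>+w. (\<integral>\<^sup>+i. ?w i w * f (fst (fst w), snd (snd w)) \<partial>count_space I) \<partial>(q1 \<Otimes>\<^sub>M q2))"
    by (simp add: nn_integral_multc)
  also have "\<dots> = (\<integral>\<^sup>+i. (\<integral>\<^sup>+w. ?w i w * f (fst (fst w), snd (snd w)) \<partial>(q1 \<Otimes>\<^sub>M q2)) \<partial>count_space I)"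
    using measurable_compose[OF pr f] w
    by (intro nn_integral_count_space_nn_integral[OF I] borel_measurable_times_ennreal) auto
  also have "\<dots> = (\<integral>\<^sup>+i. (\<integral>\<^sup>+u. (\<integral>\<^sup>+v. indicator (cell i) (snd u) * indicator (cell i) (fst v) * f (fst u, snd v) \<partial>q2) \<partial>q1) / emeasure m (cell i) \<partial>count_space I)"
  proof (rule nn_integral_cong)
    fix i assume "i \<in> space (count_space I)"
    then have i [measurable]: "cell i \<in> sets borel" by (simp add: cell)
    have h: "(\<lambda>w. indicator (cell i) (snd (fst w)) * indicator (cell i) (fst (snd w)) * f (fst (fst w), snd (snd w)))
        \<in> borel_measurable (q1 \<Otimes>\<^sub>M q2)"
      using measurable_compose[OF pr f] by measurable
    have "(\<integral>\<^sup>+w. ?w i w * f (fst (fst w), snd (snd w)) \<partial>(q1 \<Otimes>\<^sub>M q2)) =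
        (\<integral>\<^sup>+w. (indicator (cell i) (snd (fst w)) * indicator (cell i) (fst (snd w)) * f (fst (fst w), snd (snd w))) / emeasure m (cell i) \<partial>(q1 \<Otimes>\<^sub>M q2))"
      by (simp add: divide_ennreal_def ac_simps)
    also have "\<dots> = (\<integral>\<^sup>+w. indicator (cell i) (snd (fst w)) * indicator (cell i) (fst (snd w)) * f (fst (fst w), snd (snd w)) \<partial>(q1 \<Otimes>\<^sub>M q2)) / emeasure m (cell i)"
      by (rule nn_integral_divide[OF h])
    also have "(\<integral>\<^sup>+w. indicator (cell i) (snd (fst w)) * indicator (cell i) (fst (snd w)) * f (fst (fst w), snd (snd w)) \<partial>(q1 \<Otimes>\<^sub>M q2))
        = (\<integral>\<^sup>+u. (\<integral>\<^sup>+v. indicator (cell i) (snd u) * indicator (cell i) (fst v) * f (fst u, snd v) \<partial>q2) \<partial>q1)"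
      using nn_integral_fst[OF h] by simp
    finally show "(\<integral>\<^sup>+w. ?w i w * f (fst (fst w), snd (snd w)) \<partial>(q1 \<Otimes>\<^sub>M q2)) = (\<integral>\<^sup>+u. (\<integral>\<^sup>+v. indicator (cell i) (snd u) * indicator (cell i) (fst v) * f (fst u, snd v) \<partial>q2) \<partial>q1) / emeasure m (cell i)" .
  qed
  finally show ?thesis .
qed

lemma nn_integral_prod:
  assumes [measurable]: "\<phi> \<in> borel_measurable borel" "\<psi> \<in> borel_measurable borel"
  shows "(\<integral>\<^sup>+u. (\<integral>\<^sup>+v. \<phi> u * \<psi> v \<partial>q2) \<partial>q1) = (\<integral>\<^sup>+u. \<phi> u \<partial>q1) * (\<integral>\<^sup>+v. \<psi> v \<partial>q2)"
  using assms sets_q_borel by (simp add: nn_integral_cmult nn_integral_multc cong: measurable_cong_sets)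

lemma emeasure_glue_rectangle:
  assumes A: "A \<in> sets borel" and C: "C \<in> sets borel"
  shows "emeasure (glue I cell m q1 q2) (A \<times> C) =
    (\<integral>\<^sup>+i. emeasure q1 (A \<times> cell i) * emeasure q2 (cell i \<times> C) / emeasure m (cell i) \<partial>count_space I)"
proof -
  let ?L = "\<lambda>i. \<integral>\<^sup>+u. (\<integral>\<^sup>+v. indicator (cell i) (snd u) * indicator (cell i) (fst v) * indicator (A \<times> C) (fst u, snd v) \<partial>q2) \<partial>q1"
  have "emeasure (glue I cell m q1 q2) (A \<times> C) = (\<integral>\<^sup>+z. indicator (A \<times> C) z \<partial>glue I cell m q1 q2)"
    using borel_Times[OF A C] by (subst nn_integral_indicator) (auto simp: glue_def)
  also have "\<dots> = (\<integral>\<^sup>+i. ?L i / emeasure m (cell i) \<partial>count_space I)"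
    by (rule nn_integral_glue) (use borel_Times[OF A C] in simp)
  also have "\<dots> = (\<integral>\<^sup>+i. emeasure q1 (A \<times> cell i) * emeasure q2 (cell i \<times> C) / emeasure m (cell i) \<partial>count_space I)"
  proof (rule nn_integral_cong)
    fix i assume "i \<in> space (count_space I)"
    then have i: "cell i \<in> sets borel" by (simp add: cell)
    have "?L i
       = (\<integral>\<^sup>+u. (\<integral>\<^sup>+v. indicator (A \<times> cell i) u * indicator (cell i \<times> C) v \<partial>q2) \<partial>q1)"
      by (intro nn_integral_cong) (auto split: split_indicator)
    also have "\<dots> = emeasure q1 (A \<times> cell i) * emeasure q2 (cell i \<times> C)"
      using borel_Times[OF A i] borel_Times[OF i C] sets_q_borel by (subst nn_integral_prod) auto
    finally show "?L i / emeasure m (cell i)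
      = emeasure q1 (A \<times> cell i) * emeasure q2 (cell i \<times> C) / emeasure m (cell i)" by simp
  qed
  finally show ?thesis .
qed

lemma cell_le:
  assumes "A \<in> sets borel" "i \<in> I"
  shows "emeasure q1 (A \<times> cell i) \<le> emeasure m (cell i)" "emeasure q2 (cell i \<times> A) \<le> emeasure m (cell i)"
proof -
  have "emeasure q1 (A \<times> cell i) \<le> emeasure q1 (UNIV \<times> cell i)" "emeasure q2 (cell i \<times> A) \<le> emeasure q2 (cell i \<times> UNIV)"
    using cell[OF assms(2)] sets_q_borel by (auto intro!: emeasure_mono borel_Times)
  then show "emeasure q1 (A \<times> cell i) \<le> emeasure m (cell i)" "emeasure q2 (cell i \<times> A) \<le> emeasure m (cell i)"
    using couplingD(3)[OF c1 cell[OF assms(2)]] couplingD(2)[OF c2 cell[OF assms(2)]] by simp_all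
qed

lemma nn_integral_cells_snd:
  assumes "f \<in> borel_measurable borel"
  shows "(\<integral>\<^sup>+i. (\<integral>\<^sup>+u. f u * indicator (cell i) (snd u) \<partial>q1) \<partial>count_space I) = (\<integral>\<^sup>+u. f u \<partial>q1)"
  using assms sets_q_borel
  by (intro nn_integral_partition[where N = borel, symmetric] I cell disj)
    (auto simp: cover cong: measurable_cong_sets simp flip: borel_prod)

lemma nn_integral_cells_fst:
  assumes "f \<in> borel_measurable borel"
  shows "(\<integral>\<^sup>+i. (\<integral>\<^sup>+v. f v * indicator (cell i) (fst v) \<partial>q2) \<partial>count_space I) = (\<integral>\<^sup>+v. f v \<partial>q2)"
  using assms sets_q_borel
  by (intro nn_integral_partition[where N = borel, symmetric] I cell disj)
    (auto simp: cover cong: measurable_cong_sets simp flip: borel_prod)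

lemma emeasure_cells_snd:
  assumes A: "A \<in> sets borel"
  shows "(\<integral>\<^sup>+i. emeasure q1 (A \<times> cell i) \<partial>count_space I) = emeasure l A"
proof -
  have "disjoint_family_on (\<lambda>i. A \<times> cell i) I" using disj unfolding disjoint_family_on_def by blast
  then have "(\<integral>\<^sup>+i. emeasure q1 (A \<times> cell i) \<partial>count_space I) = emeasure q1 (\<Union>i\<in>I. A \<times> cell i)"
    using A cell sets_q_borel by (intro emeasure_UN_countable[symmetric] I) (auto intro: borel_Times)
  also have "(\<Union>i\<in>I. A \<times> cell i) = A \<times> UNIV" using cover by blast
  finally show ?thesis using couplingD(2)[OF c1 A] by simp
qed

lemma emeasure_cells_fst:
  assumes A: "A \<in> sets borel"
  shows "(\<integral>\<^sup>+i. emeasure q2 (cell i \<times> A) \<partial>count_space I) = emeasure r A"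
proof -
  have "disjoint_family_on (\<lambda>i. cell i \<times> A) I" using disj unfolding disjoint_family_on_def by blast
  then have "(\<integral>\<^sup>+i. emeasure q2 (cell i \<times> A) \<partial>count_space I) = emeasure q2 (\<Union>i\<in>I. cell i \<times> A)"
    using A cell sets_q_borel by (intro emeasure_UN_countable[symmetric] I) (auto intro: borel_Times)
  also have "(\<Union>i\<in>I. cell i \<times> A) = UNIV \<times> A" using cover by blast
  finally show ?thesis using couplingD(3)[OF c2 A] by simp
qed

text \<open>In the formula for rectangles with \<open>C = UNIV\<close> the factor \<open>q2 (cell i \<times> UNIV)\<close> equals \<open>m (cell i)\<close> and
  cancels; what remains is the sum of \<open>q1 (A \<times> cell i)\<close>. Thus the coupling is exact although the gluing
  is only done cell by cell.\<close>
lemma coupling_glue: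
  assumes "sets l = sets borel" "sets r = sets borel"
  shows "coupling l r (glue I cell m q1 q2)"
proof (rule couplingI)
  fix A :: "'a set" assume A: "A \<in> sets borel"
  have "emeasure (glue I cell m q1 q2) (A \<times> UNIV) = (\<integral>\<^sup>+i. emeasure q1 (A \<times> cell i) \<partial>count_space I)"
    using A couplingD(2)[OF c2 cell] cell_le[OF A] fin
    by (subst emeasure_glue_rectangle) (auto simp: mult_divide_cancel_dominated intro!: nn_integral_cong)
  then show "emeasure (glue I cell m q1 q2) (A \<times> UNIV) = emeasure l A" using emeasure_cells_snd[OF A] by simp
  have "emeasure (glue I cell m q1 q2) (UNIV \<times> A) = (\<integral>\<^sup>+i. emeasure q2 (cell i \<times> A) \<partial>count_space I)"
    using A couplingD(3)[OF c1 cell] cell_le[OF A] fin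
    by (subst emeasure_glue_rectangle) (auto simp: mult_divide_cancel_dominated intro!: nn_integral_cong)
  then show "emeasure (glue I cell m q1 q2) (UNIV \<times> A) = emeasure r A" using emeasure_cells_fst[OF A] by simp
qed (use assms in \<open>auto simp: glue_def\<close>)

text \<open>A path from \<open>x\<close> to \<open>z\<close> runs from \<open>x\<close> to \<open>y\<close>, jumps inside a cell from \<open>y\<close> to \<open>y'\<close>, and runs on to \<open>z\<close>.
  The bound \<open>\<beta>\<close> pays for the jump. The term of \<open>F2\<close> and the term of \<open>\<beta>\<close> integrate to quantities of \<open>q2\<close>
  and \<open>r\<close>; the term of \<open>F1\<close> stays a sum over cells, since the restriction to \<open>B\<close> concerns \<open>z\<close> and not \<open>y\<close>.\<close>
lemma glue_cost_le:
  assumes F [measurable]: "f \<in> borel_measurable borel" "F1 \<in> borel_measurable borel" "F2 \<in> borel_measurable borel"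
    and B: "B \<in> sets borel"
    and le: "\<And>i x y y' z. i \<in> I \<Longrightarrow> y \<in> cell i \<Longrightarrow> y' \<in> cell i \<Longrightarrow> f (x, z) \<le> F1 (x, y) + \<beta> + F2 (y', z)"
  shows "(\<integral>\<^sup>+z\<in>UNIV \<times> B. f z \<partial>glue I cell m q1 q2) \<le>
    (\<integral>\<^sup>+i. (\<integral>\<^sup>+u\<in>UNIV \<times> cell i. F1 u \<partial>q1) * emeasure q2 (cell i \<times> B) / emeasure m (cell i) \<partial>count_space I)
    + \<beta> * emeasure r B + (\<integral>\<^sup>+v\<in>UNIV \<times> B. F2 v \<partial>q2)"
proof -
  have UB: "(UNIV :: 'a set) \<times> B \<in> sets borel" using B by (intro borel_Times) simp_all
  let ?L = "\<lambda>i. \<integral>\<^sup>+u. (\<integral>\<^sup>+v. indicator (cell i) (snd u) * indicator (cell i) (fst v) * (f (fst u, snd v) * indicator (UNIV \<times> B) (fst u, snd v)) \<partial>q2) \<partial>q1"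
  let ?X = "\<lambda>i. \<integral>\<^sup>+u\<in>UNIV \<times> cell i. F1 u \<partial>q1"
  let ?Z = "\<lambda>i. \<integral>\<^sup>+v\<in>cell i \<times> B. F2 v \<partial>q2"
  have "(\<integral>\<^sup>+z\<in>UNIV \<times> B. f z \<partial>glue I cell m q1 q2) =
    (\<integral>\<^sup>+i. ?L i / emeasure m (cell i) \<partial>count_space I)"
    using UB by (intro nn_integral_glue) auto
  also have "\<dots> \<le> (\<integral>\<^sup>+i. ?X i * emeasure q2 (cell i \<times> B) / emeasure m (cell i) + \<beta> * emeasure q2 (cell i \<times> B) + ?Z i \<partial>count_space I)"
  proof (rule nn_integral_mono)
    fix i assume "i \<in> space (count_space I)"
    then have iI: "i \<in> I" by simp
    note i [measurable] = cell[OF iI]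
    have S: "(UNIV :: 'a set) \<times> cell i \<in> sets borel" "cell i \<times> B \<in> sets borel" using i B by (auto intro!: borel_Times)
    note [measurable] = S
    have m1: "(\<lambda>u. f u * indicator S u) \<in> borel_measurable borel" if "f \<in> borel_measurable borel" "S \<in> sets borel" for f :: "'a \<times> 'a \<Rightarrow> ennreal" and S
      using that by measurable
    have mq2: "g \<in> borel_measurable q2" if "g \<in> borel_measurable borel" for g :: "'a \<times> 'a \<Rightarrow> ennreal"
      using that sets_q_borel by (simp cong: measurable_cong_sets)
    have mq1: "g \<in> borel_measurable q1" if "g \<in> borel_measurable borel" for g :: "'a \<times> 'a \<Rightarrow> ennreal"
      using that sets_q_borel by (simp cong: measurable_cong_sets)
    let ?\<phi> = "\<lambda>u. F1 u * indicator (UNIV \<times> cell i) u" and ?\<psi> = "\<lambda>v. F2 v * indicator (cell i \<times> B) v"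
    let ?a = "indicator (UNIV \<times> cell i) :: 'a \<times> 'a \<Rightarrow> ennreal" and ?b = "indicator (cell i \<times> B) :: 'a \<times> 'a \<Rightarrow> ennreal"
    have ab: "?a \<in> borel_measurable borel" "?b \<in> borel_measurable borel" using S by auto
    have "?L i
      \<le> (\<integral>\<^sup>+u. (\<integral>\<^sup>+v. ?\<phi> u * ?b v + \<beta> * (?a u * ?b v) + ?a u * ?\<psi> v \<partial>q2) \<partial>q1)"
    proof (intro nn_integral_mono)
      fix u v :: "'a \<times> 'a"
      show "indicator (cell i) (snd u) * indicator (cell i) (fst v) * (f (fst u, snd v) * indicator (UNIV \<times> B) (fst u, snd v))
        \<le> ?\<phi> u * ?b v + \<beta> * (?a u * ?b v) + ?a u * ?\<psi> v"
        using le[OF iI, of "snd u" "fst v" "fst u" "snd v"] by (cases u; cases v) (auto split: split_indicator)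
    qed
    also have "\<dots> = (\<integral>\<^sup>+u. (\<integral>\<^sup>+v. ?\<phi> u * ?b v \<partial>q2) + \<beta> * (\<integral>\<^sup>+v. ?a u * ?b v \<partial>q2) + (\<integral>\<^sup>+v. ?a u * ?\<psi> v \<partial>q2) \<partial>q1)"
      using mq2[OF m1[OF F(3) S(2)]] mq2[OF ab(2)]
      by (simp add: nn_integral_add nn_integral_cmult)
    also have "\<dots> = (\<integral>\<^sup>+u. (\<integral>\<^sup>+v. ?\<phi> u * ?b v \<partial>q2) \<partial>q1) + \<beta> * (\<integral>\<^sup>+u. (\<integral>\<^sup>+v. ?a u * ?b v \<partial>q2) \<partial>q1) + (\<integral>\<^sup>+u. (\<integral>\<^sup>+v. ?a u * ?\<psi> v \<partial>q2) \<partial>q1)"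
      using mq1[OF m1[OF F(2) S(1)]] mq1[OF ab(1)] mq2[OF m1[OF F(3) S(2)]] mq2[OF ab(2)]
      by (simp add: nn_integral_add nn_integral_cmult)
    also have "\<dots> = ?X i * emeasure q2 (cell i \<times> B) + \<beta> * (emeasure m (cell i) * emeasure q2 (cell i \<times> B)) + emeasure m (cell i) * ?Z i"
      using nn_integral_prod[OF m1[OF F(2) S(1)] ab(2)] nn_integral_prod[OF ab] nn_integral_prod[OF ab(1) m1[OF F(3) S(2)]]
        couplingD(3)[OF c1 i] S sets_q_borel by simp
    finally have "?L i / emeasure m (cell i)
      \<le> (?X i * emeasure q2 (cell i \<times> B) + \<beta> * (emeasure m (cell i) * emeasure q2 (cell i \<times> B)) + emeasure m (cell i) * ?Z i) / emeasure m (cell i)"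
      by (rule divide_right_mono_ennreal)
    also have "\<dots> = ?X i * emeasure q2 (cell i \<times> B) / emeasure m (cell i) + \<beta> * emeasure q2 (cell i \<times> B) * emeasure m (cell i) / emeasure m (cell i) + ?Z i * emeasure m (cell i) / emeasure m (cell i)"
      by (simp add: divide_ennreal_def distrib_right distrib_left ac_simps)
    also have "\<dots> \<le> ?X i * emeasure q2 (cell i \<times> B) / emeasure m (cell i) + \<beta> * emeasure q2 (cell i \<times> B) + ?Z i"
      by (intro add_mono order_refl mult_divide_le fin[OF iI])
    finally show "?L i / emeasure m (cell i)
      \<le> ?X i * emeasure q2 (cell i \<times> B) / emeasure m (cell i) + \<beta> * emeasure q2 (cell i \<times> B) + ?Z i" .
  qed
  also have "\<dots> = (\<integral>\<^sup>+i. ?X i * emeasure q2 (cell i \<times> B) / emeasure m (cell i) \<partial>count_space I)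
    + \<beta> * (\<integral>\<^sup>+i. emeasure q2 (cell i \<times> B) \<partial>count_space I) + (\<integral>\<^sup>+i. ?Z i \<partial>count_space I)"
    by (simp add: nn_integral_add nn_integral_cmult)
  also have "(\<integral>\<^sup>+i. ?Z i \<partial>count_space I) = (\<integral>\<^sup>+i. (\<integral>\<^sup>+v. (F2 v * indicator (UNIV \<times> B) v) * indicator (cell i) (fst v) \<partial>q2) \<partial>count_space I)"
    by (intro nn_integral_cong) (auto split: split_indicator)
  also have "\<dots> = (\<integral>\<^sup>+v\<in>UNIV \<times> B. F2 v \<partial>q2)"
    using UB by (intro nn_integral_cells_fst borel_measurable_times_ennreal F borel_measurable_indicator)
  finally show ?thesis using emeasure_cells_fst[OF B] by simp
qed

end

section \<open>Equivariant gluing\<close>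

lemma small_diameter_partition:
  fixes B :: "'a::{metric_space, second_countable_topology} set"
  assumes B: "B \<in> sets borel" and \<delta>: "0 < \<delta>"
  obtains E :: "nat \<Rightarrow> 'a set" where "\<And>j. E j \<in> sets borel" "disjoint_family E" "(\<Union>j. E j) = B"
    "\<And>j x y. x \<in> E j \<Longrightarrow> y \<in> E j \<Longrightarrow> dist x y \<le> \<delta>"
proof -
  obtain D :: "'a set" where D: "countable D" "\<forall>U::'a set. open U \<longrightarrow> U \<noteq> {} \<longrightarrow> (\<exists>d\<in>D. d \<in> U)"
    using countable_dense_exists[where 'a = 'a] by (elim exE conjE) (rule that)
  define b where "b j = ball (from_nat_into D j) (\<delta> / 2)" for j
  define E where "E j = B \<inter> disjointed b j" for j
  have cover: "(\<Union>j. b j) = UNIV"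
  proof -
    have "x \<in> (\<Union>j. b j)" for x
    proof -
      obtain d where d: "d \<in> D" "d \<in> ball x (\<delta> / 2)" using D(2)[rule_format, of "ball x (\<delta> / 2)"] \<delta> by auto
      obtain j where "from_nat_into D j = d" using from_nat_into_surj[OF D(1) d(1)] by blast
      then show ?thesis using d(2) by (auto simp: b_def dist_commute intro!: exI[of _ j])
    qed
    then show ?thesis by blast
  qed
  show ?thesis
  proof (rule that[of E])
    have "disjointed b j \<in> sets borel" for j
      by (simp add: disjointed_def b_def sets.Diff sets.countable_UN')
    then show "E j \<in> sets borel" for j unfolding E_def using B by blast
    show "disjoint_family E" unfolding E_def using disjoint_family_disjointed[of b] by (auto simp: disjoint_family_on_def)
    show "(\<Union>j. E j) = B" unfolding E_def using UN_disjointed_eq[of b] cover by auto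
    fix j x y assume "x \<in> E j" "y \<in> E j"
    then have "x \<in> b j" "y \<in> b j" unfolding E_def using disjointed_subset[of b j] by auto
    then show "dist x y \<le> \<delta>" unfolding b_def using dist_triangle3[of x y "from_nat_into D j"] by auto
  qed
qed

text \<open>The cells of the gluing are the translates of a partition of \<open>B0\<close> into pieces of diameter at
  most \<open>\<delta>\<close>. Translation by \<open>G\<close> permutes them and preserves their diameters.\<close>
locale equivariant_gluing = equivariant_flow G B0 P \<theta>
  for G :: "('a::polish_space \<Rightarrow> 'a) set" and B0 :: "'a set" and P :: "'w measure" and \<theta> :: "('a \<Rightarrow> 'a) \<Rightarrow> 'w \<Rightarrow> 'w" +
  fixes \<Lambda> \<xi> M :: "'w \<Rightarrow> 'a measure" and q1 q2 :: "'w \<Rightarrow> ('a \<times> 'a) measure"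
    and E :: "nat \<Rightarrow> 'a set" and \<delta> :: real
  assumes \<Lambda>: "random_measure P \<Lambda>" "equivariant G \<theta> \<Lambda>" "intensity P B0 \<Lambda> = 1"
    and \<xi>: "random_measure P \<xi>" "equivariant G \<theta> \<xi>" "intensity P B0 \<xi> = 1"
    and M: "random_measure P M" "equivariant G \<theta> M" "intensity P B0 M = 1"
    and q1: "q1 \<in> equivariant_semicouplings P G \<theta> \<Lambda> \<xi>"
    and q2: "q2 \<in> equivariant_semicouplings P G \<theta> \<xi> M"
    and E_borel: "\<And>j. E j \<in> sets borel" and E_disj: "disjoint_family E" and E_UN: "(\<Union>j. E j) = B0"
    and E_dist: "\<And>j x y. x \<in> E j \<Longrightarrow> y \<in> E j \<Longrightarrow> dist x y \<le> \<delta>" and \<delta>: "0 < \<delta>"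
begin

definition cells :: "(('a \<Rightarrow> 'a) \<times> nat) set" where "cells = G \<times> UNIV"

definition cell :: "('a \<Rightarrow> 'a) \<times> nat \<Rightarrow> 'a set" where "cell i = fst i ` E (snd i)"

lemma countable_cells: "countable cells"
  unfolding cells_def using countable_group by (intro countable_SIGMA) auto

lemma cell_borel: "i \<in> cells \<Longrightarrow> cell i \<in> sets borel"
  by (auto simp: cells_def cell_def intro: group_image_borel E_borel)

lemma cell_subset: "cell i \<subseteq> fst i ` B0"
  using E_UN by (auto simp: cell_def)

lemma cells_disj: "disjoint_family_on cell cells"
  unfolding disjoint_family_on_def
proof (intro ballI impI)
  fix i k assume ik: "i \<in> cells" "k \<in> cells" "i \<noteq> k"
  show "cell i \<inter> cell k = {}"
  proof (cases "fst i = fst k")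
    case False
    then have "fst i ` B0 \<inter> fst k ` B0 = {}"
      using ik by (intro disjoint_family_onD[OF cells_disjoint]) (auto simp: cells_def)
    then show ?thesis using cell_subset[of i] cell_subset[of k] by blast
  next
    case True
    then have "E (snd i) \<inter> E (snd k) = {}"
      using E_disj ik(3) by (auto simp: disjoint_family_on_def prod_eq_iff)
    moreover have "inj (fst i)" using group_bij[of "fst i"] ik(1) by (auto simp: cells_def bij_def)
    ultimately show ?thesis unfolding cell_def True[symmetric] by (simp flip: image_Int)
  qed
qed

lemma cells_UN: "(\<Union>i\<in>cells. cell i) = UNIV"
proof -
  have "y \<in> (\<Union>i\<in>cells. cell i)" for y
  proof -
    obtain g x where g: "g \<in> G" "x \<in> B0" "y = g x" using cells_cover by blast
    moreover obtain j where "x \<in> E j" using g(2) E_UN by blast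
    ultimately show ?thesis by (intro UN_I[of "(g, j)"]) (auto simp: cells_def cell_def)
  qed
  then show ?thesis by blast
qed

lemma cell_Int_B0:
  assumes "i \<in> cells" shows "cell i \<inter> B0 = cell i \<or> cell i \<inter> B0 = {}"
proof (cases "fst i = id")
  case True
  then show ?thesis using cell_subset[of i] by auto
next
  case False
  then have "fst i ` B0 \<inter> id ` B0 = {}"
    using assms by (intro disjoint_family_onD[OF cells_disjoint]) (auto simp: cells_def)
  then show ?thesis using cell_subset[of i] by auto
qed

lemma cell_dist: "i \<in> cells \<Longrightarrow> x \<in> cell i \<Longrightarrow> y \<in> cell i \<Longrightarrow> dist x y \<le> \<delta>"
  using E_dist by (auto simp: cells_def cell_def)

definition shift :: "('a \<Rightarrow> 'a) \<Rightarrow> ('a \<Rightarrow> 'a) \<times> nat \<Rightarrow> ('a \<Rightarrow> 'a) \<times> nat" where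
  "shift k i = (k \<circ> fst i, snd i)"

lemma cell_shift: "cell (shift k i) = k ` cell i"
  by (simp add: cell_def shift_def image_comp)

lemma shift_bij: "k \<in> G \<Longrightarrow> bij_betw (shift k) cells cells"
  by (rule bij_betw_byWitness[where f' = "shift (inv k)"])
    (auto simp: cells_def shift_def comp_assoc[symmetric] group_inv_simps)

lemma nn_integral_shift:
  assumes "k \<in> G" shows "(\<integral>\<^sup>+i. f (shift k i) \<partial>count_space cells) = (\<integral>\<^sup>+i. f i \<partial>count_space cells)"
  by (rule nn_integral_bij_count_space[OF shift_bij[OF assms]])

lemma q_random_equivariant: "random_measure P q1" "equivariant2 G \<theta> q1" "random_measure P q2" "equivariant2 G \<theta> q2"
  using q1 q2 by (auto simp: equivariant_semicouplings_def)

text \<open>Random measures have to be Radon and equivariant for every \<open>\<omega>\<close>, while the semicouplings are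
  only couplings for almost every \<open>\<omega>\<close>. The exceptional points are therefore cut out by a condition
  that is itself invariant under the flow.\<close>
definition good :: "'w \<Rightarrow> bool" where
  "good \<omega> \<longleftrightarrow> coupling (\<Lambda> \<omega>) (\<xi> \<omega>) (q1 \<omega>) \<and> coupling (\<xi> \<omega>) (M \<omega>) (q2 \<omega>) \<and> (\<forall>g\<in>G. emeasure (\<xi> \<omega>) (g ` B0) \<noteq> \<infinity>)"

lemma AE_good: "AE \<omega> in P. good \<omega>"
  using AE_coupling[OF \<Lambda> \<xi>(1,3) q1] AE_coupling[OF \<xi> M(1,3) q2] AE_finite_cells[OF \<xi>]
  by eventually_elim (simp add: good_def)

lemma good_measurable: "Measurable.pred P good"
proof -
  have "{\<omega>\<in>space P. \<not> good \<omega>} \<in> null_sets P" using AE_good by (simp only: AE_iff_null_sets)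
  then have "space P - {\<omega>\<in>space P. \<not> good \<omega>} \<in> sets P" by blast
  also have "space P - {\<omega>\<in>space P. \<not> good \<omega>} = {\<omega>\<in>space P. good \<omega>}" by blast
  finally show ?thesis by (simp add: pred_def)
qed

lemma coupling_shift:
  assumes l: "random_measure P l" "equivariant G \<theta> l" and m: "random_measure P m" "equivariant G \<theta> m"
    and q: "random_measure P q" "equivariant2 G \<theta> q" and k: "k \<in> G" and c: "coupling (l \<omega>) (m \<omega>) (q \<omega>)"
  shows "coupling (l (\<theta> k \<omega>)) (m (\<theta> k \<omega>)) (q (\<theta> k \<omega>))"
proof (rule couplingI)
  fix A :: "'a set" assume A: "A \<in> sets borel"
  have kA: "A = k ` inv k ` A" using group_bij[OF k] by (simp add: image_comp group_inv_simps[OF k])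
  have kU: "UNIV = k ` (UNIV :: 'a set)" using group_bij[OF k] by (simp add: bij_def)
  have B: "inv k ` A \<in> sets borel" using A k by (intro group_image_borel) auto
  have "emeasure (q (\<theta> k \<omega>)) (k ` inv k ` A \<times> k ` UNIV) = emeasure (q \<omega>) (inv k ` A \<times> UNIV)"
    using q(2) k B unfolding equivariant2_def by simp
  also have "\<dots> = emeasure (l \<omega>) (inv k ` A)" by (rule couplingD(2)[OF c B])
  also have "\<dots> = emeasure (l (\<theta> k \<omega>)) (k ` inv k ` A)" using l(2) k B unfolding equivariant_def by simp
  finally show "emeasure (q (\<theta> k \<omega>)) (A \<times> UNIV) = emeasure (l (\<theta> k \<omega>)) A"
    by (simp only: kA[symmetric] kU[symmetric])
  have "emeasure (q (\<theta> k \<omega>)) (k ` UNIV \<times> k ` inv k ` A) = emeasure (q \<omega>) (UNIV \<times> inv k ` A)"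
    using q(2) k B unfolding equivariant2_def by simp
  also have "\<dots> = emeasure (m \<omega>) (inv k ` A)" by (rule couplingD(3)[OF c B])
  also have "\<dots> = emeasure (m (\<theta> k \<omega>)) (k ` inv k ` A)" using m(2) k B unfolding equivariant_def by simp
  finally show "emeasure (q (\<theta> k \<omega>)) (UNIV \<times> A) = emeasure (m (\<theta> k \<omega>)) A"
    by (simp only: kA[symmetric] kU[symmetric])
qed (use random_measure_sets l m q in blast)+

lemma good_shift_imp:
  assumes k: "k \<in> G" and g: "good \<omega>" shows "good (\<theta> k \<omega>)"
  unfolding good_def
proof (intro conjI ballI)
  show "coupling (\<Lambda> (\<theta> k \<omega>)) (\<xi> (\<theta> k \<omega>)) (q1 (\<theta> k \<omega>))" "coupling (\<xi> (\<theta> k \<omega>)) (M (\<theta> k \<omega>)) (q2 (\<theta> k \<omega>))"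
    using coupling_shift[OF \<Lambda>(1,2) \<xi>(1,2) q_random_equivariant(1,2) k] coupling_shift[OF \<xi>(1,2) M(1,2) q_random_equivariant(3,4) k] g
    by (auto simp: good_def)
  fix h assume h: "h \<in> G"
  have "k ` (inv k \<circ> h) ` B0 = h ` B0" by (simp add: image_comp comp_assoc[symmetric] group_inv_simps[OF k])
  moreover have "(inv k \<circ> h) ` B0 \<in> sets borel" using h k by (intro group_image_borel B0_borel) auto
  ultimately have "emeasure (\<xi> (\<theta> k \<omega>)) (h ` B0) = emeasure (\<xi> \<omega>) ((inv k \<circ> h) ` B0)"
    using \<xi>(2) k unfolding equivariant_def by metis
  then show "emeasure (\<xi> (\<theta> k \<omega>)) (h ` B0) \<noteq> \<infinity>" using g group_comp[OF group_inv[OF k] h] unfolding good_def by metis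
qed

lemma good_shift: "k \<in> G \<Longrightarrow> good (\<theta> k \<omega>) \<longleftrightarrow> good \<omega>"
  using good_shift_imp[of k \<omega>] good_shift_imp[of "inv k" "\<theta> k \<omega>"] by (auto simp: flow_inv)

lemma sigma_finite_radon:
  fixes \<nu> :: "('a \<times> 'a) measure"
  assumes "\<nu> \<in> radon_measures" shows "sigma_finite_measure \<nu>"
proof
  obtain V :: "nat \<Rightarrow> 'a set" where V: "\<And>n. V n \<in> sets borel" "(\<Union>n. V n \<times> V n) = UNIV"
    "\<And>\<nu> n. \<nu> \<in> radon_measures \<Longrightarrow> emeasure \<nu> (V n \<times> V n) \<noteq> \<infinity>"
    by (rule finite_squares, rule that, assumption+)
  show "\<exists>A. countable A \<and> A \<subseteq> sets \<nu> \<and> \<Union>A = space \<nu> \<and> (\<forall>a\<in>A. emeasure \<nu> a \<noteq> \<infinity>)"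
    using V radon_measuresD[OF assms] assms
    by (intro exI[of _ "range (\<lambda>n. V n \<times> V n)"]) (auto intro!: borel_Times)
qed

lemma good_gluing: "good \<omega> \<Longrightarrow> gluing cells cell (\<Lambda> \<omega>) (\<xi> \<omega>) (M \<omega>) (q1 \<omega>) (q2 \<omega>)"
proof (unfold_locales)
  assume g: "good \<omega>"
  show "coupling (\<Lambda> \<omega>) (\<xi> \<omega>) (q1 \<omega>)" "coupling (\<xi> \<omega>) (M \<omega>) (q2 \<omega>)" using g by (auto simp: good_def)
  interpret sigma_finite_measure "q2 \<omega>"
    using random_measure_radon[OF q_random_equivariant(3)] by (intro sigma_finite_radon) (simp add: space_P)
  show "\<exists>A. countable A \<and> A \<subseteq> sets (q2 \<omega>) \<and> \<Union>A = space (q2 \<omega>) \<and> (\<forall>a\<in>A. emeasure (q2 \<omega>) a \<noteq> \<infinity>)"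
    by (rule sigma_finite_countable)
  fix i assume i: "i \<in> cells"
  have "emeasure (\<xi> \<omega>) (cell i) \<le> emeasure (\<xi> \<omega>) (fst i ` B0)"
    using i cell_subset group_image_borel[OF _ B0_borel] random_measure_sets(1)[OF \<xi>(1)]
    by (intro emeasure_mono) (auto simp: cells_def)
  then show "emeasure (\<xi> \<omega>) (cell i) \<noteq> \<infinity>" using g i by (auto simp: good_def cells_def top_unique)
qed (use countable_cells cell_borel cells_disj cells_UN in auto)

definition glued :: "'w \<Rightarrow> ('a \<times> 'a) measure" where
  "glued \<omega> = (if good \<omega> then glue cells cell (\<xi> \<omega>) (q1 \<omega>) (q2 \<omega>) else null_measure borel)"

lemma coupling_glued: "good \<omega> \<Longrightarrow> coupling (\<Lambda> \<omega>) (M \<omega>) (glued \<omega>)"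
  using gluing.coupling_glue[OF good_gluing random_measure_sets(1)[OF \<Lambda>(1)] random_measure_sets(1)[OF M(1)]]
  by (simp add: glued_def)

lemma sets_glued: "sets (glued \<omega>) = sets borel"
  by (simp add: glued_def glue_def)

lemma emeasure_glued:
  assumes "A \<in> sets borel" "C \<in> sets borel"
  shows "emeasure (glued \<omega>) (A \<times> C) = (if good \<omega> then
    (\<integral>\<^sup>+i. emeasure (q1 \<omega>) (A \<times> cell i) * emeasure (q2 \<omega>) (cell i \<times> C) / emeasure (\<xi> \<omega>) (cell i) \<partial>count_space cells) else 0)"
  using gluing.emeasure_glue_rectangle[OF good_gluing assms] by (simp add: glued_def)

text \<open>A compact set has a compact first projection \<open>C\<close>, and the mass of \<open>C \<times> UNIV\<close> is \<open>\<Lambda> \<omega> C\<close>.\<close>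
lemma glued_radon: "glued \<omega> \<in> radon_measures"
  unfolding radon_measures_def
proof (intro CollectI conjI allI impI)
  fix K :: "('a \<times> 'a) set" assume K: "compact K"
  show "emeasure (glued \<omega>) K < \<infinity>"
  proof (cases "good \<omega>")
    case True
    have F: "compact (fst ` K)" by (intro compact_continuous_image K continuous_intros)
    have "emeasure (glued \<omega>) K \<le> emeasure (glued \<omega>) (fst ` K \<times> UNIV)"
      using compact_imp_closed[OF F] by (intro emeasure_mono) (auto simp: sets_glued intro!: borel_Times image_eqI)
    also have "\<dots> = emeasure (\<Lambda> \<omega>) (fst ` K)"
      using compact_imp_closed[OF F] by (intro couplingD(2)[OF coupling_glued[OF True]]) auto
    also have "\<dots> < \<infinity>" using radon_measuresD(3)[OF random_measure_radon[OF \<Lambda>(1)] F] by (simp add: space_P)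
    finally show ?thesis .
  qed (simp add: glued_def)
qed (rule sets_glued)

lemma glued_random: "random_measure P glued"
proof (rule random_measureI[OF locally_compact_prod])
  obtain V :: "nat \<Rightarrow> 'a set" where V: "\<And>n. V n \<in> sets borel" "(\<Union>n. V n \<times> V n) = UNIV"
    "\<And>\<nu> n. \<nu> \<in> radon_measures \<Longrightarrow> emeasure \<nu> (V n \<times> V n) \<noteq> \<infinity>"
    by (rule finite_squares, rule that, assumption+)
  fix C :: "('a \<times> 'a) set" assume C: "C \<in> sets borel"
  have rect: "(\<lambda>\<omega>. emeasure (glued \<omega>) R) \<in> borel_measurable P" if "R \<in> rectangles" for R
  proof -
    obtain A B where AB: "R = A \<times> B" "A \<in> sets borel" "B \<in> sets borel" using \<open>R \<in> rectangles\<close> by (auto simp: rectangles_def)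
    have "(\<lambda>\<omega>. \<integral>\<^sup>+i. emeasure (q1 \<omega>) (A \<times> cell i) * emeasure (q2 \<omega>) (cell i \<times> B) / emeasure (\<xi> \<omega>) (cell i) \<partial>count_space cells) \<in> borel_measurable P"
      using AB cell_borel
      by (intro borel_measurable_nn_integral_count_space[OF countable_cells] borel_measurable_divide_ennreal borel_measurable_times_ennreal
          emeasure_random_measurable2 q_random_equivariant emeasure_random_measurable \<xi>(1) borel_Times) auto
    then show ?thesis unfolding AB(1) emeasure_glued[OF AB(2,3)]
      using good_measurable by (intro measurable_If) (auto simp: pred_def)
  qed
  show "(\<lambda>\<omega>. emeasure (glued \<omega>) C) \<in> borel_measurable P"
  proof (rule measurable_emeasure_of_generator[where E = rectangles and V = "\<lambda>n. V n \<times> V n"])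
    show "sigma_sets UNIV rectangles = sets (borel :: ('a \<times> 'a) measure)" by (rule sigma_sets_rectangles)
    show "range (\<lambda>n. V n \<times> V n) \<subseteq> rectangles" using V(1) by (auto simp: rectangles_def)
    show "emeasure (glued \<omega>) (V n \<times> V n) \<noteq> \<infinity>" for \<omega> n by (rule V(3)[OF glued_radon])
  qed (use V(2) C rect sets_glued Int_stable_rectangles in auto)
qed (rule glued_radon)

lemma glued_equivariant: "equivariant2 G \<theta> glued"
  unfolding equivariant2_def
proof (intro ballI allI)
  fix k \<omega> and A B :: "'a set" assume k: "k \<in> G" and A: "A \<in> sets borel" and B: "B \<in> sets borel"
  have kA: "k ` A \<in> sets borel" "k ` B \<in> sets borel" using k A B group_image_borel by auto
  have "(\<integral>\<^sup>+i. emeasure (q1 (\<theta> k \<omega>)) (k ` A \<times> cell i) * emeasure (q2 (\<theta> k \<omega>)) (cell i \<times> k ` B) / emeasure (\<xi> (\<theta> k \<omega>)) (cell i) \<partial>count_space cells)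
    = (\<integral>\<^sup>+i. emeasure (q1 (\<theta> k \<omega>)) (k ` A \<times> cell (shift k i)) * emeasure (q2 (\<theta> k \<omega>)) (cell (shift k i) \<times> k ` B) / emeasure (\<xi> (\<theta> k \<omega>)) (cell (shift k i)) \<partial>count_space cells)"
    by (rule nn_integral_shift[OF k, symmetric])
  also have "\<dots> = (\<integral>\<^sup>+i. emeasure (q1 \<omega>) (A \<times> cell i) * emeasure (q2 \<omega>) (cell i \<times> B) / emeasure (\<xi> \<omega>) (cell i) \<partial>count_space cells)"
    unfolding cell_shift using q_random_equivariant(2,4) \<xi>(2) k A B cell_borel unfolding equivariant_def equivariant2_def
    by (intro nn_integral_cong) simp
  finally show "emeasure (glued (\<theta> k \<omega>)) (k ` A \<times> k ` B) = emeasure (glued \<omega>) (A \<times> B)"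
    by (simp add: emeasure_glued[OF kA] emeasure_glued[OF A B] good_shift[OF k])
qed

lemma glued_semicoupling: "glued \<in> equivariant_semicouplings P G \<theta> \<Lambda> M"
proof -
  have "AE \<omega> in P. semicoupling (\<Lambda> \<omega>) (M \<omega>) (glued \<omega>)"
    using AE_good by eventually_elim (intro coupling_imp_semicoupling coupling_glued)
  then show ?thesis using glued_random glued_equivariant by (simp add: equivariant_semicouplings_def)
qed

definition cell_cost :: "real \<Rightarrow> ('a \<Rightarrow> 'a) \<times> nat \<Rightarrow> 'w \<Rightarrow> ennreal" where
  "cell_cost p i \<omega> = (\<integral>\<^sup>+u\<in>UNIV \<times> cell i. dist_pow p u \<partial>q1 \<omega>)"

lemma cell_cost_measurable: "i \<in> cells \<Longrightarrow> cell_cost p i \<in> borel_measurable P"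
  unfolding cell_cost_def using cell_borel
  by (intro nn_integral_random_measurable2[OF q_random_equivariant(1)] borel_measurable_times_ennreal dist_powr_measurable borel_measurable_indicator borel_Times) auto

lemma cell_cost_shift:
  assumes k: "k \<in> G" and i: "i \<in> cells"
  shows "cell_cost p (shift k i) (\<theta> k \<omega>) = cell_cost p i \<omega>"
proof -
  have "cell_cost p (shift k i) (\<theta> k \<omega>) = (\<integral>\<^sup>+u\<in>k ` UNIV \<times> k ` cell i. dist_pow p u \<partial>q1 (\<theta> k \<omega>))"
    using group_bij[OF k] by (simp add: cell_cost_def cell_shift bij_def)
  also have "\<dots> = (\<integral>\<^sup>+u\<in>UNIV \<times> cell i. dist_pow p (map_prod k k u) \<partial>q1 \<omega>)"
    by (rule nn_integral_equivariant2[OF q_random_equivariant(1,2) k dist_powr_measurable _ cell_borel[OF i]]) simp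
  also have "\<dots> = cell_cost p i \<omega>"
    unfolding cell_cost_def using k by (intro nn_integral_cong) (simp add: map_prod_def split_beta)
  finally show ?thesis .
qed

text \<open>At a point \<open>v\<close> of the second coupling that starts in a cell, the cost at which the first coupling
  fills this cell, per unit of mass. Integrating it against \<open>q2\<close> yields the first term in
  the bound \<open>glue_cost_le\<close>.\<close>
definition avg_cost :: "real \<Rightarrow> 'w \<Rightarrow> 'a \<times> 'a \<Rightarrow> ennreal" where
  "avg_cost p \<omega> v = (\<integral>\<^sup>+i. cell_cost p i \<omega> / emeasure (\<xi> \<omega>) (cell i) * indicator (cell i) (fst v) \<partial>count_space cells)"

lemma fst_measurable_borel: "fst \<in> (borel :: ('a \<times> 'a) measure) \<rightarrow>\<^sub>M borel"
  by (simp flip: borel_prod)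

lemma avg_cost_measurable: "avg_cost p \<omega> \<in> borel_measurable borel"
  unfolding avg_cost_def
  by (intro borel_measurable_nn_integral_count_space[OF countable_cells] borel_measurable_times_ennreal
      measurable_compose[OF fst_measurable_borel borel_measurable_indicator[OF cell_borel]]) auto

lemma nn_integral_avg_cost:
  assumes A: "A \<in> sets borel" and B: "B \<in> sets borel"
  shows "(\<integral>\<^sup>+v\<in>A \<times> B. avg_cost p \<omega> v \<partial>q2 \<omega>) =
    (\<integral>\<^sup>+i. cell_cost p i \<omega> / emeasure (\<xi> \<omega>) (cell i) * emeasure (q2 \<omega>) ((cell i \<inter> A) \<times> B) \<partial>count_space cells)"
proof -
  have S: "(cell i \<inter> A) \<times> B \<in> sets (q2 \<omega>)" if "i \<in> cells" for i
    using A B cell_borel[OF that] random_measure_sets(1)[OF q_random_equivariant(3)] by (auto intro!: borel_Times)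
  have "(\<integral>\<^sup>+v\<in>A \<times> B. avg_cost p \<omega> v \<partial>q2 \<omega>) =
    (\<integral>\<^sup>+v. (\<integral>\<^sup>+i. cell_cost p i \<omega> / emeasure (\<xi> \<omega>) (cell i) * indicator ((cell i \<inter> A) \<times> B) v \<partial>count_space cells) \<partial>q2 \<omega>)"
  proof (rule nn_integral_cong)
    fix v :: "'a \<times> 'a"
    have "indicator ((cell i \<inter> A) \<times> B) v = (indicator (cell i) (fst v) * indicator (A \<times> B) v :: ennreal)" for i
      by (cases v) (simp add: indicator_def)
    then show "avg_cost p \<omega> v * indicator (A \<times> B) v = (\<integral>\<^sup>+i. cell_cost p i \<omega> / emeasure (\<xi> \<omega>) (cell i) * indicator ((cell i \<inter> A) \<times> B) v \<partial>count_space cells)"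
      unfolding avg_cost_def by (simp add: nn_integral_multc[symmetric] mult.assoc)
  qed
  also have "\<dots> = (\<integral>\<^sup>+i. (\<integral>\<^sup>+v. cell_cost p i \<omega> / emeasure (\<xi> \<omega>) (cell i) * indicator ((cell i \<inter> A) \<times> B) v \<partial>q2 \<omega>) \<partial>count_space cells)"
    using S by (intro nn_integral_count_space_nn_integral[OF countable_cells]) auto
  also have "\<dots> = (\<integral>\<^sup>+i. cell_cost p i \<omega> / emeasure (\<xi> \<omega>) (cell i) * emeasure (q2 \<omega>) ((cell i \<inter> A) \<times> B) \<partial>count_space cells)"
    using S by (intro nn_integral_cong) (simp add: nn_integral_cmult)
  finally show ?thesis .
qed

lemma avg_cost_set_measurable:
  assumes "A \<in> sets borel" "B \<in> sets borel"
  shows "(\<lambda>\<omega>. \<integral>\<^sup>+v\<in>A \<times> B. avg_cost p \<omega> v \<partial>q2 \<omega>) \<in> borel_measurable P"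
  unfolding nn_integral_avg_cost[OF assms] using assms cell_borel
  by (intro borel_measurable_nn_integral_count_space[OF countable_cells] borel_measurable_divide_ennreal borel_measurable_times_ennreal
          cell_cost_measurable emeasure_random_measurable2 q_random_equivariant emeasure_random_measurable \<xi>(1) borel_Times) auto

text \<open>The weight \<open>avg_cost\<close> is invariant, so the integral over targets in \<open>B0\<close> becomes one over sources in
  \<open>B0\<close>. There each cell contributes its cost per unit of mass times its mass, which sums up to the
  cost of \<open>q1\<close> with target in \<open>B0\<close>.\<close>
lemma expectation_avg_cost_le:
  "(\<integral>\<^sup>+\<omega>. (\<integral>\<^sup>+v\<in>UNIV \<times> B0. avg_cost p \<omega> v \<partial>q2 \<omega>) \<partial>P) \<le> transport_cost p q1"
proof -
  let ?S = "\<lambda>\<omega>. \<integral>\<^sup>+v\<in>B0 \<times> UNIV. avg_cost p \<omega> v \<partial>q2 \<omega>"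
  have "(\<integral>\<^sup>+\<omega>. (\<integral>\<^sup>+v\<in>UNIV \<times> B0. avg_cost p \<omega> v \<partial>q2 \<omega>) \<partial>P) = (\<integral>\<^sup>+\<omega>. ?S \<omega> \<partial>P)"
  proof (rule mass_transport_measure[OF q_random_equivariant(3,4) avg_cost_measurable _ avg_cost_set_measurable])
    fix k \<omega> and x y :: 'a assume k: "k \<in> G"
    have "avg_cost p (\<theta> k \<omega>) (k x, k y) = (\<integral>\<^sup>+i. cell_cost p (shift k i) (\<theta> k \<omega>) / emeasure (\<xi> (\<theta> k \<omega>)) (cell (shift k i)) * indicator (cell (shift k i)) (k x) \<partial>count_space cells)"
      unfolding avg_cost_def fst_conv by (rule nn_integral_shift[OF k, symmetric])
    also have "\<dots> = avg_cost p \<omega> (x, y)"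
      unfolding avg_cost_def fst_conv
    proof (rule nn_integral_cong)
      fix i assume "i \<in> space (count_space cells)"
      then have i: "i \<in> cells" by simp
      have "k x \<in> k ` cell i \<longleftrightarrow> x \<in> cell i" using group_bij[OF k] by (auto simp: bij_def inj_def)
      moreover have "emeasure (\<xi> (\<theta> k \<omega>)) (k ` cell i) = emeasure (\<xi> \<omega>) (cell i)"
        using \<xi>(2) k cell_borel[OF i] by (simp add: equivariant_def)
      ultimately show "cell_cost p (shift k i) (\<theta> k \<omega>) / emeasure (\<xi> (\<theta> k \<omega>)) (cell (shift k i)) * indicator (cell (shift k i)) (k x)
        = cell_cost p i \<omega> / emeasure (\<xi> \<omega>) (cell i) * indicator (cell i) x"
        unfolding cell_cost_shift[OF k i] cell_shift by (simp add: indicator_def)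
    qed
    finally show "avg_cost p (\<theta> k \<omega>) (k x, k y) = avg_cost p \<omega> (x, y)" .
  qed
  also have "\<dots> \<le> transport_cost p q1"
    unfolding transport_cost_def
  proof (rule nn_integral_mono_AE)
    show "AE \<omega> in P. ?S \<omega> \<le> (\<integral>\<^sup>+u\<in>UNIV \<times> B0. dist_pow p u \<partial>q1 \<omega>)"
      using AE_good
    proof eventually_elim
      fix \<omega> assume g: "good \<omega>"
      interpret gluing cells cell "\<Lambda> \<omega>" "\<xi> \<omega>" "M \<omega>" "q1 \<omega>" "q2 \<omega>" by (rule good_gluing[OF g])
      have UB: "(UNIV :: 'a set) \<times> B0 \<in> sets borel" by (intro borel_Times) auto
      have "?S \<omega> =
        (\<integral>\<^sup>+i. cell_cost p i \<omega> / emeasure (\<xi> \<omega>) (cell i) * emeasure (q2 \<omega>) ((cell i \<inter> B0) \<times> UNIV) \<partial>count_space cells)"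
        by (rule nn_integral_avg_cost) auto
      also have "\<dots> \<le> (\<integral>\<^sup>+i. (\<integral>\<^sup>+u. (dist_pow p u * indicator (UNIV \<times> B0) u) * indicator (cell i) (snd u) \<partial>q1 \<omega>) \<partial>count_space cells)"
      proof (rule nn_integral_mono)
        fix i assume "i \<in> space (count_space cells)"
        then have i: "i \<in> cells" by simp
        from cell_Int_B0[OF i]
        show "cell_cost p i \<omega> / emeasure (\<xi> \<omega>) (cell i) * emeasure (q2 \<omega>) ((cell i \<inter> B0) \<times> UNIV)
          \<le> (\<integral>\<^sup>+u. (dist_pow p u * indicator (UNIV \<times> B0) u) * indicator (cell i) (snd u) \<partial>q1 \<omega>)"
        proof
          assume e: "cell i \<inter> B0 = cell i"
          have "cell_cost p i \<omega> / emeasure (\<xi> \<omega>) (cell i) * emeasure (q2 \<omega>) (cell i \<times> UNIV) \<le> cell_cost p i \<omega>"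
            using mult_divide_le[OF fin[OF i], of "cell_cost p i \<omega>"] couplingD(2)[OF c2 cell_borel[OF i]]
            by (simp add: ennreal_times_divide mult.commute)
          also have "\<dots> = (\<integral>\<^sup>+u. (dist_pow p u * indicator (UNIV \<times> B0) u) * indicator (cell i) (snd u) \<partial>q1 \<omega>)"
          proof -
            have "cell i \<subseteq> B0" using e by blast
            then have "indicator (UNIV \<times> cell i) u = (indicator (UNIV \<times> B0) u * indicator (cell i) (snd u) :: ennreal)" for u :: "'a \<times> 'a"
              by (cases u) (auto simp: indicator_def)
            then show ?thesis unfolding cell_cost_def by (simp only: mult.assoc)
          qed
          finally show ?thesis using e by simp
        qed simp
      qed
      also have "\<dots> = (\<integral>\<^sup>+u\<in>UNIV \<times> B0. dist_pow p u \<partial>q1 \<omega>)"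
        using UB by (intro nn_integral_cells_snd borel_measurable_times_ennreal dist_powr_measurable borel_measurable_indicator)
      finally show "?S \<omega> \<le> (\<integral>\<^sup>+u\<in>UNIV \<times> B0. dist_pow p u \<partial>q1 \<omega>)" .
    qed
  qed
  finally show ?thesis .
qed

text \<open>The convexity inequality with the numbers \<open>a\<close>, \<open>\<delta>\<close>, \<open>c\<close> as weights turns the pointwise triangle
  inequality into this bound; with \<open>S = a + \<delta> + c\<close> the three terms add up to
  \<open>S powr (p - 1) * (a + \<delta> + c) = S powr p\<close>.\<close>
lemma transport_cost_glued_le:
  assumes p: "1 \<le> p" and a: "0 < a" "transport_cost p q1 \<le> ennreal (a powr p)"
    and c: "0 < c" "transport_cost p q2 \<le> ennreal (c powr p)"
  shows "transport_cost p glued \<le> ennreal ((a + \<delta> + c) powr p)"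
proof -
  define S where "S = a + \<delta> + c"
  have S: "0 < S" using a(1) c(1) \<delta> by (simp add: S_def)
  \<comment> \<open>The weight of the leg of length \<open>t\<close> in \<open>powr_sum3_weighted\<close>.\<close>
  define w where "w t = S powr (p - 1) * t powr (1 - p)" for t
  have w_nonneg: "0 \<le> w t" for t by (simp add: w_def)
  have w_mult: "w t * t powr p = S powr (p - 1) * t" if "0 < t" for t
    using that by (simp add: w_def powr_diff)
  let ?\<beta> = "ennreal (w \<delta> * \<delta> powr p)"
  let ?A = "\<lambda>\<omega>. \<integral>\<^sup>+v\<in>UNIV \<times> B0. avg_cost p \<omega> v \<partial>q2 \<omega>"
  let ?C = "\<lambda>\<omega>. \<integral>\<^sup>+v\<in>UNIV \<times> B0. dist_pow p v \<partial>q2 \<omega>"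
  let ?T = "\<lambda>\<omega>. ennreal (w a) * ?A \<omega> + ?\<beta> * emeasure (M \<omega>) B0 + ennreal (w c) * ?C \<omega>"
  have bound: "dist_pow p (x, z) \<le> ennreal (w a) * dist_pow p (x, y) + ?\<beta> + ennreal (w c) * dist_pow p (y', z)"
    if "i \<in> cells" "y \<in> cell i" "y' \<in> cell i" for i x y y' z
  proof -
    have "dist x z \<le> dist x y + \<delta> + dist y' z"
      using cell_dist[OF that] dist_triangle[of x z y] dist_triangle[of y z y'] by linarith
    then have "dist x z powr p \<le> (dist x y + \<delta> + dist y' z) powr p"
      using p by (intro powr_mono2) auto
    also have "\<dots> \<le> w a * dist x y powr p + w \<delta> * \<delta> powr p + w c * dist y' z powr p"
      using powr_sum3_weighted[OF p, of "dist x y" \<delta> "dist y' z" a \<delta> c] a(1) c(1) \<delta>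
      by (simp add: w_def S_def distrib_left mult.assoc)
    finally have "dist_pow p (x, z) \<le> ennreal (w a * dist x y powr p + w \<delta> * \<delta> powr p + w c * dist y' z powr p)"
      unfolding fst_conv snd_conv by (rule ennreal_leI)
    also have "\<dots> = ennreal (w a) * dist_pow p (x, y) + ?\<beta> + ennreal (w c) * dist_pow p (y', z)"
      unfolding fst_conv snd_conv using w_nonneg by (simp add: ennreal_mult')
    finally show ?thesis .
  qed
  have "transport_cost p glued \<le> (\<integral>\<^sup>+\<omega>. ?T \<omega> \<partial>P)"
    unfolding transport_cost_def
  proof (rule nn_integral_mono_AE)
    show "AE \<omega> in P. (\<integral>\<^sup>+z\<in>UNIV \<times> B0. dist_pow p z \<partial>glued \<omega>) \<le> ?T \<omega>"
      using AE_good
    proof eventually_elim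
      fix \<omega> assume g: "good \<omega>"
      interpret gluing cells cell "\<Lambda> \<omega>" "\<xi> \<omega>" "M \<omega>" "q1 \<omega>" "q2 \<omega>" by (rule good_gluing[OF g])
      have mq: "(\<lambda>u. dist_pow p u * indicator C u) \<in> borel_measurable (q1 \<omega>)" "(\<lambda>u. dist_pow p u * indicator C u) \<in> borel_measurable (q2 \<omega>)"
        if "C \<in> sets borel" for C
        using that sets_q_borel by (auto intro!: borel_measurable_times_ennreal borel_measurable_indicator dist_powr_measurable cong: measurable_cong_sets)
      have UB: "(UNIV :: 'a set) \<times> B \<in> sets borel" if "B \<in> sets borel" for B :: "'a set" using that by (intro borel_Times) auto
      have "(\<integral>\<^sup>+z\<in>UNIV \<times> B0. dist_pow p z \<partial>glued \<omega>) \<le>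
        (\<integral>\<^sup>+i. (\<integral>\<^sup>+u\<in>UNIV \<times> cell i. ennreal (w a) * dist_pow p u \<partial>q1 \<omega>) * emeasure (q2 \<omega>) (cell i \<times> B0) / emeasure (\<xi> \<omega>) (cell i) \<partial>count_space cells)
        + ?\<beta> * emeasure (M \<omega>) B0 + (\<integral>\<^sup>+v\<in>UNIV \<times> B0. ennreal (w c) * dist_pow p v \<partial>q2 \<omega>)"
        unfolding glued_def if_P[OF g]
        by (rule glue_cost_le[OF dist_powr_measurable
            borel_measurable_times_ennreal[OF borel_measurable_const dist_powr_measurable]
            borel_measurable_times_ennreal[OF borel_measurable_const dist_powr_measurable] B0_borel bound])
      also have "(\<integral>\<^sup>+v\<in>UNIV \<times> B0. ennreal (w c) * dist_pow p v \<partial>q2 \<omega>) = ennreal (w c) * ?C \<omega>"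
        using mq(2)[OF UB[OF B0_borel]] by (simp add: mult.assoc nn_integral_cmult)
      also have "(\<integral>\<^sup>+i. (\<integral>\<^sup>+u\<in>UNIV \<times> cell i. ennreal (w a) * dist_pow p u \<partial>q1 \<omega>) * emeasure (q2 \<omega>) (cell i \<times> B0) / emeasure (\<xi> \<omega>) (cell i) \<partial>count_space cells)
         = (\<integral>\<^sup>+i. ennreal (w a) * (cell_cost p i \<omega> / emeasure (\<xi> \<omega>) (cell i) * emeasure (q2 \<omega>) ((cell i \<inter> UNIV) \<times> B0)) \<partial>count_space cells)"
        unfolding cell_cost_def using mq(1)[OF UB[OF cell_borel]]
        by (intro nn_integral_cong) (simp add: mult.assoc nn_integral_cmult divide_ennreal_def mult.commute mult.left_commute)
      also have "\<dots> = ennreal (w a) * ?A \<omega>"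
        by (subst nn_integral_avg_cost) (auto simp: nn_integral_cmult)
      finally show "(\<integral>\<^sup>+z\<in>UNIV \<times> B0. dist_pow p z \<partial>glued \<omega>) \<le> ?T \<omega>" .
    qed
  qed
  also have "\<dots> = ennreal (w a) * (\<integral>\<^sup>+\<omega>. ?A \<omega> \<partial>P)
      + ?\<beta> * (\<integral>\<^sup>+\<omega>. emeasure (M \<omega>) B0 \<partial>P) + ennreal (w c) * transport_cost p q2"
  proof -
    have m3: "(\<lambda>\<omega>. \<integral>\<^sup>+v\<in>UNIV \<times> B0. dist_pow p v \<partial>q2 \<omega>) \<in> borel_measurable P"
      by (intro nn_integral_random_measurable2[OF q_random_equivariant(3)] borel_measurable_times_ennreal dist_powr_measurable borel_measurable_indicator borel_Times) auto
    have m1: "(\<lambda>\<omega>. \<integral>\<^sup>+v\<in>UNIV \<times> B0. avg_cost p \<omega> v \<partial>q2 \<omega>) \<in> borel_measurable P"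
      by (rule avg_cost_set_measurable) auto
    note m2 = emeasure_random_measurable[OF M(1) B0_borel]
    show ?thesis unfolding transport_cost_def using m1 m2 m3
      by (simp add: nn_integral_add nn_integral_cmult borel_measurable_times_ennreal borel_measurable_add)
  qed
  also have "\<dots> \<le> ennreal (w a) * ennreal (a powr p) + ?\<beta> * 1 + ennreal (w c) * ennreal (c powr p)"
    using order_trans[OF expectation_avg_cost_le a(2)] c(2) M(3)
    by (intro add_mono mult_left_mono) (auto simp: intensity_def)
  also have "\<dots> = ennreal (w a * a powr p + w \<delta> * \<delta> powr p + w c * c powr p)"
    using w_nonneg by (simp add: ennreal_mult')
  also have "w a * a powr p + w \<delta> * \<delta> powr p + w c * c powr p = S powr (p - 1) * S"
    using w_mult[OF a(1)] w_mult[OF \<delta>] w_mult[OF c(1)] by (simp add: S_def distrib_left)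
  also have "\<dots> = S powr p" using S by (simp add: powr_diff)
  finally show ?thesis by (simp add: S_def)
qed

end

section \<open>Vanishing distance and the triangle inequality\<close>

text \<open>Finite intersections of the compact closures of sets from a countable basis. By local compactness
  every open set is a countable union of such closures.\<close>
lemma countable_compact_generator:
  assumes locally_compact: "locally_compact_type TYPE('x::{metric_space, second_countable_topology})"
  obtains \<K> :: "'x::{metric_space, second_countable_topology} set set"
  where "countable \<K>" "Int_stable \<K>" "\<And>K. K \<in> \<K> \<Longrightarrow> compact K" "sigma_sets UNIV \<K> = sets borel" "\<Union>\<K> = UNIV"
proof -
  obtain B :: "'x set set" where B: "countable B" "topological_basis B"
    using ex_countable_basis by blast
  define \<C> where "\<C> = {C \<in> closure ` B. compact C}"
  have \<C>: "countable \<C>" unfolding \<C>_def using B(1) by (rule countable_subset[rotated, OF countable_image]) auto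
  define \<K> where "\<K> = Inter ` {F. finite F \<and> F \<subseteq> \<C> \<and> F \<noteq> {}}"
  have \<C>_sub: "C \<in> \<K>" if "C \<in> \<C>" for C
    unfolding \<K>_def using that by (intro image_eqI[of _ _ "{C}"]) auto
  have open_UN: "U = \<Union>{C \<in> \<C>. C \<subseteq> U}" if U: "open U" for U :: "'x set"
  proof
    show "U \<subseteq> \<Union>{C \<in> \<C>. C \<subseteq> U}"
    proof
      fix x assume x: "x \<in> U"
      obtain W K where W: "open W" "compact K" "x \<in> W" "W \<subseteq> K" using locally_compact_typeE[OF locally_compact] .
      obtain r where r: "0 < r" "cball x r \<subseteq> U \<inter> W"
        using open_contains_cball[of "U \<inter> W"] U W x by blast
      obtain b where b: "b \<in> B" "x \<in> b" "b \<subseteq> ball x r"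
        using topological_basisE[OF B(2), of "ball x r" x] r by auto
      have "closure b \<subseteq> cball x r" using b(3) by (meson ball_subset_cball closed_cball closure_minimal order_trans)
      then have c: "closure b \<subseteq> U" "closure b \<subseteq> K" using r W(4) by auto
      then have "compact (closure b)" using W(2) by (metis closed_closure compact_Int_closed inf.absorb_iff2)
      then have "closure b \<in> {C \<in> \<C>. C \<subseteq> U}" using b(1) c(1) by (auto simp: \<C>_def)
      then show "x \<in> \<Union>{C \<in> \<C>. C \<subseteq> U}" using b(2) closure_subset[of b] by blast
    qed
  qed blast
  show ?thesis
  proof (rule that[of \<K>])
    have "countable {F. finite F \<and> F \<subseteq> \<C> \<and> F \<noteq> {}}"
      by (rule countable_subset[OF _ countable_Collect_finite_subset[OF \<C>]]) auto
    then show "countable \<K>" unfolding \<K>_def by simp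
    show "Int_stable \<K>"
      unfolding Int_stable_def
    proof (intro ballI)
      fix a b assume "a \<in> \<K>" "b \<in> \<K>"
      then obtain F F' where "a = \<Inter>F" "b = \<Inter>F'" "finite F" "F \<subseteq> \<C>" "F \<noteq> {}" "finite F'" "F' \<subseteq> \<C>"
        unfolding \<K>_def by blast
      then show "a \<inter> b \<in> \<K>" unfolding \<K>_def by (intro image_eqI[of _ _ "F \<union> F'"]) auto
    qed
    show compact: "compact K" if "K \<in> \<K>" for K
    proof -
      obtain F where F: "K = \<Inter>F" "F \<subseteq> \<C>" "F \<noteq> {}" using \<open>K \<in> \<K>\<close> unfolding \<K>_def by auto
      then obtain C where "C \<in> F" by blast
      have "closed K" unfolding F(1) using F(2) by (intro closed_Inter) (auto simp: \<C>_def)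
      moreover have "compact C" "K \<subseteq> C" using F \<open>C \<in> F\<close> by (auto simp: \<C>_def)
      ultimately show ?thesis by (metis compact_Int_closed inf.absorb_iff2)
    qed
    show "sigma_sets UNIV \<K> = sets borel"
    proof
      show "sigma_sets UNIV \<K> \<subseteq> sets borel"
        using compact by (intro sets.sigma_sets_subset'[of _ borel, simplified]) (auto intro!: borel_closed compact_imp_closed)
      have "U \<in> sigma_sets UNIV \<K>" if U: "open U" for U
      proof -
        have "\<Union>{C \<in> \<C>. C \<subseteq> U} \<in> sigma_sets UNIV \<K>"
          using \<C> \<C>_sub by (intro sigma_sets_UNION) (auto intro: countable_subset[OF _ \<C>])
        then show ?thesis using open_UN[OF U] by simp
      qed
      then show "sets borel \<subseteq> sigma_sets UNIV \<K>" unfolding borel_def by (auto intro!: sigma_sets_mono)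
    qed
    show "\<Union>\<K> = UNIV" using open_UN[OF open_UNIV] \<C>_sub by auto
  qed
qed

context equivariant_flow
begin

lemma wasserstein_lessD:
  assumes p: "1 \<le> p" and less: "wasserstein p P G \<theta> B0 \<Lambda> M < ennreal a" and a: "0 \<le> a"
  obtains q where "q \<in> equivariant_semicouplings P G \<theta> \<Lambda> M" "transport_cost p q < ennreal (a powr p)"
proof -
  define C where "C = wasserstein_pow p P G \<theta> B0 \<Lambda> M"
  have C: "C \<noteq> \<infinity>" "ennreal (enn2real C powr (1 / p)) < ennreal a"
    using less by (auto simp: wasserstein_def C_def[symmetric] Let_def split: if_splits)
  then have "enn2real C powr (1 / p) < a" by (simp add: ennreal_less_iff)
  then have "(enn2real C powr (1 / p)) powr p < a powr p" using p by (intro powr_less_mono2) auto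
  then have "enn2real C < a powr p" using p by (simp add: powr_powr)
  then have "ennreal (enn2real C) < ennreal (a powr p)" by (simp add: ennreal_less_iff)
  then have "C < ennreal (a powr p)" using C(1) by (simp add: less_top)
  then obtain q where "q \<in> equivariant_semicouplings P G \<theta> \<Lambda> M" "transport_cost p q < ennreal (a powr p)"
    unfolding C_def wasserstein_pow_eq INF_less_iff by blast
  then show ?thesis by (rule that)
qed

lemma wasserstein_leI:
  assumes p: "1 \<le> p" and q: "q \<in> equivariant_semicouplings P G \<theta> \<Lambda> M" and a: "0 \<le> a"
    and cost: "transport_cost p q \<le> ennreal (a powr p)"
  shows "wasserstein p P G \<theta> B0 \<Lambda> M \<le> ennreal a"
proof -
  define C where "C = wasserstein_pow p P G \<theta> B0 \<Lambda> M"
  have C: "C \<le> ennreal (a powr p)" unfolding C_def wasserstein_pow_eq using INF_lower[OF q, of "transport_cost p"] cost by (rule order_trans)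
  then have "C \<noteq> \<infinity>" by (auto simp: top_unique)
  moreover have "enn2real C powr (1 / p) \<le> (a powr p) powr (1 / p)"
    using p C by (intro powr_mono2 enn2real_leI) auto
  then have "enn2real C powr (1 / p) \<le> a" using p a by (simp add: powr_powr)
  ultimately show ?thesis by (simp add: wasserstein_def C_def[symmetric] Let_def ennreal_leI)
qed

text \<open>Almost optimal semicouplings are glued, and the diameter of the cells tends to zero together with
  the optimality gaps.\<close>
lemma wasserstein_triangle:
  assumes p: "1 \<le> p"
    and \<Lambda>: "random_measure P \<Lambda>" "equivariant G \<theta> \<Lambda>" "intensity P B0 \<Lambda> = 1"
    and \<xi>: "random_measure P \<xi>" "equivariant G \<theta> \<xi>" "intensity P B0 \<xi> = 1"
    and M: "random_measure P M" "equivariant G \<theta> M" "intensity P B0 M = 1"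
  shows "wasserstein p P G \<theta> B0 \<Lambda> M \<le> wasserstein p P G \<theta> B0 \<Lambda> \<xi> + wasserstein p P G \<theta> B0 \<xi> M"
proof (rule ennreal_le_epsilon)
  fix e :: real assume e: "0 < e"
  assume "wasserstein p P G \<theta> B0 \<Lambda> \<xi> + wasserstein p P G \<theta> B0 \<xi> M < \<top>"
  then have fin: "wasserstein p P G \<theta> B0 \<Lambda> \<xi> < \<top>" "wasserstein p P G \<theta> B0 \<xi> M < \<top>" by (auto simp: less_top)
  obtain w1 where w1: "0 \<le> w1" "wasserstein p P G \<theta> B0 \<Lambda> \<xi> = ennreal w1" using fin(1) by (cases "wasserstein p P G \<theta> B0 \<Lambda> \<xi>") auto
  obtain w2 where w2: "0 \<le> w2" "wasserstein p P G \<theta> B0 \<xi> M = ennreal w2" using fin(2) by (cases "wasserstein p P G \<theta> B0 \<xi> M") auto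
  define d where "d = e / 3"
  have d: "0 < d" using e by (simp add: d_def)
  obtain r1 where r1: "r1 \<in> equivariant_semicouplings P G \<theta> \<Lambda> \<xi>" "transport_cost p r1 < ennreal ((w1 + d) powr p)"
    using wasserstein_lessD[OF p, of \<Lambda> \<xi> "w1 + d"] w1 d by (auto simp: ennreal_less_iff)
  obtain r2 where r2: "r2 \<in> equivariant_semicouplings P G \<theta> \<xi> M" "transport_cost p r2 < ennreal ((w2 + d) powr p)"
    using wasserstein_lessD[OF p, of \<xi> M "w2 + d"] w2 d by (auto simp: ennreal_less_iff)
  obtain E :: "nat \<Rightarrow> 'a set" where E: "\<And>j. E j \<in> sets borel" "disjoint_family E" "(\<Union>j. E j) = B0"
    "\<And>j x y. x \<in> E j \<Longrightarrow> y \<in> E j \<Longrightarrow> dist x y \<le> d"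
    by (rule small_diameter_partition[OF B0_borel d], rule that, assumption+)
  interpret equivariant_gluing G B0 P \<theta> \<Lambda> \<xi> M r1 r2 E d
    by unfold_locales (use \<Lambda> \<xi> M r1 r2 E d in auto)
  have "transport_cost p glued \<le> ennreal (((w1 + d) + d + (w2 + d)) powr p)"
    using r1(2) r2(2) w1(1) w2(1) d by (intro transport_cost_glued_le[OF p]) auto
  then have "wasserstein p P G \<theta> B0 \<Lambda> M \<le> ennreal ((w1 + d) + d + (w2 + d))"
    using w1 w2 d by (intro wasserstein_leI[OF p glued_semicoupling]) auto
  also have "(w1 + d) + d + (w2 + d) = w1 + w2 + e" by (simp add: d_def)
  finally show "wasserstein p P G \<theta> B0 \<Lambda> M \<le> wasserstein p P G \<theta> B0 \<Lambda> \<xi> + wasserstein p P G \<theta> B0 \<xi> M + ennreal e"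
    using w1 w2 e by simp
qed

text \<open>The diagonal coupling of \<open>\<Lambda>\<close> with itself has no cost. It is equivariant because \<open>\<Lambda>\<close> is.\<close>
lemma wasserstein_self:
  assumes p: "1 \<le> p" and \<Lambda>: "random_measure P \<Lambda>" "equivariant G \<theta> \<Lambda>"
    and eq: "AE \<omega> in P. \<Lambda> \<omega> = M \<omega>"
  shows "wasserstein p P G \<theta> B0 \<Lambda> M = 0"
proof -
  define q where "q \<omega> = distr (\<Lambda> \<omega>) borel (\<lambda>x. (x, x))" for \<omega>
  have diag: "(\<lambda>x::'a. (x, x)) \<in> borel \<rightarrow>\<^sub>M borel" by (intro borel_measurable_continuous_onI continuous_intros)
  have diag': "(\<lambda>x::'a. (x, x)) \<in> \<Lambda> \<omega> \<rightarrow>\<^sub>M borel" for \<omega>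
    using diag random_measure_sets(1)[OF \<Lambda>(1)] by (simp cong: measurable_cong_sets)
  have em: "emeasure (q \<omega>) C = emeasure (\<Lambda> \<omega>) {x. (x, x) \<in> C}" if "C \<in> sets borel" for \<omega> C
    unfolding q_def using that random_measure_sets(2)[OF \<Lambda>(1)] by (subst emeasure_distr[OF diag']) (auto simp: vimage_def)
  have pre: "{x. (x, x) \<in> C} \<in> sets borel" if "C \<in> sets borel" for C :: "('a \<times> 'a) set"
    using measurable_sets[OF diag that] by (simp add: vimage_def)
  have "random_measure P q"
  proof (rule random_measureI[OF locally_compact_prod])
    show "(\<lambda>\<omega>. emeasure (q \<omega>) C) \<in> borel_measurable P" if "C \<in> sets borel" for C
      unfolding em[OF that] by (rule emeasure_random_measurable[OF \<Lambda>(1) pre[OF that]])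
    show "q \<omega> \<in> radon_measures" for \<omega>
      unfolding radon_measures_def
    proof (intro CollectI conjI allI impI)
      fix K :: "('a \<times> 'a) set" assume K: "compact K"
      have F: "compact (fst ` K)" by (intro compact_continuous_image K continuous_intros)
      have "emeasure (q \<omega>) K = emeasure (\<Lambda> \<omega>) {x. (x, x) \<in> K}" using compact_imp_closed[OF K] by (intro em) auto
      also have "\<dots> \<le> emeasure (\<Lambda> \<omega>) (fst ` K)"
        using compact_imp_closed[OF F] random_measure_sets(1)[OF \<Lambda>(1)] by (intro emeasure_mono) (auto intro: rev_image_eqI)
      also have "\<dots> < \<infinity>" using radon_measuresD(3)[OF random_measure_radon[OF \<Lambda>(1)] F] by (simp add: space_P)
      finally show "emeasure (q \<omega>) K < \<infinity>" .
    qed (simp add: q_def)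
  qed
  moreover have "equivariant2 G \<theta> q"
    unfolding equivariant2_def
  proof (intro ballI allI)
    fix g \<omega> and A B :: "'a set" assume g: "g \<in> G" and AB: "A \<in> sets borel" "B \<in> sets borel"
    have "inj g" using group_bij[OF g] by (simp add: bij_def)
    then have "{x. (x, x) \<in> g ` A \<times> g ` B} = g ` (A \<inter> B)" by (auto simp: image_Int)
    moreover have "{x. (x, x) \<in> A \<times> B} = A \<inter> B" by auto
    moreover have "A \<inter> B \<in> sets borel" using AB by auto
    ultimately show "emeasure (q (\<theta> g \<omega>)) (g ` A \<times> g ` B) = emeasure (q \<omega>) (A \<times> B)"
      using \<Lambda>(2) g AB by (simp add: em borel_Times group_image_borel equivariant_def)
  qed
  moreover have "AE \<omega> in P. semicoupling (\<Lambda> \<omega>) (M \<omega>) (q \<omega>)"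
    using eq
  proof eventually_elim
    fix \<omega> assume e: "\<Lambda> \<omega> = M \<omega>"
    have "sets (q \<omega>) = sets borel" by (simp add: q_def)
    moreover have "emeasure (q \<omega>) (A \<times> UNIV) = emeasure (\<Lambda> \<omega>) A" "emeasure (q \<omega>) (UNIV \<times> A) = emeasure (\<Lambda> \<omega>) A"
      if "A \<in> sets borel" for A
      using that by (simp_all add: em borel_Times)
    ultimately have "coupling (\<Lambda> \<omega>) (\<Lambda> \<omega>) (q \<omega>)"
      using random_measure_sets(1)[OF \<Lambda>(1)] by (intro couplingI) auto
    then show "semicoupling (\<Lambda> \<omega>) (M \<omega>) (q \<omega>)" using e by (simp add: coupling_imp_semicoupling)
  qed
  ultimately have q: "q \<in> equivariant_semicouplings P G \<theta> \<Lambda> M" by (simp add: equivariant_semicouplings_def)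
  have "(\<integral>\<^sup>+z\<in>UNIV \<times> B0. dist_pow p z \<partial>q \<omega>) = 0" for \<omega>
  proof -
    have "UNIV \<times> B0 \<in> sets (borel :: ('a \<times> 'a) measure)" by (intro borel_Times) auto
    then have "(\<lambda>z::'a \<times> 'a. dist_pow p z * indicator (UNIV \<times> B0) z) \<in> borel_measurable borel"
      by (intro borel_measurable_times_ennreal dist_powr_measurable borel_measurable_indicator)
    then show ?thesis unfolding q_def by (subst nn_integral_distr[OF diag']) auto
  qed
  then have "transport_cost p q = 0" by (simp add: transport_cost_def)
  then have "wasserstein p P G \<theta> B0 \<Lambda> M \<le> ennreal 0"
    by (intro wasserstein_leI[OF p q]) auto
  then show ?thesis by simp
qed

lemma transport_cost_cell:
  assumes q: "random_measure P q" "equivariant2 G \<theta> q" and g: "g \<in> G"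
  shows "(\<integral>\<^sup>+\<omega>. (\<integral>\<^sup>+z\<in>g ` B0 \<times> UNIV. dist_pow p z \<partial>q \<omega>) \<partial>P) = transport_cost p q"
proof -
  have "(\<integral>\<^sup>+z\<in>g ` B0 \<times> g ` UNIV. dist_pow p z \<partial>q (\<theta> g \<omega>)) = (\<integral>\<^sup>+z\<in>B0 \<times> UNIV. dist_pow p (map_prod g g z) \<partial>q \<omega>)" for \<omega>
    by (rule nn_integral_equivariant2[OF q g dist_powr_measurable B0_borel]) simp
  then have shift: "(\<integral>\<^sup>+z\<in>g ` B0 \<times> UNIV. dist_pow p z \<partial>q (\<theta> g \<omega>)) = (\<integral>\<^sup>+z\<in>B0 \<times> UNIV. dist_pow p z \<partial>q \<omega>)" for \<omega>
    using group_bij[OF g] g by (simp add: bij_def map_prod_def split_beta)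
  have "(\<lambda>z. dist_pow p z * indicator (g ` B0 \<times> UNIV) z) \<in> borel_measurable borel"
    using group_image_borel[OF g B0_borel]
    by (intro borel_measurable_times_ennreal dist_powr_measurable borel_measurable_indicator borel_Times) auto
  then have "(\<integral>\<^sup>+\<omega>. (\<integral>\<^sup>+z\<in>g ` B0 \<times> UNIV. dist_pow p z \<partial>q \<omega>) \<partial>P) = (\<integral>\<^sup>+\<omega>. (\<integral>\<^sup>+z\<in>g ` B0 \<times> UNIV. dist_pow p z \<partial>q (\<theta> g \<omega>)) \<partial>P)"
    by (intro nn_integral_flow[OF g, symmetric] nn_integral_random_measurable2[OF q(1)])
  then show ?thesis unfolding shift transport_cost_fst[OF q] .
qed

text \<open>Mass of \<open>\<Lambda>\<close> on a part of \<open>K\<close> that is covered by finitely many cells either lands in the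
  \<open>e\<close>-neighbourhood of \<open>K\<close>, where it is mass of \<open>M\<close>, or travels at least the distance \<open>e\<close>. By Markov's
  inequality the expected mass of the second kind is at most the number of cells times \<open>e powr (- p)\<close>
  times the cost, and the cost can be chosen arbitrarily small. Finitely many cells keep the
  bound finite.\<close>
lemma wasserstein_zero_thickening:
  assumes p: "1 \<le> p"
    and \<Lambda>: "random_measure P \<Lambda>" "equivariant G \<theta> \<Lambda>" "intensity P B0 \<Lambda> = 1"
    and M: "random_measure P M" "intensity P B0 M = 1"
    and zero: "wasserstein p P G \<theta> B0 \<Lambda> M = 0"
    and F: "finite F" "F \<subseteq> G" and K: "K \<in> sets borel" and e: "0 < e"
  shows "AE \<omega> in P. emeasure (\<Lambda> \<omega>) (K \<inter> (\<Union>g\<in>F. g ` B0)) \<le> emeasure (M \<omega>) (\<Union>x\<in>K. ball x e)"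
proof -
  define A where "A = K \<inter> (\<Union>g\<in>F. g ` B0)"
  define N where "N = (\<Union>x\<in>K. ball x e)"
  define c where "c = real (card F) * e powr (- p)"
  have A: "A \<in> sets borel"
    unfolding A_def using K F group_image_borel[OF _ B0_borel] by (intro sets.Int sets.finite_UN) auto
  have N: "N \<in> sets borel" unfolding N_def by (intro borel_open) auto
  note [measurable] = emeasure_random_measurable[OF \<Lambda>(1) A] emeasure_random_measurable[OF M(1) N]
  let ?D = "\<lambda>\<omega>. emeasure (\<Lambda> \<omega>) A - emeasure (M \<omega>) N"
  have bound: "(\<integral>\<^sup>+\<omega>. ?D \<omega> \<partial>P) \<le> ennreal c * transport_cost p q"
    if q: "q \<in> equivariant_semicouplings P G \<theta> \<Lambda> M" for q
  proof -
    have q': "random_measure P q" "equivariant2 G \<theta> q" using q by (auto simp: equivariant_semicouplings_def)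
    note s = random_measure_sets(1)[OF q'(1)]
    have meas: "(\<lambda>z. dist_pow p z * indicator (g ` B0 \<times> UNIV) z) \<in> borel_measurable borel" if "g \<in> G" for g
      using group_image_borel[OF that B0_borel]
      by (intro borel_measurable_times_ennreal dist_powr_measurable borel_measurable_indicator borel_Times) auto
    let ?R = "\<lambda>g \<omega>. ennreal (e powr (- p)) * (\<integral>\<^sup>+z\<in>g ` B0 \<times> UNIV. dist_pow p z \<partial>q \<omega>)"
    have "(\<integral>\<^sup>+\<omega>. ?D \<omega> \<partial>P)
      \<le> (\<integral>\<^sup>+\<omega>. (\<Sum>g\<in>F. ?R g \<omega>) \<partial>P)"
    proof (rule nn_integral_mono_AE)
      show "AE \<omega> in P. ?D \<omega> \<le> (\<Sum>g\<in>F. ?R g \<omega>)"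
        using AE_coupling[OF \<Lambda> M q] AE_finite_cells[OF \<Lambda>]
      proof eventually_elim
        fix \<omega> assume c: "coupling (\<Lambda> \<omega>) (M \<omega>) (q \<omega>)" and fin: "\<forall>g\<in>G. emeasure (\<Lambda> \<omega>) (g ` B0) \<noteq> \<infinity>"
        have cells: "g ` B0 \<in> sets (\<Lambda> \<omega>)" if "g \<in> F" for g
          using that F(2) group_image_borel[OF _ B0_borel] random_measure_sets(1)[OF \<Lambda>(1)] by auto
        have "emeasure (\<Lambda> \<omega>) A \<le> emeasure (\<Lambda> \<omega>) (\<Union>g\<in>F. g ` B0)"
          using cells F(1) by (intro emeasure_mono sets.finite_UN) (auto simp: A_def)
        also have "\<dots> \<le> (\<Sum>g\<in>F. emeasure (\<Lambda> \<omega>) (g ` B0))"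
          using cells by (intro emeasure_subadditive_finite F(1)) auto
        also have "\<dots> < \<infinity>" using fin F by (auto simp: less_top)
        \<comment> \<open>Finiteness matters: in \<^typ>\<open>ennreal\<close> the difference \<open>\<infinity> - \<infinity>\<close> is \<open>\<infinity>\<close>.\<close>
        finally have A_fin: "emeasure (\<Lambda> \<omega>) A \<noteq> \<top>" by simp
        have S: "A \<times> (- N) \<in> sets (q \<omega>)" "UNIV \<times> N \<in> sets (q \<omega>)" "A \<times> UNIV \<in> sets (q \<omega>)"
          using A N s by (auto intro!: borel_Times)
        have "emeasure (\<Lambda> \<omega>) A = emeasure (q \<omega>) (A \<times> UNIV)" by (rule couplingD(2)[OF c A, symmetric])
        also have "\<dots> \<le> emeasure (q \<omega>) (UNIV \<times> N \<union> A \<times> (- N))" using S by (intro emeasure_mono) auto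
        also have "\<dots> \<le> emeasure (q \<omega>) (UNIV \<times> N) + emeasure (q \<omega>) (A \<times> (- N))" using S by (intro emeasure_subadditive) auto
        also have "emeasure (q \<omega>) (UNIV \<times> N) = emeasure (M \<omega>) N" by (rule couplingD(3)[OF c N])
        also have "emeasure (q \<omega>) (A \<times> (- N)) = (\<integral>\<^sup>+z. indicator (A \<times> (- N)) z \<partial>q \<omega>)" using S by simp
        also have "\<dots> \<le> (\<integral>\<^sup>+z. (\<Sum>g\<in>F. ennreal (e powr (- p)) * (dist_pow p z * indicator (g ` B0 \<times> UNIV) z)) \<partial>q \<omega>)"
        proof (rule nn_integral_mono)
          fix z :: "'a \<times> 'a"
          show "indicator (A \<times> (- N)) z \<le> (\<Sum>g\<in>F. ennreal (e powr (- p)) * (dist_pow p z * indicator (g ` B0 \<times> UNIV) z))"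
          proof (cases "z \<in> A \<times> (- N)")
            case True
            then obtain x y where z: "z = (x, y)" "x \<in> A" "y \<notin> N" by auto
            then obtain g where g: "g \<in> F" "x \<in> g ` B0" "x \<in> K" unfolding A_def by blast
            have "e \<le> dist x y" using z(3) g(3) unfolding N_def by auto
            then have "e powr p \<le> dist x y powr p" using p e by (intro powr_mono2) auto
            then have "1 \<le> e powr (- p) * dist x y powr p" using e by (simp add: powr_minus field_simps)
            then have "1 \<le> ennreal (e powr (- p) * dist x y powr p)" by simp
            also have "\<dots> = ennreal (e powr (- p)) * (dist_pow p z * indicator (g ` B0 \<times> UNIV) z)"
              using z g by (simp add: ennreal_mult')
            also have "\<dots> \<le> (\<Sum>g\<in>F. ennreal (e powr (- p)) * (dist_pow p z * indicator (g ` B0 \<times> UNIV) z))"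
              using F(1) g(1) by (intro member_le_sum) auto
            finally show ?thesis using True by simp
          qed simp
        qed
        also have "\<dots> = (\<Sum>g\<in>F. ?R g \<omega>)"
          using meas F(2) s by (subst nn_integral_sum) (auto simp: nn_integral_cmult subset_iff cong: measurable_cong_sets intro!: sum.cong)
        finally show "?D \<omega> \<le> (\<Sum>g\<in>F. ?R g \<omega>)"
          using A_fin by (simp add: ennreal_minus_le_iff)
      qed
    qed
    also have "\<dots> = (\<Sum>g\<in>F. ennreal (e powr (- p)) * (\<integral>\<^sup>+\<omega>. (\<integral>\<^sup>+z\<in>g ` B0 \<times> UNIV. dist_pow p z \<partial>q \<omega>) \<partial>P))"
    proof -
      have "(\<lambda>\<omega>. \<integral>\<^sup>+z\<in>g ` B0 \<times> UNIV. dist_pow p z \<partial>q \<omega>) \<in> borel_measurable P" if "g \<in> F" for g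
        using that F(2) by (intro nn_integral_random_measurable2[OF q'(1) meas]) auto
      then show ?thesis by (simp add: nn_integral_sum nn_integral_cmult cong: sum.cong)
    qed
    also have "\<dots> = (\<Sum>g\<in>F. ennreal (e powr (- p)) * transport_cost p q)"
      using F(2) by (intro sum.cong arg_cong2[where f = "(*)"] refl transport_cost_cell q') auto
    also have "\<dots> = ennreal c * transport_cost p q"
      by (simp add: c_def ennreal_mult' ennreal_of_nat_eq_real_of_nat mult.assoc)
    finally show ?thesis .
  qed
  have "(\<integral>\<^sup>+\<omega>. ?D \<omega> \<partial>P) \<le> 0"
  proof (rule ennreal_le_epsilon)
    fix d :: real assume d: "0 < d"
    have c0: "0 \<le> c" by (simp add: c_def)
    \<comment> \<open>A coupling of cost below \<open>t powr p = d / (c + 1)\<close> makes the bound smaller than \<open>d\<close>.\<close>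
    define t where "t = (d / (c + 1)) powr (1 / p)"
    have t: "0 < t" "t powr p = d / (c + 1)" using d c0 p by (auto simp: t_def powr_powr)
    obtain q where q: "q \<in> equivariant_semicouplings P G \<theta> \<Lambda> M" "transport_cost p q < ennreal (t powr p)"
      using wasserstein_lessD[OF p, of \<Lambda> M t] zero t(1) by auto
    have "(\<integral>\<^sup>+\<omega>. ?D \<omega> \<partial>P) \<le> ennreal c * ennreal (d / (c + 1))"
      using bound[OF q(1)] q(2) unfolding t(2) by (meson less_imp_le mult_left_mono order_trans zero_le)
    also have "\<dots> = ennreal (c * (d / (c + 1)))" using c0 d by (intro ennreal_mult[symmetric]) auto
    also have "\<dots> \<le> ennreal d" using c0 d by (intro ennreal_leI) (simp add: field_simps)
    finally show "(\<integral>\<^sup>+\<omega>. ?D \<omega> \<partial>P) \<le> 0 + ennreal d" by simp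
  qed
  then have "(\<integral>\<^sup>+\<omega>. ?D \<omega> \<partial>P) = 0" by simp
  then have "AE \<omega> in P. ?D \<omega> = 0"
    by (subst (asm) nn_integral_0_iff_AE) auto
  then show ?thesis unfolding A_def[symmetric] N_def[symmetric] by eventually_elim (rule ennreal_minus_eq_0)
qed

text \<open>The finitely many cells exhaust \<open>K\<close>, and the neighbourhoods of \<open>K\<close> shrink to \<open>K\<close>. The latter limit needs
  a neighbourhood of finite mass, which exists because \<open>K\<close> has a relatively compact one.\<close>
lemma wasserstein_zero_compact:
  assumes p: "1 \<le> p"
    and \<Lambda>: "random_measure P \<Lambda>" "equivariant G \<theta> \<Lambda>" "intensity P B0 \<Lambda> = 1"
    and M: "random_measure P M" "intensity P B0 M = 1"
    and zero: "wasserstein p P G \<theta> B0 \<Lambda> M = 0" and K: "compact K"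
  shows "AE \<omega> in P. emeasure (\<Lambda> \<omega>) K \<le> emeasure (M \<omega>) K"
proof -
  obtain V :: "nat \<Rightarrow> 'a set" where V: "incseq V" "\<And>n. open (V n)" "\<And>n. compact (closure (V n))" "(\<Union>n. V n) = UNIV"
    by (rule open_exhaustion[OF locally_compact]) (rule that)
  obtain m where m: "K \<subseteq> V m" using compact_subset_exhaustion[OF V(1,2,4) K] by blast
  obtain e where e: "0 < e" "(\<Union>x\<in>K. ball x e) \<subseteq> V m"
    using compact_subset_open_imp_ball_epsilon_subset[OF K V(2) m] by blast
  define N where "N k = (\<Union>x\<in>K. ball x (e / Suc k))" for k
  define F where "F n = from_nat_into G ` {..<n}" for n :: nat
  define A where "A n = K \<inter> (\<Union>g\<in>F n. g ` B0)" for n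
  have G_ne: "G \<noteq> {}" using group_id by blast
  have F: "finite (F n)" "F n \<subseteq> G" for n
    using from_nat_into[OF G_ne] by (auto simp: F_def)
  have Kb: "K \<in> sets borel" using compact_imp_closed[OF K] by simp
  have Ab: "A n \<in> sets borel" for n
    unfolding A_def using Kb F[of n] group_image_borel[OF _ B0_borel] by (intro sets.Int sets.finite_UN) auto
  have A_inc: "incseq A" unfolding A_def F_def by (intro monoI) force
  have A_UN: "(\<Union>n. A n) = K"
  proof
    show "K \<subseteq> (\<Union>n. A n)"
    proof
      fix x assume x: "x \<in> K"
      obtain g where g: "g \<in> G" "x \<in> g ` B0" using cells_cover by blast
      obtain i where "from_nat_into G i = g" using from_nat_into_surj[OF countable_group g(1)] by blast
      then have "x \<in> A (Suc i)" using x g(2) unfolding A_def F_def by blast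
      then show "x \<in> (\<Union>n. A n)" by blast
    qed
  qed (auto simp: A_def)
  have Nb: "N k \<in> sets borel" for k unfolding N_def by (intro borel_open) auto
  have N_dec: "decseq N"
  proof (rule decseq_SucI)
    fix k
    have "e / Suc (Suc k) \<le> e / Suc k" using e(1) by (simp add: frac_le)
    then show "N (Suc k) \<subseteq> N k" unfolding N_def by (intro UN_mono subset_ball) auto
  qed
  have N_INT: "(\<Inter>k. N k) = K"
  proof
    show "(\<Inter>k. N k) \<subseteq> K"
    proof
      fix y assume y: "y \<in> (\<Inter>k. N k)"
      have "\<exists>x\<in>K. dist x y < r" if r: "0 < r" for r
      proof -
        obtain k where k: "e / r < real k" using reals_Archimedean2 by blast
        then have "e / Suc k < r" using r e(1) by (simp add: field_simps)
        moreover obtain x where "x \<in> K" "dist x y < e / Suc k" using y unfolding N_def by auto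
        ultimately show ?thesis by force
      qed
      then have "y \<in> closure K" by (simp add: closure_approachable)
      then show "y \<in> K" using compact_imp_closed[OF K] by simp
    qed
    show "K \<subseteq> (\<Inter>k. N k)" using e(1) by (auto simp: N_def intro!: bexI)
  qed
  have "AE \<omega> in P. \<forall>n k. emeasure (\<Lambda> \<omega>) (A n) \<le> emeasure (M \<omega>) (N k)"
    unfolding AE_all_countable A_def N_def
    using wasserstein_zero_thickening[OF p \<Lambda> M zero F Kb] e(1) by simp
  then show ?thesis
  proof eventually_elim
    fix \<omega> assume le: "\<forall>n k. emeasure (\<Lambda> \<omega>) (A n) \<le> emeasure (M \<omega>) (N k)"
    have Nfin: "emeasure (M \<omega>) (N k) \<noteq> \<infinity>" for k
    proof -
      have "e / Suc k \<le> e" using e(1) by (simp add: divide_le_eq)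
      then have "N k \<subseteq> (\<Union>x\<in>K. ball x e)" unfolding N_def by (intro UN_mono subset_ball) auto
      then have "N k \<subseteq> closure (V m)" using e(2) closure_subset[of "V m"] by blast
      then have "emeasure (M \<omega>) (N k) \<le> emeasure (M \<omega>) (closure (V m))"
        using random_measure_sets(1)[OF M(1)] by (intro emeasure_mono) auto
      also have "\<dots> < \<infinity>"
        using random_measure_radon[OF M(1)] V(3)[of m] by (intro radon_measuresD(3)) (auto simp: space_P)
      finally show ?thesis by simp
    qed
    have "emeasure (\<Lambda> \<omega>) K = (SUP n. emeasure (\<Lambda> \<omega>) (A n))"
      unfolding A_UN[symmetric] using Ab A_inc random_measure_sets(1)[OF \<Lambda>(1)]
      by (intro SUP_emeasure_incseq[symmetric]) auto
    also have "\<dots> \<le> (INF k. emeasure (M \<omega>) (N k))" using le by (intro SUP_least INF_greatest) auto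
    also have "\<dots> = emeasure (M \<omega>) K"
      unfolding N_INT[symmetric] using Nb N_dec Nfin random_measure_sets(1)[OF M(1)]
      by (intro INF_emeasure_decseq) auto
    finally show "emeasure (\<Lambda> \<omega>) K \<le> emeasure (M \<omega>) K" .
  qed
qed

text \<open>Both inequalities between \<open>\<Lambda>\<close> and \<open>M\<close> hold on compact sets, the second one by symmetry of the
  distance. Countably many compact sets determine a Radon measure, which fixes one exceptional
  null set for all of them.\<close>
lemma wasserstein_zero_imp_AE_eq:
  assumes p: "1 \<le> p"
    and \<Lambda>: "random_measure P \<Lambda>" "equivariant G \<theta> \<Lambda>" "intensity P B0 \<Lambda> = 1"
    and M: "random_measure P M" "equivariant G \<theta> M" "intensity P B0 M = 1"
    and zero: "wasserstein p P G \<theta> B0 \<Lambda> M = 0"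
  shows "AE \<omega> in P. \<Lambda> \<omega> = M \<omega>"
proof -
  have zero': "wasserstein p P G \<theta> B0 M \<Lambda> = 0" using zero wasserstein_commute[OF \<Lambda> M] by simp
  obtain \<K> :: "'a set set" where \<K>: "countable \<K>" "Int_stable \<K>" "\<And>K. K \<in> \<K> \<Longrightarrow> compact K"
    "sigma_sets UNIV \<K> = sets borel" "\<Union>\<K> = UNIV"
    by (rule countable_compact_generator[OF locally_compact]) (rule that)
  have "AE \<omega> in P. \<forall>K\<in>\<K>. emeasure (\<Lambda> \<omega>) K \<le> emeasure (M \<omega>) K"
    using wasserstein_zero_compact[OF p \<Lambda> M(1,3) zero \<K>(3)] by (simp add: AE_ball_countable \<K>(1))
  moreover have "AE \<omega> in P. \<forall>K\<in>\<K>. emeasure (M \<omega>) K \<le> emeasure (\<Lambda> \<omega>) K"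
    using wasserstein_zero_compact[OF p M \<Lambda>(1,3) zero' \<K>(3)] by (simp add: AE_ball_countable \<K>(1))
  ultimately show ?thesis
  proof eventually_elim
    fix \<omega> assume le: "\<forall>K\<in>\<K>. emeasure (\<Lambda> \<omega>) K \<le> emeasure (M \<omega>) K" "\<forall>K\<in>\<K>. emeasure (M \<omega>) K \<le> emeasure (\<Lambda> \<omega>) K"
    show "\<Lambda> \<omega> = M \<omega>"
    proof (rule measure_eqI_generator_eq_countable[where E = \<K> and A = \<K> and \<Omega> = UNIV])
      show "emeasure (\<Lambda> \<omega>) K \<noteq> \<infinity>" if "K \<in> \<K>" for K
        using radon_measuresD(3)[OF random_measure_radon[OF \<Lambda>(1)] \<K>(3)[OF that], of \<omega>] by (simp add: space_P less_top)
    qed (use \<K> le random_measure_sets(1)[OF \<Lambda>(1)] random_measure_sets(1)[OF M(1)] in \<open>auto intro: antisym\<close>)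
  qed
qed

end

section \<open>The metric properties of the Wasserstein distance\<close>

lemma completed_borel_probD:
  assumes "completed_borel_prob P"
  shows "prob_space P" "complete_measure P" "space P = UNIV"
proof -
  obtain P0 where P0: "sets P0 = sets borel" "prob_space P0" "P = completion P0"
    using assms by (auto simp: completed_borel_prob_def)
  show "prob_space P" unfolding P0(3) by (rule prob_space.prob_space_completion[OF P0(2)])
  show "complete_measure P" unfolding P0(3) by (rule completion.complete_measure_axioms)
  show "space P = UNIV" using sets_eq_imp_space_eq[OF P0(1)] by (simp add: P0(3))
qed

theorem proposition8p1:
  fixes \<A> :: "('a::polish_space, 'n::finite) chart set"
    and \<gamma> :: "('a, 'n) chart \<Rightarrow> 'a \<Rightarrow> real^'n^'n"
    and m vol :: "'a measure" and s :: real
    and G :: "('a \<Rightarrow> 'a) set"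
    and B0 :: "'a set"
    and P :: "'w::metric_space measure"
    and \<theta> :: "('a \<Rightarrow> 'a) \<Rightarrow> 'w \<Rightarrow> 'w"
    and \<mu> \<Lambda> \<xi> :: "'w \<Rightarrow> 'a measure"
    and p :: real
  assumes "connected_riemannian_manifold \<A> \<gamma>" and "\<not> compact (UNIV :: 'a set)"
    and "isometry_group G" and "properly_discontinuous G" and "cocompact G" and "free_action G"
    and "dirichlet_fundamental_region G B0"
    and "riemannian_volume \<A> \<gamma> vol" and "0 < s" and "m = scale_measure (ennreal s) vol"
    and "emeasure m B0 = 1"
    and "compact (UNIV :: 'w set)" and "completed_borel_prob P"
    and "measurable_flow P G \<theta>" and "stationary P G \<theta>"
    and "1 \<le> p"
    and "\<forall>\<nu>\<in>{\<mu>, \<Lambda>, \<xi>}. random_measure P \<nu> \<and> equivariant G \<theta> \<nu> \<and> intensity P B0 \<nu> = 1"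
    and "wasserstein p P G \<theta> B0 \<Lambda> \<mu> < \<infinity>" and "wasserstein p P G \<theta> B0 \<Lambda> \<xi> < \<infinity>"
    and "wasserstein p P G \<theta> B0 \<xi> \<mu> < \<infinity>"
  shows "(wasserstein p P G \<theta> B0 \<Lambda> \<mu> = 0 \<longleftrightarrow> (AE \<omega> in P. \<Lambda> \<omega> = \<mu> \<omega>)) \<and>
    wasserstein p P G \<theta> B0 \<Lambda> \<mu> = wasserstein p P G \<theta> B0 \<mu> \<Lambda> \<and>
    wasserstein p P G \<theta> B0 \<Lambda> \<mu>
      \<le> wasserstein p P G \<theta> B0 \<Lambda> \<xi> + wasserstein p P G \<theta> B0 \<xi> \<mu>"
proof -
  have "smooth_atlas \<A>" using assms(1) by (simp add: connected_riemannian_manifold_def)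
  then have locally_compact: "locally_compact_type TYPE('a)" by (rule smooth_atlas_locally_compact)
  note P = completed_borel_probD[OF \<open>completed_borel_prob P\<close>]
  have "fundamental_region G B0" using assms(7) by (simp add: dirichlet_fundamental_region_def)
  interpret equivariant_flow G B0 P \<theta>
    using locally_compact P assms(3,4,14,15) \<open>fundamental_region G B0\<close> by (intro equivariant_flow.intro)
  have \<mu>: "random_measure P \<mu>" "equivariant G \<theta> \<mu>" "intensity P B0 \<mu> = 1"
    and \<Lambda>: "random_measure P \<Lambda>" "equivariant G \<theta> \<Lambda>" "intensity P B0 \<Lambda> = 1"
    and \<xi>: "random_measure P \<xi>" "equivariant G \<theta> \<xi>" "intensity P B0 \<xi> = 1"
    using assms(17) by auto
  show ?thesis
    using wasserstein_zero_imp_AE_eq[OF assms(16) \<Lambda> \<mu>] wasserstein_self[OF assms(16) \<Lambda>(1,2), of \<mu>]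
      wasserstein_commute[OF \<Lambda> \<mu>] wasserstein_triangle[OF assms(16) \<Lambda> \<xi> \<mu>]
    by blast
qed

end
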